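(* Let $k\in\mathbb{N}$ and assume $\mu(1/2)<\frac{1}{2k}$. Then: (i) for every $\sigma$ with $1/2<\sigma<\sigma_k$ and every $N\in\mathbb{N}$, $$\limsup_{T\to\infty}\frac{\int_0^T|\zeta(\sigma+it)|^{2k}\sin^2\big(k\theta_{Z_N}(\sigma+it)\big)dt}{M_k(\sigma,T)}=\frac12;$$ (ii) for every $\sigma$ with $\sigma_k<\sigma<1$ and every $\epsilon>0$ there is an $N(\epsilon)$ such that for all $N>N(\epsilon)$, $$\limsup_{T\to\infty}\frac{\int_0^T|\zeta(\sigma+it)|^{2k}\sin^2\big(k\theta_{Z_N}(\sigma+it)\big)dt}{M_k(\sigma,T)}<\epsilon.$$
   Context: $\zeta$ is the Riemann zeta function. $\mu(\sigma)=\inf\{\mu:\zeta(\sigma+it)\ll t^{\mu}\text{ as }t\to\infty\}$. $M_k(\sigma,T)=\int_0^T|\zeta(\sigma+it)|^{2k}\,dt$. For $k\in\mathbb{N}$, $\sigma_k$ is the infimum of the numbers $\sigma_0\in[1/2,1)$ such that $M_k(\sigma,T)\ll T$ (as $T\to\infty$) for every $\sigma_0<\sigma<1$. Thus $1/2\le\sigma_k<1$, $M_k(\sigma,T)\ll T$ for $\sigma_k<\sigma<1$, and $\limsup_{T\to\infty}M_k(\sigma,T)/T=\infty$ for $1/2\le\sigma<\sigma_k$. For $N\in\mathbb{N}$, $$P_N(\sigma+it)=\exp\left(\sum_{2\le n\le N^2}\frac{\Lambda_N(n)}{n^{\sigma+it}\log n}\right),$$ where $\Lambda_N(n)=\Lambda(n)$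 for $n\le N$ and $\Lambda_N(n)=\Lambda(n)\left(2-\frac{\log n}{\log N}\right)$ for $N<n\le N^2$, and $\Lambda$ is the von Mangoldt function. $Z_N=\zeta/P_N$, and $\theta_{Z_N}=\arg Z_N$ (defined modulo $2\pi$, away from the zeros of $\zeta$). *)

theory Defs
  imports
    "HOL-Complex_Analysis.Complex_Analysis"
    "HOL-Number_Theory.Prime_Powers"
    "HOL-Library.Landau_Symbols"
begin

text \<open>
  The Riemann zeta function as the analytic continuation of its Dirichlet series.
  The value at the pole \<open>1\<close> is an arbitrary convention that only serves to make the
  function unique; existence and uniqueness are proved in \<open>zeta_ex1\<close> below.
\<close>

definition is_zeta :: "(complex \<Rightarrow> complex) \<Rightarrow> bool" where
  "is_zeta f \<longleftrightarrow> f holomorphic_on (- {1}) \<and>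
     (\<forall>s. Re s > 1 \<longrightarrow> (\<lambda>n. of_nat (Suc n) powr (- s)) sums f s) \<and> f 1 = 0"

definition zeta :: "complex \<Rightarrow> complex" where
  "zeta = (THE f. is_zeta f)"

text \<open>
  The infimum is taken in the extended reals, so that no boundedness or non-emptiness
  has to be known in advance.
\<close>

definition zeta_mu :: "real \<Rightarrow> ereal" where
  "zeta_mu \<sigma> = Inf (ereal ` {m. (\<lambda>t. norm (zeta (Complex \<sigma> t))) \<in> O[at_top](\<lambda>t. t powr m)})"

definition zeta_moment :: "nat \<Rightarrow> real \<Rightarrow> real \<Rightarrow> real" where
  "zeta_moment k \<sigma> T = integral {0..T} (\<lambda>t. norm (zeta (Complex \<sigma> t)) ^ (2 * k))"

definition sigma_crit :: "nat \<Rightarrow> real" where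
  "sigma_crit k = Inf {\<sigma>0 \<in> {1/2..<1}. \<forall>\<sigma>\<in>{\<sigma>0<..<1}. (\<lambda>T. zeta_moment k \<sigma> T) \<in> O[at_top](\<lambda>T. T)}"

text \<open>Only the values for \<open>n \<le> N\<^sup>2\<close> are used.\<close>

definition Lambda_N :: "nat \<Rightarrow> nat \<Rightarrow> real" where
  "Lambda_N N n = (if n \<le> N then mangoldt n
              else mangoldt n * (2 - ln (real n) / ln (real N)))"

definition P_approx :: "nat \<Rightarrow> complex \<Rightarrow> complex" where
  "P_approx N s = exp (\<Sum>n=2..N\<^sup>2. of_real (Lambda_N N n) / (of_nat n powr s * of_real (ln (real n))))"

definition Z_quot :: "nat \<Rightarrow> complex \<Rightarrow> complex" where
  "Z_quot N s = zeta s / P_approx N s"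

text \<open>
  The principal branch is chosen for the argument; \<open>sin\<^sup>2 (k \<theta>)\<close> with integral \<open>k\<close> depends
  only on \<open>\<theta>\<close> modulo \<open>2 \<pi>\<close>. At zeros of zeta, where \<open>Arg 0 = 0\<close>, the weight
  \<open>|zeta|\<^sup>2\<^sup>k\<close> in the moment below vanishes for \<open>k \<ge> 1\<close>.
\<close>

definition theta_Z :: "nat \<Rightarrow> complex \<Rightarrow> real" where
  "theta_Z N s = Arg (Z_quot N s)"

definition zeta_sin_moment :: "nat \<Rightarrow> nat \<Rightarrow> real \<Rightarrow> real \<Rightarrow> real" where
  "zeta_sin_moment k N \<sigma> T = integral {0..T}
     (\<lambda>t. norm (zeta (Complex \<sigma> t)) ^ (2 * k) * (sin (real k * theta_Z N (Complex \<sigma> t)))\<^sup>2)"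


subsection \<open>Existence and uniqueness of the continuation\<close>

lemma series_holomorphic:
  fixes f :: "nat \<Rightarrow> complex \<Rightarrow> complex"
  assumes hol: "\<And>n. f n holomorphic_on {s. Re s > c}"
    and bd: "\<And>K \<delta>. \<delta> > 0 \<Longrightarrow> \<exists>C\<ge>0. \<forall>n y. norm y \<le> K \<longrightarrow> Re y \<ge> c + \<delta> \<longrightarrow>
                norm (f n y) \<le> C * real (Suc n) powr (-1 - \<delta>)"
  shows "\<exists>g. g holomorphic_on {s. Re s > c} \<and> (\<forall>s. Re s > c \<longrightarrow> (\<lambda>n. f n s) sums g s)"
proof -
  have op: "open {s. Re s > c}" by (rule open_halfspace_Re_gt)
  have "\<exists>d h. 0 < d \<and> summable h \<and> range h \<subseteq> \<real>\<^sub>\<ge>\<^sub>0 \<and>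
      (\<forall>\<^sub>F n in sequentially. \<forall>y\<in>ball x d \<inter> {s. Re s > c}. cmod (f n y) \<le> cmod (h n))"
    if "x \<in> {s. Re s > c}" for x
  proof -
    define d where "d = (Re x - c) / 2"
    have d: "d > 0" using that by (simp add: d_def)
    obtain C where C: "C \<ge> 0" "\<And>n y. norm y \<le> norm x + d \<Longrightarrow> Re y \<ge> c + d \<Longrightarrow>
        norm (f n y) \<le> C * real (Suc n) powr (-1 - d)"
      using bd[OF d, of "norm x + d"] by blast
    define h :: "nat \<Rightarrow> complex" where "h n = of_real (C * real (Suc n) powr (-1 - d))" for n
    have "summable (\<lambda>n. real n powr (-1 - d))"
      using d by (subst summable_real_powr_iff) auto
    then have "summable (\<lambda>n. real (Suc n) powr (-1 - d))"
      by (subst summable_Suc_iff)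
    then have "summable h"
      unfolding h_def by (intro summable_of_real summable_mult)
    moreover have "range h \<subseteq> \<real>\<^sub>\<ge>\<^sub>0"
      using C(1) by (auto simp: h_def simp del: of_real_mult)
    moreover have "cmod (f n y) \<le> cmod (h n)" if "y \<in> ball x d" for n y
    proof -
      have xy: "norm (x - y) < d" using that by (simp add: dist_norm)
      have "norm y \<le> norm x + norm (y - x)" by (metis add.commute diff_add_cancel norm_triangle_ineq)
      then have 1: "norm y \<le> norm x + d" using xy by (simp add: norm_minus_commute)
      have "\<bar>Re (x - y)\<bar> < d" using abs_Re_le_cmod[of "x - y"] xy by linarith
      then have "Re y > Re x - d" by simp
      then have 2: "Re y \<ge> c + d" by (simp add: d_def field_simps)
      show ?thesis using C(2)[OF 1 2, of n] C(1) unfolding h_def by (simp add: norm_mult abs_mult)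
    qed
    ultimately show ?thesis using d by (intro exI[of _ d] exI[of _ h]) auto
  qed
  then obtain g where g: "\<forall>x\<in>{s. Re s > c}. ((\<lambda>n. f n x) sums g x) \<and> g field_differentiable (at x)"
    using series_differentiable_comparison_complex[OF op, of f]
      holomorphic_on_imp_differentiable_at[OF hol op] by blast
  then have "g holomorphic_on {s. Re s > c}"
    by (auto simp: holomorphic_on_def intro: field_differentiable_at_within)
  then show ?thesis using g by blast
qed

lemma dirichlet_series_holomorphic:
  "\<exists>D. D holomorphic_on {s. Re s > 1} \<and>
     (\<forall>s. Re s > 1 \<longrightarrow> (\<lambda>n. of_nat (Suc n) powr (- s)) sums D s)"
proof (rule series_holomorphic)
  show "(\<lambda>s. of_nat (Suc n) powr (- s)) holomorphic_on {s. Re s > 1}" for n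
    by (intro holomorphic_intros)
  fix K \<delta> :: real assume "\<delta> > 0"
  have "norm ((of_nat (Suc n) :: complex) powr (- y)) \<le> 1 * real (Suc n) powr (-1 - \<delta>)"
    if "Re y \<ge> 1 + \<delta>" for n y
  proof -
    have "norm ((of_nat (Suc n) :: complex) powr (- y)) = real (Suc n) powr (- Re y)"
      by (subst norm_powr_real_powr) auto
    also have "\<dots> \<le> real (Suc n) powr (-1 - \<delta>)"
      using that by (intro powr_mono) auto
    finally show ?thesis by simp
  qed
  then show "\<exists>C\<ge>0. \<forall>n y. norm y \<le> K \<longrightarrow> Re y \<ge> 1 + \<delta> \<longrightarrow>
      norm ((of_nat (Suc n) :: complex) powr (- y)) \<le> C * real (Suc n) powr (-1 - \<delta>)"
    by (intro exI[of _ 1]) auto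
qed

definition taylor_rem :: "nat \<Rightarrow> nat \<Rightarrow> complex \<Rightarrow> complex" where
  "taylor_rem J n s = of_nat (Suc (Suc n)) powr (1 - s) -
     (\<Sum>j\<le>J. ((1 - s) gchoose j) * of_nat (Suc n) powr (1 - s - of_nat j))"

lemma taylor_rem_bound:
  assumes "Re s > 1 - real J"
  shows "norm (taylor_rem J n s) \<le>
    (1 + norm s + real J) ^ Suc J * real (Suc n) powr (- Re s - real J)"
proof -
  define a where "a = 1 - s"
  define q where "q i = (\<Prod>l<i. a - of_nat l)" for i
  define f where "f i x = q i * x powr (a - of_nat i)" for i and x :: complex
  define A where "A = closed_segment (of_nat (Suc n)) (of_nat (Suc (Suc n)) :: complex)"
  have A: "x \<in> \<real> \<and> Re x \<ge> real (Suc n)" if x: "x \<in> A" for x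
  proof -
    obtain u where u: "0 \<le> u" "u \<le> 1"
        "x = (1 - u) *\<^sub>R of_nat (Suc n) + u *\<^sub>R of_nat (Suc (Suc n))"
      using x unfolding A_def in_segment by blast
    then have "x = of_real (real (Suc n) + u)"
      by (simp add: scaleR_conv_of_real algebra_simps)
    then show ?thesis using u by simp
  qed
  have qn: "norm (q (Suc J)) \<le> (1 + norm s + real J) ^ Suc J"
  proof -
    have "norm (q (Suc J)) = (\<Prod>l<Suc J. norm (a - of_nat l))"
      unfolding q_def by (simp only: prod_norm)
    also have "\<dots> \<le> (\<Prod>l<Suc J. 1 + norm s + real J)"
    proof (rule prod_mono, safe)
      fix l assume l: "l < Suc J"
      have "norm (a - of_nat l) \<le> norm (1 - s) + norm (of_nat l :: complex)"
        unfolding a_def by (rule norm_triangle_ineq4)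
      also have "norm (1 - s) \<le> 1 + norm s"
        using norm_triangle_ineq4[of 1 s] by simp
      finally show "norm (a - of_nat l) \<le> 1 + norm s + real J" using l by simp
    qed simp
    finally show ?thesis by simp
  qed
  have "cmod (f 0 (of_nat (Suc (Suc n))) - (\<Sum>i\<le>J. f i (of_nat (Suc n)) *
      (of_nat (Suc (Suc n)) - of_nat (Suc n)) ^ i / fact i)) \<le>
      ((1 + norm s + real J) ^ Suc J * real (Suc n) powr (- Re s - real J)) *
      cmod (of_nat (Suc (Suc n)) - of_nat (Suc n)) ^ Suc J / fact J"
  proof (rule complex_Taylor[where S = A])
    show "convex A" by (simp add: A_def)
    show "of_nat (Suc n) \<in> A" "of_nat (Suc (Suc n)) \<in> A" by (simp_all add: A_def)
    fix x assume x: "x \<in> A"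
    have xr: "x \<in> \<real>" "Re x \<ge> real (Suc n)" using A[OF x] by auto
    then have x0: "x \<notin> \<real>\<^sub>\<le>\<^sub>0" by (auto simp: complex_nonpos_Reals_iff)
    show "(f i has_field_derivative f (Suc i) x) (at x within A)" for i
    proof -
      have "((\<lambda>x. x powr (a - of_nat i)) has_field_derivative
          (a - of_nat i) * x powr (a - of_nat i - 1)) (at x)"
        by (rule has_field_derivative_powr[OF x0])
      from DERIV_cmult[OF this, of "q i"]
      have "(f i has_field_derivative f (Suc i) x) (at x)"
        unfolding f_def by (simp add: q_def algebra_simps)
      then show ?thesis by (rule has_field_derivative_at_within)
    qed
    have "norm (x powr (a - of_nat (Suc J))) = Re x powr (- Re s - real J)"
      using xr by (subst norm_powr_real_powr) (auto simp: a_def)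
    also have "\<dots> \<le> real (Suc n) powr (- Re s - real J)"
      using assms xr by (intro powr_mono2') auto
    finally show "cmod (f (Suc J) x) \<le>
        (1 + norm s + real J) ^ Suc J * real (Suc n) powr (- Re s - real J)"
      unfolding f_def norm_mult using qn by (intro mult_mono) auto
  qed
  moreover have "q i / fact i = a gchoose i" for i
    by (simp add: q_def gbinomial_prod_rev atLeast0LessThan)
  then have "(\<Sum>i\<le>J. f i (of_nat (Suc n)) *
      (of_nat (Suc (Suc n)) - of_nat (Suc n)) ^ i / fact i) =
      (\<Sum>j\<le>J. ((1 - s) gchoose j) * of_nat (Suc n) powr (1 - s - of_nat j))"
    unfolding f_def a_def[symmetric]
    by (intro sum.cong refl) (metis (no_types, lifting) add_diff_cancel_left' mult.right_neutral
        of_nat_Suc power_one times_divide_eq_left add.commute)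
  moreover have "f 0 (of_nat (Suc (Suc n))) = of_nat (Suc (Suc n)) powr (1 - s)"
    by (simp add: f_def q_def a_def)
  ultimately have "norm (taylor_rem J n s) \<le>
      ((1 + norm s + real J) ^ Suc J * real (Suc n) powr (- Re s - real J)) / fact J"
    unfolding taylor_rem_def by simp
  also have "\<dots> \<le> ((1 + norm s + real J) ^ Suc J * real (Suc n) powr (- Re s - real J)) / 1"
    by (intro divide_left_mono) (auto simp: fact_ge_1)
  finally show ?thesis by simp
qed

lemma gchoose_holomorphic:
  "(\<lambda>s. (1 - s :: complex) gchoose j) holomorphic_on A"
  unfolding gbinomial_prod_rev by (intro holomorphic_intros) auto

lemma taylor_rem_sum_holomorphic:
  "\<exists>R. R holomorphic_on {s. Re s > 1 - real J} \<and>
     (\<forall>s. Re s > 1 - real J \<longrightarrow> (\<lambda>n. taylor_rem J n s) sums R s)"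
proof (rule series_holomorphic)
  show "taylor_rem J n holomorphic_on {s. Re s > 1 - real J}" for n
    unfolding taylor_rem_def by (intro holomorphic_intros gchoose_holomorphic)
  fix K \<delta> :: real assume \<delta>: "\<delta> > 0"
  define C where "C = (1 + \<bar>K\<bar> + real J) ^ Suc J"
  have "norm (taylor_rem J n y) \<le> C * real (Suc n) powr (-1 - \<delta>)"
    if "norm y \<le> K" "Re y \<ge> 1 - real J + \<delta>" for n y
  proof -
    have "norm (taylor_rem J n y) \<le>
        (1 + norm y + real J) ^ Suc J * real (Suc n) powr (- Re y - real J)"
      using that \<delta> by (intro taylor_rem_bound) auto
    also have "\<dots> \<le> C * real (Suc n) powr (-1 - \<delta>)"
      unfolding C_def using that by (intro mult_mono power_mono powr_mono) auto
    finally show ?thesis .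
  qed
  moreover have "C \<ge> 0" by (simp add: C_def)
  ultimately show "\<exists>C\<ge>0. \<forall>n y. norm y \<le> K \<longrightarrow> Re y \<ge> 1 - real J + \<delta> \<longrightarrow>
      norm (taylor_rem J n y) \<le> C * real (Suc n) powr (-1 - \<delta>)"
    by blast
qed

lemma zeta_recursion:
  assumes D: "\<And>s. Re s > 1 \<Longrightarrow> (\<lambda>n. of_nat (Suc n) powr (- s)) sums D s"
    and R: "(\<lambda>n. taylor_rem (Suc m) n s) sums R" and s: "Re s > 1"
  shows "(s - 1) * D s = 1 + R + (\<Sum>j=2..Suc m. ((1 - s) gchoose j) * D (s + of_nat j - 1))"
proof -
  let ?g = "\<lambda>n. of_nat (Suc n) powr (1 - s) :: complex"
  let ?b = "\<lambda>j. (1 - s) gchoose j"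
  have "?g \<longlonglongrightarrow> 0"
  proof (rule tendsto_norm_zero_cancel)
    have "(\<lambda>n. real (Suc n) powr (1 - Re s)) \<longlonglongrightarrow> 0"
      using s by (intro tendsto_neg_powr filterlim_compose[OF filterlim_real_sequentially filterlim_Suc]) auto
    moreover have "norm (?g n) = real (Suc n) powr (1 - Re s)" for n
      by (subst norm_powr_real_powr) auto
    ultimately show "(\<lambda>n. norm (?g n)) \<longlonglongrightarrow> 0" by simp
  qed
  then have "(\<lambda>n. ?g (Suc n) - ?g n) sums (0 - ?g 0)"
    by (rule telescope_sums)
  moreover have "(\<lambda>n. \<Sum>j=1..Suc m. ?b j * of_nat (Suc n) powr (1 - s - of_nat j)) sums
      (\<Sum>j=1..Suc m. ?b j * D (s + of_nat j - 1))"
  proof (intro sums_sum sums_mult)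
    fix j assume "j \<in> {1..Suc m}"
    then have "Re (s + of_nat j - 1) > 1" using s by auto
    from D[OF this] show "(\<lambda>n. of_nat (Suc n) powr (1 - s - of_nat j)) sums D (s + of_nat j - 1)"
      by (simp add: algebra_simps)
  qed
  ultimately have "(\<lambda>n. (?g (Suc n) - ?g n) -
      (\<Sum>j=1..Suc m. ?b j * of_nat (Suc n) powr (1 - s - of_nat j))) sums
      ((0 - ?g 0) - (\<Sum>j=1..Suc m. ?b j * D (s + of_nat j - 1)))"
    by (rule sums_diff)
  moreover have "(?g (Suc n) - ?g n) -
      (\<Sum>j=1..Suc m. ?b j * of_nat (Suc n) powr (1 - s - of_nat j)) = taylor_rem (Suc m) n s" for n
  proof -
    have "{..Suc m} = insert 0 {1..Suc m}" by auto
    then show ?thesis unfolding taylor_rem_def by (simp del: sum.cl_ivl_Suc)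
  qed
  ultimately have "R = (0 - ?g 0) - (\<Sum>j=1..Suc m. ?b j * D (s + of_nat j - 1))"
    using R sums_unique2 by simp
  moreover have "{1..Suc m} = insert 1 {2..Suc m}" by auto
  then have "(\<Sum>j=1..Suc m. ?b j * D (s + of_nat j - 1)) =
      (1 - s) * D s + (\<Sum>j=2..Suc m. ?b j * D (s + of_nat j - 1))"
    by (simp del: sum.cl_ivl_Suc)
  ultimately have "R = (0 - ?g 0) - ((1 - s) * D s +
      (\<Sum>j=2..Suc m. ?b j * D (s + of_nat j - 1)))"
    by (simp only:)
  then show ?thesis by (simp add: algebra_simps del: sum.cl_ivl_Suc)
qed

lemma gchoose_absorb:
  assumes "j \<ge> 2" "s + of_nat j - 2 \<noteq> (0::complex)"
  shows "((1 - s) gchoose j) * (x / (s + of_nat j - 2)) =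
     - (((1 - s) gchoose (j - 1)) / of_nat j) * x"
proof -
  obtain i where j: "j = Suc i" using assms(1) by (cases j) auto
  have "of_nat j * ((1 - s) gchoose j) = ((1 - s) gchoose i) * (1 - s - of_nat i)"
    unfolding j using gbinomial_absorption' [of "Suc i" "1 - s"] gbinomial_mult_1[of "1 - s" i]
    by (simp add: algebra_simps)
  also have "1 - s - of_nat i = - (s + of_nat j - 2)" by (simp add: j)
  finally have "of_nat j * ((1 - s) gchoose j) = - ((1 - s) gchoose i) * (s + of_nat j - 2)"
    by (simp add: algebra_simps)
  moreover have "of_nat j \<noteq> (0::complex)" using assms(1) by simp
  ultimately have "(1 - s) gchoose j = - ((1 - s) gchoose i) * (s + of_nat j - 2) / of_nat j"
    by (metis nonzero_mult_div_cancel_left)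
  then show ?thesis using assms(2) by (simp add: j)
qed

lemma zeta_continuation_step:
  assumes D: "D holomorphic_on {s. Re s > 1}"
    "\<And>s. Re s > 1 \<Longrightarrow> (\<lambda>n. of_nat (Suc n) powr (- s)) sums D s"
  shows "\<exists>h. h holomorphic_on {s. Re s > 1 - real m} \<and> (\<forall>s. Re s > 1 \<longrightarrow> h s = (s - 1) * D s)"
proof (induction m)
  case 0
  show ?case using D(1) by (intro exI[of _ "\<lambda>s. (s - 1) * D s"]) (auto intro!: holomorphic_intros)
next
  case (Suc m)
  then obtain h where h: "h holomorphic_on {s. Re s > 1 - real m}"
    "\<And>s. Re s > 1 \<Longrightarrow> h s = (s - 1) * D s" by blast
  obtain R where R: "R holomorphic_on {s. Re s > 1 - real (Suc m)}"
    "\<And>s. Re s > 1 - real (Suc m) \<Longrightarrow> (\<lambda>n. taylor_rem (Suc m) n s) sums R s"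
    using taylor_rem_sum_holomorphic[of "Suc m"] by blast
  define h' where "h' s = 1 + R s +
    (\<Sum>j=2..Suc m. - (((1 - s) gchoose (j - 1)) / of_nat j) * h (s + of_nat j - 1))" for s
  have hj: "(\<lambda>s. h (s + of_nat j - 1)) holomorphic_on {s. Re s > 1 - real (Suc m)}"
    if "j \<in> {2..Suc m}" for j
  proof -
    have "(h \<circ> (\<lambda>s. s + of_nat j - 1)) holomorphic_on {s. Re s > 1 - real (Suc m)}"
      using that by (intro holomorphic_on_compose_gen[OF _ h(1)] holomorphic_intros) auto
    then show ?thesis by (simp add: o_def)
  qed
  have "h' holomorphic_on {s. Re s > 1 - real (Suc m)}"
    unfolding h'_def by (intro holomorphic_intros R(1) hj gchoose_holomorphic) auto
  moreover have "h' s = (s - 1) * D s" if s: "Re s > 1" for s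
  proof -
    have "(\<lambda>n. taylor_rem (Suc m) n s) sums R s" using s by (intro R(2)) auto
    from zeta_recursion[OF D(2) this s]
    have "(s - 1) * D s = 1 + R s +
      (\<Sum>j=2..Suc m. ((1 - s) gchoose j) * D (s + of_nat j - 1))" .
    also have "(\<Sum>j=2..Suc m. ((1 - s) gchoose j) * D (s + of_nat j - 1)) =
      (\<Sum>j=2..Suc m. - (((1 - s) gchoose (j - 1)) / of_nat j) * h (s + of_nat j - 1))"
    proof (intro sum.cong refl)
      fix j assume j: "j \<in> {2..Suc m}"
      have 1: "Re (s + of_nat j - 1) > 1" using j s by auto
      have "Re (s + of_nat j - 2) > 0" using j s by auto
      then have 2: "s + of_nat j - 2 \<noteq> 0" by force
      have "h (s + of_nat j - 1) = (s + of_nat j - 2) * D (s + of_nat j - 1)"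
        using h(2)[OF 1] by (simp add: algebra_simps)
      then have "D (s + of_nat j - 1) = h (s + of_nat j - 1) / (s + of_nat j - 2)"
        using 2 by simp
      then show "((1 - s) gchoose j) * D (s + of_nat j - 1) =
          - (((1 - s) gchoose (j - 1)) / of_nat j) * h (s + of_nat j - 1)"
        using gchoose_absorb[of j s] j 2 by simp
    qed
    finally show ?thesis by (simp add: h'_def)
  qed
  ultimately show ?case by blast
qed

lemma zeta_ex: "\<exists>f. is_zeta f"
proof -
  obtain D where D: "D holomorphic_on {s. Re s > 1}"
    "\<And>s. Re s > 1 \<Longrightarrow> (\<lambda>n. of_nat (Suc n) powr (- s)) sums D s"
    using dirichlet_series_holomorphic by blast
  obtain H where H: "\<And>m. H m holomorphic_on {s. Re s > 1 - real m}"
    "\<And>m s. Re s > 1 \<Longrightarrow> H m s = (s - 1) * D s"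
    using zeta_continuation_step[OF D] by metis
  have H_eq: "H m s = H n s" if "m \<le> n" "Re s > 1 - real m" for m n s
  proof (rule analytic_continuation_open[of "{s. Re s > 1}" "{s. Re s > 1 - real m}" "H m" "H n"])
    show "{s. Re s > 1} \<noteq> {}" by (auto intro: exI[of _ 2])
    show "connected {s. Re s > 1 - real m}" by (intro convex_connected convex_halfspace_Re_gt)
    show "H n holomorphic_on {s. Re s > 1 - real m}"
      by (rule holomorphic_on_subset[OF H(1)]) (use that in auto)
  qed (use that H in \<open>auto simp: open_halfspace_Re_gt\<close>)
  define N where "N s = nat \<lceil>2 - Re s\<rceil>" for s
  define h where "h s = H (N s) s" for s
  have N: "Re s > 1 - real (N s)" for s unfolding N_def by linarith
  have h: "h s = H m s" if "Re s > 1 - real m" for m s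
    unfolding h_def using H_eq[of m "N s" s] H_eq[of "N s" m s] N that by (metis nle_le)
  have "h field_differentiable (at s)" for s
  proof -
    let ?A = "{z. Re z > 1 - real (N s)}"
    have "h holomorphic_on ?A"
      using H(1)[of "N s"] by (rule holomorphic_transform) (simp add: h)
    then show ?thesis
      using N by (intro holomorphic_on_imp_differentiable_at[of h ?A]) (auto simp: open_halfspace_Re_gt)
  qed
  then have hol: "h holomorphic_on A" for A
    by (auto simp: holomorphic_on_def intro: field_differentiable_at_within)
  have "h s / (s - 1) = D s" if "Re s > 1" for s
  proof -
    have "s \<noteq> 1" using that by auto
    moreover have "h s = (s - 1) * D s" using that h[of 0 s] H(2)[of s 0] by simp
    ultimately show ?thesis by simp
  qed
  then have "is_zeta (\<lambda>s. h s / (s - 1))"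
    unfolding is_zeta_def using D(2) by (auto intro!: holomorphic_intros hol)
  then show ?thesis by blast
qed

lemma zeta_unique:
  assumes "is_zeta f" "is_zeta g"
  shows "f = g"
proof
  fix s
  show "f s = g s"
  proof (cases "s = 1")
    case False
    show ?thesis
    proof (rule analytic_continuation_open[of "{s. Re s > 1}" "- {1}" f g])
      show "{s. Re s > 1} \<noteq> {}" by (auto intro: exI[of _ 2])
      show "connected (- {1::complex})" by (rule connected_punctured_universe) simp
      show "f z = g z" if "z \<in> {s. Re s > 1}" for z
        using assms that unfolding is_zeta_def by (blast intro: sums_unique2)
    qed (use assms False in \<open>auto simp: is_zeta_def open_halfspace_Re_gt\<close>)
  qed (use assms in \<open>simp add: is_zeta_def\<close>)
qed

theorem zeta_ex1: "\<exists>!f. is_zeta f"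
  using zeta_ex zeta_unique by blast

theorem is_zeta_zeta: "is_zeta zeta"
  unfolding zeta_def by (rule theI'[OF zeta_ex1])

end

theory Submission
  imports Defs "HOL-Real_Asymp.Real_Asymp"
begin

text \<open>
  Write \<open>\<theta>\<close> for the argument of \<open>\<zeta> / P\<^sub>N\<close>. Since \<open>\<zeta>\<^sup>2\<^sup>k cnj (P\<^sub>N)\<^sup>k / P\<^sub>N\<^sup>k\<close> equals
  \<open>|\<zeta>|\<^sup>2\<^sup>k exp (2 i k \<theta>)\<close>, the weighted moment of \<open>sin\<^sup>2 (k \<theta>)\<close> is half of the moment of \<open>\<zeta>\<close> minus half
  of the real part of the integral of this twisted power (\<open>zeta_sin_moment_eq\<close>). The conjugate of
  \<open>P\<^sub>N\<close> at a point of the line \<open>Re s = \<sigma>\<close> is \<open>P\<^sub>N (2 \<sigma> - s)\<close>, so the twisted power is the restriction to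
  that line of a function holomorphic in the upper half plane. The hypothesis on \<open>\<mu> (1/2)\<close>, spread over
  the strip \<open>1/2 \<le> Re s \<le> 2\<close> by a maximum modulus argument (\<open>zeta_growth_strip\<close>), says that \<open>\<zeta>\<^sup>2\<^sup>k\<close> is
  \<open>O (t powr c)\<close> there for some \<open>c < 1\<close>. Hence mean values may be computed on the line \<open>Re s = 2\<close>
  instead (\<open>contour_shift_mean\<close>).

  On that line everything is an absolutely convergent Dirichlet series, and what matters is that all
  coefficients are nonnegative: \<open>\<zeta> / P\<^sub>N\<close> is the exponential of the series with coefficients
  \<open>(\<Lambda> - \<Lambda>\<^sub>N) / log\<close>, and \<open>\<Lambda>\<^sub>N \<le> \<Lambda>\<close>. The functions on the line are then uniform limits of trigonometric
  polynomials with nonnegative coefficients (\<open>pos_ap\<close>), a class that is closed under products and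
  exponentials and whose members have asymptotically nonnegative mean (\<open>pos_ap_mean_nonneg\<close>). Three
  consequences: the integral of the twisted power lies between \<open>- o(T)\<close> and \<open>O(T)\<close>
  (\<open>twisted_power_bounds\<close>), the moment of \<open>\<zeta>\<close> is eventually at least \<open>T / 4\<close> (\<open>zeta_moment_lower_bound\<close>), and the
  moment of \<open>P\<^sub>N\<close> is at most that of \<open>\<zeta>\<close>, up to \<open>o(T)\<close> and for every \<open>N\<close>
  (\<open>P_moment_le_zeta_moment\<close>).

  To the left of the critical abscissa the moment of \<open>\<zeta>\<close> is not \<open>O(T)\<close>, so the twisted integral is
  negligible for suitable arbitrarily large \<open>T\<close>, and its lower bound keeps the ratio from exceeding
  \<open>1/2\<close> in the limit (\<open>sin_moment_ratio_half\<close>).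

  To the right, \<open>|\<zeta>|\<^sup>2\<^sup>k sin\<^sup>2 (k \<theta>) \<le> |\<zeta>\<^sup>k - P\<^sub>N\<^sup>k|\<^sup>2\<close>, so it suffices that \<open>P\<^sub>N\<^sup>k\<close> approximates \<open>\<zeta>\<^sup>k\<close> in mean
  square (\<open>mean_square_distance_small\<close>). On a line between the critical abscissa and \<open>\<sigma>\<close> the mean
  square of the difference is bounded independently of \<open>N\<close>; on \<open>Re s = 2\<close> the difference tends to \<open>0\<close>
  uniformly; a three lines theorem for mean squares (\<open>mean_square_three_lines\<close>,
  \<open>mean_square_interpolation\<close>) gives smallness in between.

  Two facts about the critical abscissa are needed as well. Boundedness of the moment on one line
  implies boundedness on every line further right (\<open>moment_bounded_mono\<close>, again by
  interpolation), and moments are bounded near the line \<open>Re s = 1\<close> (\<open>moment_bounded_near_1\<close>). The latter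
  is proved by comparing \<open>\<zeta>\<^sup>k\<close> with a partial sum of its Dirichlet series whose length is a power
  of \<open>T\<close> with exponent less than \<open>1\<close>.
\<close>

section \<open>Growth of zeta in the strip\<close>

lemma zeta_holomorphic: "zeta holomorphic_on {s. Im s > 0}"
proof -
  have "zeta holomorphic_on - {1}" using is_zeta_zeta by (simp add: is_zeta_def)
  then show ?thesis by (rule holomorphic_on_subset) auto
qed

lemma maximum_modulus_rectangle:
  assumes holo: "F holomorphic_on S" "open S" "cbox (Complex a c) (Complex b d) \<subseteq> S"
    and left: "\<And>y. c \<le> y \<Longrightarrow> y \<le> d \<Longrightarrow> norm (F (Complex a y)) \<le> B"
    and right: "\<And>y. c \<le> y \<Longrightarrow> y \<le> d \<Longrightarrow> norm (F (Complex b y)) \<le> B"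
    and ends: "\<And>x. a \<le> x \<Longrightarrow> x \<le> b \<Longrightarrow> norm (F (Complex x c)) \<le> B"
      "\<And>x. a \<le> x \<Longrightarrow> x \<le> b \<Longrightarrow> norm (F (Complex x d)) \<le> B"
    and z: "z \<in> cbox (Complex a c) (Complex b d)"
  shows "norm (F z) \<le> B"
proof (rule maximum_modulus_frontier[where S = "cbox (Complex a c) (Complex b d)" and f = F])
  show "F holomorphic_on interior (cbox (Complex a c) (Complex b d))"
    using holo(1) by (rule holomorphic_on_subset) (use holo(3) interior_subset in blast)
  show "continuous_on (closure (cbox (Complex a c) (Complex b d))) F"
    using holo by (simp add: holomorphic_on_imp_continuous_on holomorphic_on_subset)
  fix w assume "w \<in> frontier (cbox (Complex a c) (Complex b d))"
  then have w: "w \<in> cbox (Complex a c) (Complex b d)" "w \<notin> box (Complex a c) (Complex b d)"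
    by (auto simp: frontier_cbox)
  have "w = Complex (Re w) (Im w)" by simp
  moreover have "Re w = a \<or> Re w = b \<or> Im w = c \<or> Im w = d"
    using w by (auto simp: in_cbox_complex_iff in_box_complex_iff)
  ultimately show "norm (F w) \<le> B"
    using w(1) left[of "Im w"] right[of "Im w"] ends(1)[of "Re w"] ends(2)[of "Re w"]
    by (auto simp: in_cbox_complex_iff)
qed (use z in auto)

lemma norm_exp_square: "norm (exp (z\<^sup>2)) = exp ((Re z)\<^sup>2 - (Im z)\<^sup>2)"
  by (simp add: norm_exp_eq_Re power2_eq_square)

text \<open>
  Comparing \<open>(n + 1) powr (1 - s)\<close> with its first order Taylor polynomial at \<open>n\<close> continues \<open>(s - 1) \<zeta>(s)\<close> to the
  right half plane, with a remainder that is an explicit convergent series.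
\<close>

lemma zeta_first_step_expansion:
  "\<exists>R. \<forall>s. Re s > 0 \<longrightarrow> (\<lambda>n. taylor_rem 1 n s) sums R s \<and> (s \<noteq> 1 \<longrightarrow> (s - 1) * zeta s = 1 + R s)"
proof -
  obtain R where R: "R holomorphic_on {s. Re s > 0}"
    "\<And>s. Re s > 0 \<Longrightarrow> (\<lambda>n. taylor_rem 1 n s) sums R s"
    using taylor_rem_sum_holomorphic[of 1] by auto
  have z: "zeta holomorphic_on - {1}"
    "\<And>s. Re s > 1 \<Longrightarrow> (\<lambda>n. of_nat (Suc n) powr (- s)) sums zeta s"
    using is_zeta_zeta by (auto simp: is_zeta_def)
  let ?A = "{s. Re s > 0} - {1}"
  have "(s - 1) * zeta s = 1 + R s" if s: "Re s > 0" "s \<noteq> 1" for s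
  proof (rule analytic_continuation_open[of "{s. Re s > 1}" ?A "\<lambda>s. (s - 1) * zeta s" "\<lambda>s. 1 + R s"])
    show "{s. Re s > 1} \<noteq> {}" by (auto intro: exI[of _ 2])
    show "connected ?A"
      by (intro connected_open_delete convex_connected convex_halfspace_Re_gt open_halfspace_Re_gt) auto
    show "(\<lambda>s. (s - 1) * zeta s) holomorphic_on ?A"
      by (intro holomorphic_intros holomorphic_on_subset[OF z(1)]) auto
    show "(\<lambda>s. 1 + R s) holomorphic_on ?A"
      by (intro holomorphic_intros holomorphic_on_subset[OF R(1)]) auto
    show "(s - 1) * zeta s = 1 + R s" if "s \<in> {s. Re s > 1}" for s
      using zeta_recursion[of zeta 0 s "R s"] z(2) R(2)[of s] that by auto
  qed (use s in \<open>auto simp: open_halfspace_Re_gt intro: open_delete\<close>)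
  with R show ?thesis by (intro exI[of _ R]) simp
qed

text \<open>
  Each remainder term is at most \<open>25 t\<^sup>2 n powr (- 3/2)\<close> in the strip, and \<open>|s - 1| \<ge> 1\<close> there. Any polynomial
  bound would do for the maximum modulus argument below.
\<close>

lemma zeta_polynomial_growth:
  "\<exists>C>0. \<forall>x t. 1/2 \<le> x \<longrightarrow> x \<le> 2 \<longrightarrow> 1 \<le> t \<longrightarrow> norm (zeta (Complex x t)) \<le> C * t\<^sup>2"
proof -
  obtain R where R: "\<And>s. Re s > 0 \<Longrightarrow> (\<lambda>n. taylor_rem 1 n s) sums R s"
      "\<And>s. Re s > 0 \<Longrightarrow> s \<noteq> 1 \<Longrightarrow> (s - 1) * zeta s = 1 + R s"
    using zeta_first_step_expansion by metis
  define h where "h n = real (Suc n) powr (-3/2)" for n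
  have sh: "summable h"
    unfolding h_def by (subst summable_Suc_iff) (subst summable_real_powr_iff, simp)
  define Z where "Z = suminf h"
  have Z: "Z \<ge> 0" unfolding Z_def by (intro suminf_nonneg sh) (auto simp: h_def)
  have "norm (zeta (Complex x t)) \<le> (1 + 25 * Z) * t\<^sup>2"
    if x: "1/2 \<le> x" "x \<le> 2" and t: "1 \<le> t" for x t
  proof -
    let ?s = "Complex x t"
    have n: "norm ?s \<le> 2 + t" using cmod_le[of ?s] x t by simp
    have "norm (taylor_rem 1 m ?s) \<le> (25 * t\<^sup>2) * h m" for m
    proof -
      have "norm (taylor_rem 1 m ?s) \<le> (1 + norm ?s + real 1) ^ Suc 1 * real (Suc m) powr (- Re ?s - real 1)"
        by (rule taylor_rem_bound) (use x in auto)
      also have "\<dots> \<le> (5 * t) ^ Suc 1 * h m"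
      proof (rule mult_mono)
        show "(1 + norm ?s + real 1) ^ Suc 1 \<le> (5 * t) ^ Suc 1"
          by (rule power_mono) (use n t in auto)
        show "real (Suc m) powr (- Re ?s - real 1) \<le> h m"
          unfolding h_def by (rule powr_mono) (use x in auto)
      qed (use t in auto)
      finally show ?thesis by (simp add: power2_eq_square)
    qed
    moreover have "(\<lambda>m. (25 * t\<^sup>2) * h m) sums ((25 * t\<^sup>2) * Z)"
      unfolding Z_def using sh by (intro sums_mult summable_sums)
    ultimately have "norm (R ?s) \<le> (25 * t\<^sup>2) * Z"
      using norm_suminf_le[of "\<lambda>m. taylor_rem 1 m ?s" "\<lambda>m. (25 * t\<^sup>2) * h m"]
        sums_unique[OF R(1)[of ?s]] x by (metis complex.sel(1) less_le_trans half_gt_zero_iff sums_iff zero_less_one)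
    then have "norm (1 + R ?s) \<le> 1 + 25 * t\<^sup>2 * Z" using norm_triangle_ineq[of 1 "R ?s"] by simp
    also have "\<dots> \<le> (1 + 25 * Z) * t\<^sup>2" using one_le_power[OF t, of 2] by (simp add: algebra_simps)
    finally have "norm (1 + R ?s) \<le> (1 + 25 * Z) * t\<^sup>2" .
    moreover have "?s \<noteq> 1" using t by (auto simp: complex_eq_iff)
    ultimately have 1: "norm ((?s - 1) * zeta ?s) \<le> (1 + 25 * Z) * t\<^sup>2"
      using R(2)[of ?s] x by simp
    have "norm (?s - 1) \<ge> 1" using abs_Im_le_cmod[of "?s - 1"] t by simp
    then have "norm (zeta ?s) \<le> norm (?s - 1) * norm (zeta ?s)" using mult_right_mono[OF _ norm_ge_zero[of "zeta ?s"], of 1] by simp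
    then show ?thesis using 1 by (simp add: norm_mult)
  qed
  then show ?thesis using Z by (intro exI[of _ "1 + 25 * Z"]) auto
qed

lemma zeta_bounded_Re_2: "\<exists>C>0. \<forall>t. norm (zeta (Complex 2 t)) \<le> C"
proof -
  define h where "h n = real (Suc n) powr (-2)" for n
  have sh: "summable h"
    unfolding h_def by (subst summable_Suc_iff) (subst summable_real_powr_iff, simp)
  have "norm (zeta (Complex 2 t)) \<le> suminf h" for t
  proof -
    have "(\<lambda>n. of_nat (Suc n) powr (- Complex 2 t)) sums zeta (Complex 2 t)"
      using is_zeta_zeta by (auto simp: is_zeta_def)
    moreover have "norm ((of_nat (Suc n) :: complex) powr (- Complex 2 t)) \<le> h n" for n
      by (subst norm_powr_real_powr) (auto simp: h_def)
    ultimately show ?thesis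
      using norm_suminf_le[OF _ sh, of "\<lambda>n. of_nat (Suc n) powr (- Complex 2 t)"] by (auto simp: sums_iff)
  qed
  moreover have "suminf h \<ge> 0" by (intro suminf_nonneg sh) (auto simp: h_def)
  ultimately show ?thesis by (intro exI[of _ "suminf h + 1"]) (auto intro: add_increasing2)
qed

text \<open>
  A Phragmen-Lindelof argument in which a Gaussian centred at the point in question replaces the usual
  slowly growing factor: the bound on the left side of the strip and boundedness on the right side
  survive in the interior.
\<close>

lemma zeta_growth_strip:
  assumes m: "m \<ge> 0" and t0: "t0 \<ge> 1" and C0: "\<And>t. t \<ge> t0 \<Longrightarrow> norm (zeta (Complex (1/2) t)) \<le> C0 * t powr m"
  shows "\<exists>C>0. \<forall>x t. 1/2 \<le> x \<longrightarrow> x \<le> 2 \<longrightarrow> 1 \<le> t \<longrightarrow> norm (zeta (Complex x t)) \<le> C * t powr m"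
proof -
  obtain C1 where C1: "C1 > 0" "\<And>x t. 1/2 \<le> x \<Longrightarrow> x \<le> 2 \<Longrightarrow> 1 \<le> t \<Longrightarrow> norm (zeta (Complex x t)) \<le> C1 * t\<^sup>2"
    using zeta_polynomial_growth by blast
  obtain C2 where C2: "C2 > 0" "\<And>t. norm (zeta (Complex 2 t)) \<le> C2" using zeta_bounded_Re_2 by blast
  have "0 \<le> C0 * t0 powr m" using order_trans[OF norm_ge_zero C0[of t0]] by simp
  then have C0': "C0 \<ge> 0" using t0 by (simp add: zero_le_mult_iff)
  define C3 where "C3 = exp 4 * (C0 * 2 powr m) + exp 4 * C2 + exp 4 * (C1 * 64)"
  \<comment> \<open>The second summand covers the small \<open>t\<close>, for which the rectangle would reach below \<open>t0\<close>.\<close>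
  define C where "C = C3 + C1 * (2 * t0)\<^sup>2"
  have C3: "C3 > 0" using C0' C1 C2 by (simp add: C3_def add_nonneg_pos)
  have "norm (zeta (Complex x t)) \<le> C * t powr m" if x: "1/2 \<le> x" "x \<le> 2" and t: "1 \<le> t" for x t
  proof (cases "t \<ge> 2 * t0")
    case False
    have "norm (zeta (Complex x t)) \<le> C1 * t\<^sup>2" using C1 x t by auto
    also have "\<dots> \<le> C1 * (2 * t0)\<^sup>2 * 1" using False t C1(1) by (simp only: mult_1_right) (intro mult_left_mono power_mono, auto)
    also have "\<dots> \<le> C * t powr m"
      using C3 C1(1) t m by (intro mult_mono) (auto simp: C_def ge_one_powr_ge_zero)
    finally show ?thesis .
  next
    case True
    define s0 where "s0 = Complex x t"
    \<comment> \<open>The Gaussian is \<open>1\<close> at \<open>s0\<close>, at most \<open>exp 4\<close> in the strip, and of order \<open>exp (- t\<^sup>2 / 4)\<close> at height \<open>t \<plusminus> t / 2\<close>.\<close>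
    define F where "F w = zeta w * exp ((w - s0)\<^sup>2)" for w
    have tm: "t powr m \<ge> 1" using t m by (simp add: ge_one_powr_ge_zero)
    have e: "norm (exp ((Complex u v - s0)\<^sup>2)) \<le> exp 4 * exp (- (v - t)\<^sup>2)" if "1/2 \<le> u" "u \<le> 2" for u v
    proof -
      have "\<bar>u - x\<bar> \<le> 2" using that x by auto
      then have "(u - x)\<^sup>2 \<le> 2\<^sup>2" using abs_le_square_iff[of "u - x" 2] by simp
      then show ?thesis unfolding norm_exp_square by (simp add: s0_def flip: exp_add)
    qed
    have e1: "norm (exp ((Complex u v - s0)\<^sup>2)) \<le> exp 4" if "1/2 \<le> u" "u \<le> 2" for u v
    proof -
      have "exp 4 * exp (- (v - t)\<^sup>2) \<le> exp 4 * 1" by (intro mult_left_mono) auto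
      then show ?thesis using e[OF that, of v] by linarith
    qed
    have ends: "norm (F (Complex u v)) \<le> C3 * t powr m"
      if u: "1/2 \<le> u" "u \<le> 2" and v: "v = t - t/2 \<or> v = t + t/2" for u v
    proof -
      have "v - t = t / 2 \<or> v - t = - (t / 2)" using v by auto
      then have "(v - t)\<^sup>2 = (t / 2)\<^sup>2" by (metis power2_minus)
      then have v1: "v \<ge> 1" "v \<le> 2 * t" "(v - t)\<^sup>2 = t\<^sup>2 / 4"
        using v True t0 by (auto simp: power_divide)
      have ex: "t\<^sup>2 / 4 \<le> exp (t\<^sup>2 / 4)" using exp_ge_add_one_self[of "t\<^sup>2 / 4"] by linarith
      have "norm (F (Complex u v)) \<le> (C1 * v\<^sup>2) * (exp 4 * exp (- (v - t)\<^sup>2))"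
        unfolding F_def norm_mult using C1 u v1 e[OF u] by (intro mult_mono) auto
      also have "\<dots> \<le> (C1 * (2 * t)\<^sup>2) * (exp 4 * exp (- (v - t)\<^sup>2))"
        using v1 C1(1) by (intro mult_right_mono mult_left_mono power_mono) auto
      also have "\<dots> = exp 4 * C1 * 16 * ((t\<^sup>2 / 4) * exp (- (t\<^sup>2 / 4)))" unfolding v1(3) by (simp add: power2_eq_square)
      also have "\<dots> \<le> exp 4 * C1 * 16 * 1"
        using C1(1) ex by (intro mult_left_mono) (auto simp: exp_minus divide_simps)
      also have "\<dots> \<le> C3 * 1" using C0' C1 C2 by (simp add: C3_def add_increasing)
      also have "\<dots> \<le> C3 * t powr m" using tm C3 by (intro mult_left_mono) auto
      finally show ?thesis .
    qed
    have "norm (F s0) \<le> C3 * t powr m"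
    proof (rule maximum_modulus_rectangle[where F = F and z = s0 and S = "{s. Im s > 0}" and a = "1/2" and b = 2 and c = "t - t/2" and d = "t + t/2"])
      show "F holomorphic_on {s. Im s > 0}" unfolding F_def by (intro holomorphic_intros zeta_holomorphic)
      show "open {s. 0 < Im s}" by (rule open_halfspace_Im_gt)
      show "cbox (Complex (1/2) (t - t/2)) (Complex 2 (t + t/2)) \<subseteq> {s. 0 < Im s}"
        using t by (auto simp: in_cbox_complex_iff)
      show "s0 \<in> cbox (Complex (1/2) (t - t/2)) (Complex 2 (t + t/2))"
        using x t by (auto simp: in_cbox_complex_iff s0_def)
    next
      fix y assume y: "t - t/2 \<le> y" "y \<le> t + t/2"
      have "norm (zeta (Complex (1/2) y)) \<le> C0 * y powr m" using C0[of y] y True by auto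
      also have "\<dots> \<le> C0 * (2 * t) powr m" using y t m C0' by (intro mult_left_mono powr_mono2) auto
      finally have "norm (F (Complex (1/2) y)) \<le> (C0 * (2 * t) powr m) * exp 4"
        unfolding F_def norm_mult using e1[of "1/2" y] C0' by (intro mult_mono) auto
      also have "\<dots> = exp 4 * (C0 * 2 powr m) * t powr m" using t by (simp add: powr_mult)
      also have "\<dots> \<le> C3 * t powr m" using C1 C2 by (intro mult_right_mono) (auto simp: C3_def)
      finally show "norm (F (Complex (1/2) y)) \<le> C3 * t powr m" .
      have "norm (F (Complex 2 y)) \<le> C2 * exp 4"
        unfolding F_def norm_mult using e1[of 2 y] C2 by (intro mult_mono) (auto intro: less_imp_le)
      also have "\<dots> \<le> C3 * 1" using C0' C1 C2 by (simp add: C3_def)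
      also have "\<dots> \<le> C3 * t powr m" using tm C3 by (intro mult_left_mono) auto
      finally show "norm (F (Complex 2 y)) \<le> C3 * t powr m" .
    qed (use ends in auto)
    also have "F s0 = zeta (Complex x t)" by (simp add: F_def s0_def)
    also have "C3 * t powr m \<le> C * t powr m" using C1(1) by (intro mult_right_mono) (auto simp: C_def)
    finally show ?thesis .
  qed
  then show ?thesis using C3 C1(1) by (intro exI[of _ C]) (auto simp: C_def add_pos_nonneg)
qed

section \<open>Mean squares on vertical lines\<close>

abbreviation square_integral :: "(complex \<Rightarrow> complex) \<Rightarrow> real \<Rightarrow> real \<Rightarrow> real \<Rightarrow> real" where
  "square_integral F x a b \<equiv> integral {a..b} (\<lambda>t. (norm (F (Complex x t)))\<^sup>2)"

lemma integral_Cauchy_Schwarz: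
  fixes f g :: "real \<Rightarrow> complex"
  assumes f: "continuous_on {a..b} f" and g: "continuous_on {a..b} g"
  shows "norm (integral {a..b} (\<lambda>t. f t * g t)) \<le>
    sqrt (integral {a..b} (\<lambda>t. (norm (f t))\<^sup>2)) * sqrt (integral {a..b} (\<lambda>t. (norm (g t))\<^sup>2))"
proof (cases "a < b")
  case True
  define A where "A = integral {a..b} (\<lambda>t. (norm (f t))\<^sup>2)"
  define B where "B = integral {a..b} (\<lambda>t. (norm (g t))\<^sup>2)"
  define C where "C = integral {a..b} (\<lambda>t. norm (f t) * norm (g t))"
  have iA: "(\<lambda>t. (norm (f t))\<^sup>2) integrable_on {a..b}"
    and iB: "(\<lambda>t. (norm (g t))\<^sup>2) integrable_on {a..b}"
    and iC: "(\<lambda>t. norm (f t) * norm (g t)) integrable_on {a..b}"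
    by (intro integrable_continuous_interval continuous_intros f g)+
  have B0: "B \<ge> 0" and A0: "A \<ge> 0" and C0: "C \<ge> 0"
    unfolding A_def B_def C_def by (intro integral_nonneg iA iB iC; simp)+
  have C: "C \<le> sqrt A * sqrt B"
  proof (cases "B = 0")
    case True
    then have "\<forall>t\<in>{a..b}. (norm (g t))\<^sup>2 = 0"
      unfolding B_def using \<open>a < b\<close> g
      by (subst (asm) integral_eq_0_iff) (auto intro!: continuous_intros)
    then have "C = integral {a..b} (\<lambda>t. 0)" unfolding C_def by (intro integral_cong) auto
    then show ?thesis using A0 B0 by simp
  next
    case False
    \<comment> \<open>Expanding this square gives \<open>0 \<le> B (A B - C\<^sup>2)\<close>.\<close>
    have "0 \<le> integral {a..b} (\<lambda>t. (norm (f t) * B - norm (g t) * C)\<^sup>2)"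
      by (intro integral_nonneg integrable_continuous_interval continuous_intros f g) simp
    also have "\<dots> = integral {a..b} (\<lambda>t. B\<^sup>2 * (norm (f t))\<^sup>2 + C\<^sup>2 * (norm (g t))\<^sup>2 - (2 * B * C) * (norm (f t) * norm (g t)))"
      by (intro integral_cong) (simp add: power2_eq_square algebra_simps)
    also have "\<dots> = B\<^sup>2 * A + C\<^sup>2 * B - (2 * B * C) * C"
      unfolding A_def B_def C_def
      by (subst integral_diff integral_add; (intro integrable_add integrable_on_mult_right iA iB iC)?)+
         (simp only: integral_mult_right)
    also have "\<dots> = B * (A * B - C\<^sup>2)" by (simp add: power2_eq_square algebra_simps)
    finally have "C\<^sup>2 \<le> A * B" using B0 False by (simp add: zero_le_mult_iff)
    then show ?thesis using real_le_rsqrt[of C "A * B"] by (simp add: real_sqrt_mult)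
  qed
  have "norm (integral {a..b} (\<lambda>t. f t * g t)) \<le> C"
    unfolding C_def
    by (intro integral_norm_bound_integral integrable_continuous_interval continuous_intros f g)
       (simp add: norm_mult)
  with C show ?thesis by (simp add: A_def B_def)
next
  case False
  then consider "a = b" | "{a..b} = {}" by force
  then show ?thesis by cases auto
qed

lemma continuous_on_vertical:
  assumes "F holomorphic_on {s. Im s > 0}" "a > 0"
  shows "continuous_on {a..b} (\<lambda>t. F (Complex x t))"
proof -
  have "continuous_on {a..b} (F \<circ> (\<lambda>t. Complex x t))"
    using assms(2)
    by (intro continuous_on_compose continuous_intros
          continuous_on_subset[OF holomorphic_on_imp_continuous_on[OF assms(1)]]) auto
  then show ?thesis by (simp add: o_def)
qed

text \<open>
  A primitive of \<open>F\<close> turns the vertical integrals into differences of its values; their discrepancy is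
  the variation of the primitive along the two horizontal segments.
\<close>

lemma contour_shift_bound:
  assumes F: "F holomorphic_on {s. Im s > 0}" and ab: "a \<le> b" and cd: "0 < c" "c \<le> d"
    and M: "\<And>x. a \<le> x \<Longrightarrow> x \<le> b \<Longrightarrow> norm (F (Complex x c)) \<le> M1"
       "\<And>x. a \<le> x \<Longrightarrow> x \<le> b \<Longrightarrow> norm (F (Complex x d)) \<le> M2"
  shows "norm (integral {c..d} (\<lambda>t. F (Complex a t)) - integral {c..d} (\<lambda>t. F (Complex b t)))
    \<le> (b - a) * (M1 + M2)"
proof -
  have op: "open {s. Im s > 0}" by (rule open_halfspace_Im_gt)
  obtain G where G: "\<And>z. z \<in> {s. Im s > 0} \<Longrightarrow> (G has_field_derivative F z) (at z)"
    using holomorphic_convex_primitive'[OF convex_halfspace_Im_gt op F]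
    by (metis at_within_open op)
  have vert: "integral {c..d} (\<lambda>t. F (Complex x t)) = - \<i> * (G (Complex x d) - G (Complex x c))" for x
  proof -
    have "((\<lambda>t. - \<i> * G (Complex x t)) has_vector_derivative F (Complex x t)) (at t within {c..d})"
      if "t \<in> {c..d}" for t
    proof -
      have "((\<lambda>t. Complex x t) has_vector_derivative \<i>) (at t within {c..d})"
        unfolding Complex_eq by (auto intro!: derivative_eq_intros)
      moreover have "(G has_field_derivative F (Complex x t)) (at (Complex x t))"
        using G that cd by auto
      ultimately have "(G \<circ> (\<lambda>t. Complex x t) has_vector_derivative \<i> * F (Complex x t)) (at t within {c..d})"
        by (rule field_vector_diff_chain_within[OF _ has_field_derivative_at_within])
      from has_vector_derivative_mult_right[OF this, of "- \<i>"] show ?thesis by (simp add: o_def)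
    qed
    from fundamental_theorem_of_calculus[OF cd(2) this] show ?thesis
      by (simp add: algebra_simps integral_unique)
  qed
  have horiz: "norm (G (Complex b y) - G (Complex a y)) \<le> M * (b - a)"
    if y: "y > 0" and M: "\<And>x. a \<le> x \<Longrightarrow> x \<le> b \<Longrightarrow> norm (F (Complex x y)) \<le> M" for y M
  proof -
    let ?S = "closed_segment (Complex a y) (Complex b y)"
    have S: "z = Complex (Re z) y \<and> a \<le> Re z \<and> Re z \<le> b" if "z \<in> ?S" for z
      using that ab closed_segment_same_Im[of "Complex a y" "Complex b y"]
      by (auto simp: complex_eq_iff closed_segment_eq_real_ivl)
    have "norm (G (Complex b y) - G (Complex a y)) \<le> M * norm (Complex b y - Complex a y)"
    proof (rule field_differentiable_bound[where S = ?S and f' = F])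
      fix z assume z: "z \<in> ?S"
      then have "Im z > 0" using S[OF z] y by (metis complex.sel(2))
      then show "(G has_field_derivative F z) (at z within ?S)"
        using G by (simp add: has_field_derivative_at_within)
      show "norm (F z) \<le> M" using S[OF z] M by metis
    qed auto
    also have "norm (Complex b y - Complex a y) = b - a"
      using ab by (simp add: complex_diff complex_norm)
    finally show ?thesis .
  qed
  have "norm (integral {c..d} (\<lambda>t. F (Complex a t)) - integral {c..d} (\<lambda>t. F (Complex b t)))
      = norm ((G (Complex b d) - G (Complex a d)) - (G (Complex b c) - G (Complex a c)))"
    unfolding vert by (simp flip: right_diff_distrib add: norm_mult) (simp add: algebra_simps)
  also have "\<dots> \<le> M2 * (b - a) + M1 * (b - a)"
    using cd M by (intro order_trans[OF norm_triangle_ineq4] add_mono horiz) auto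
  finally show ?thesis by (simp add: algebra_simps)
qed

text \<open>
  Three lines theorem for mean squares. Smearing \<open>F\<close> vertically against its own conjugate on the line of
  abscissa \<open>\<sigma>\<close> reduces it to the maximum modulus principle for one holomorphic function. The factor
  \<open>Y powr (w - \<sigma>)\<close> distributes the weight between the left and the right edge, and the Gaussian
  suppresses the horizontal edges.
\<close>

lemma mean_square_three_lines:
  assumes F: "F holomorphic_on {s. Im s > 0}"
    and ab: "a \<le> \<sigma>" "\<sigma> \<le> b" "b - a \<le> 2" and H: "0 \<le> H" "H < T1" and Y: "Y \<ge> 1"
    and left: "\<And>y. - H \<le> y \<Longrightarrow> y \<le> H \<Longrightarrow> square_integral F a (T1+y) (T2+y) \<le> A\<^sup>2"
    and right: "\<And>y. - H \<le> y \<Longrightarrow> y \<le> H \<Longrightarrow> square_integral F b (T1+y) (T2+y) \<le> E\<^sup>2"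
    and ends: "\<And>x y. a \<le> x \<Longrightarrow> x \<le> b \<Longrightarrow> \<bar>y\<bar> = H \<Longrightarrow>
       square_integral F x (T1+y) (T2+y) \<le> G\<^sup>2"
    and nonneg: "A \<ge> 0" "E \<ge> 0" "G \<ge> 0"
    and B: "exp 4 * Y powr (a - \<sigma>) * A \<le> B" "exp 4 * Y powr (b - \<sigma>) * E \<le> B"
      "exp 4 * Y powr (b - \<sigma>) * (exp (- H\<^sup>2) * G) \<le> B"
  shows "square_integral F \<sigma> T1 T2 \<le> B\<^sup>2"
proof -
  define U where "U = {w. Im w > - T1}"
  have U: "open U" "convex U"
    using convex_halfspace_Im_gt[of "- T1"] by (auto simp: U_def open_halfspace_Im_gt)
  have Fop: "open {s. Im s > 0}" by (rule open_halfspace_Im_gt)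
  define h where "h t = cnj (F (Complex \<sigma> t))" for t
  define I where "I = square_integral F \<sigma> T1 T2"
  define J where "J = sqrt I"
  \<comment> \<open>By the choice of \<open>h\<close>, \<open>\<Phi> \<sigma>\<close> is the integral \<open>I\<close> to be bounded, while Cauchy-Schwarz bounds \<open>\<Phi>\<close> on any vertical line by \<open>sqrt I\<close> times the root of the mean square of \<open>F\<close> there.\<close>
  define \<Phi> where "\<Phi> w = integral (cbox T1 T2) (\<lambda>t. F (w + \<i> * of_real t) * h t)" for w
  define \<Psi> where "\<Psi> w = \<Phi> w * (of_real Y powr (w - of_real \<sigma>) * exp ((w - of_real \<sigma>)\<^sup>2))" for w
  have T1: "T1 > 0" using H by simp
  have hc: "continuous_on {T1..T2} h"
    unfolding h_def by (intro continuous_intros continuous_on_vertical[OF F T1])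
  have inU: "w + \<i> * of_real t \<in> {s. Im s > 0}" if "w \<in> U" "t \<in> cbox T1 T2" for w t
    using that by (auto simp: U_def)
  have I0: "I \<ge> 0" unfolding I_def
    by (intro integral_nonneg integrable_continuous_interval continuous_intros continuous_on_vertical[OF F T1]) simp
  have "\<Phi> holomorphic_on U"
    unfolding \<Phi>_def
  proof (rule leibniz_rule_holomorphic[where fx = "\<lambda>w t. deriv F (w + \<i> * of_real t) * h t"])
    show "convex U" by (rule U)
    fix w t assume wt: "w \<in> U" "t \<in> cbox T1 T2"
    have "(F has_field_derivative deriv F (w + \<i> * of_real t)) (at (w + \<i> * of_real t))"
      using inU[OF wt] by (intro holomorphic_derivI[OF F Fop])
    then have "((\<lambda>w. F (w + \<i> * of_real t)) has_field_derivative deriv F (w + \<i> * of_real t)) (at w)"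
      using DERIV_shift[of F "deriv F (w + \<i> * of_real t)" w "\<i> * of_real t"] by simp
    from DERIV_cmult_right[OF this, of "h t"]
    show "((\<lambda>w. F (w + \<i> * of_real t) * h t) has_field_derivative deriv F (w + \<i> * of_real t) * h t) (at w within U)"
      by (rule has_field_derivative_at_within)
  next
    fix w assume w: "w \<in> U"
    have "continuous_on (cbox T1 T2) (F \<circ> (\<lambda>t. w + \<i> * of_real t))"
      by (intro continuous_on_compose continuous_intros
          continuous_on_subset[OF holomorphic_on_imp_continuous_on[OF F]]) (use inU[OF w] in auto)
    then have "continuous_on (cbox T1 T2) (\<lambda>t. F (w + \<i> * of_real t) * h t)"
      using hc by (intro continuous_intros) (auto simp: o_def)
    then show "(\<lambda>t. F (w + \<i> * of_real t) * h t) integrable_on cbox T1 T2"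
      by (rule integrable_continuous)
  next
    have "continuous_on (U \<times> cbox T1 T2) (deriv F \<circ> (\<lambda>p. fst p + \<i> * of_real (snd p)))"
      by (intro continuous_on_compose continuous_intros
          continuous_on_subset[OF holomorphic_on_imp_continuous_on[OF holomorphic_deriv[OF F Fop]]])
         (use inU in auto)
    moreover have "continuous_on (U \<times> cbox T1 T2) (h \<circ> snd)"
      by (intro continuous_on_compose continuous_intros continuous_on_subset[OF hc]) auto
    ultimately have "continuous_on (U \<times> cbox T1 T2)
        (\<lambda>p. (deriv F \<circ> (\<lambda>p. fst p + \<i> * of_real (snd p))) p * (h \<circ> snd) p)"
      by (rule continuous_on_mult)
    then show "continuous_on (U \<times> cbox T1 T2) (\<lambda>(w, t). deriv F (w + \<i> * of_real t) * h t)"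
      by (simp add: o_def case_prod_unfold)
  qed
  then have \<Psi>h: "\<Psi> holomorphic_on U"
    unfolding \<Psi>_def using Y by (intro holomorphic_intros) auto
  have \<Phi>b: "norm (\<Phi> (Complex x y)) \<le> X * J"
    if y: "- H \<le> y" "y \<le> H" and X: "X \<ge> 0"
      and XI: "square_integral F x (T1+y) (T2+y) \<le> X\<^sup>2" for x y X
  proof -
    have e: "Complex x y + \<i> * of_real t = Complex x (t + y)" for t by (simp add: complex_eq_iff)
    have "continuous_on {T1..T2} ((\<lambda>t. F (Complex x t)) \<circ> (\<lambda>t. t + y))"
      using y H by (intro continuous_on_compose continuous_intros continuous_on_vertical[OF F]
        continuous_on_subset[OF continuous_on_vertical[OF F, of "T1 + y" "T2 + y"]]) auto
    then have "norm (\<Phi> (Complex x y)) \<le> sqrt (integral {T1..T2} (\<lambda>t. (norm (F (Complex x (t + y))))\<^sup>2)) *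
        sqrt (integral {T1..T2} (\<lambda>t. (norm (h t))\<^sup>2))"
      unfolding \<Phi>_def e using hc integral_Cauchy_Schwarz[of T1 T2 "\<lambda>t. F (Complex x (t + y))" h]
      by (simp add: o_def)
    also have "integral {T1..T2} (\<lambda>t. (norm (F (Complex x (t + y))))\<^sup>2) =
        square_integral F x (T1+y) (T2+y)"
      using integral_shift_real_ivl[of "T1 + y" y "T2 + y" "\<lambda>t. (norm (F (Complex x t)))\<^sup>2"] by simp
    also have "integral {T1..T2} (\<lambda>t. (norm (h t))\<^sup>2) = I" by (simp add: h_def I_def)
    also have "sqrt (square_integral F x (T1+y) (T2+y)) \<le> X"
      using XI X by (intro real_le_lsqrt) auto
    finally show ?thesis using I0 by (simp add: J_def mult_right_mono)
  qed
  have kernel: "norm (of_real Y powr (Complex x y - of_real \<sigma>) * exp ((Complex x y - of_real \<sigma>)\<^sup>2))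
      \<le> exp 4 * Y powr (x - \<sigma>) * exp (- y\<^sup>2)" if "a \<le> x" "x \<le> b" for x y
  proof -
    have "\<bar>x - \<sigma>\<bar> \<le> 2" using that ab by auto
    then have "(x - \<sigma>)\<^sup>2 \<le> 2\<^sup>2" using abs_le_square_iff[of "x - \<sigma>" 2] by simp
    then have "norm (exp ((Complex x y - of_real \<sigma>)\<^sup>2)) \<le> exp 4 * exp (- y\<^sup>2)"
      unfolding norm_exp_square by (simp flip: exp_add)
    moreover have "norm (of_real Y powr (Complex x y - of_real \<sigma>)) = Y powr (x - \<sigma>)"
      using Y by (subst norm_powr_real_powr) auto
    ultimately have "norm (of_real Y powr (Complex x y - of_real \<sigma>) * exp ((Complex x y - of_real \<sigma>)\<^sup>2))
      \<le> Y powr (x - \<sigma>) * (exp 4 * exp (- y\<^sup>2))"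
      unfolding norm_mult by (intro mult_mono) auto
    then show ?thesis by (simp add: mult_ac)
  qed
  have side: "norm (\<Psi> (Complex x y)) \<le> J * B"
    if x: "a \<le> x" "x \<le> b" and y: "- H \<le> y" "y \<le> H" and X: "X \<ge> 0"
      and XI: "square_integral F x (T1+y) (T2+y) \<le> X\<^sup>2"
      and XB: "exp 4 * Y powr (x - \<sigma>) * (exp (- y\<^sup>2) * X) \<le> B" for x y X
  proof -
    have "norm (\<Psi> (Complex x y)) \<le> (X * J) * (exp 4 * Y powr (x - \<sigma>) * exp (- y\<^sup>2))"
      unfolding \<Psi>_def norm_mult[of "\<Phi> _"]
      using \<Phi>b[OF y X XI] kernel[OF x, of y] X I0 by (intro mult_mono) (auto simp: J_def)
    also have "\<dots> = J * (exp 4 * Y powr (x - \<sigma>) * (exp (- y\<^sup>2) * X))" by simp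
    also have "\<dots> \<le> J * B" using XB I0 by (intro mult_left_mono) (auto simp: J_def)
    finally show ?thesis .
  qed
  have drop: "exp 4 * Y powr (x - \<sigma>) * (exp (- y\<^sup>2) * X) \<le> exp 4 * Y powr (x - \<sigma>) * X"
    if "X \<ge> 0" for x y X :: real
    using that by (intro mult_left_mono mult_left_le_one_le) auto
  have "norm (\<Psi> (Complex \<sigma> 0)) \<le> J * B"
  proof (rule maximum_modulus_rectangle[where F = \<Psi> and S = U and a = a and b = b and c = "- H" and d = H])
    show "\<Psi> holomorphic_on U" "open U" by (fact \<Psi>h U)+
    show "cbox (Complex a (- H)) (Complex b H) \<subseteq> U" using H by (auto simp: U_def in_cbox_complex_iff)
    show "Complex \<sigma> 0 \<in> cbox (Complex a (- H)) (Complex b H)" using H ab by (auto simp: in_cbox_complex_iff)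
  next
    fix y assume y: "- H \<le> y" "y \<le> H"
    show "norm (\<Psi> (Complex a y)) \<le> J * B"
      using ab nonneg by (intro side[OF _ _ y _ left[OF y]] order_trans[OF drop B(1)]) auto
    show "norm (\<Psi> (Complex b y)) \<le> J * B"
      using ab nonneg by (intro side[OF _ _ y _ right[OF y]] order_trans[OF drop B(2)]) auto
  next
    fix x assume x: "a \<le> x" "x \<le> b"
    have "exp 4 * Y powr (x - \<sigma>) * (exp (- H\<^sup>2) * G) \<le> exp 4 * Y powr (b - \<sigma>) * (exp (- H\<^sup>2) * G)"
      using x Y nonneg by (intro mult_right_mono mult_left_mono powr_mono) auto
    then have 1: "exp 4 * Y powr (x - \<sigma>) * (exp (- H\<^sup>2) * G) \<le> B" using B(3) by linarith
    show "norm (\<Psi> (Complex x (- H))) \<le> J * B"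
      using x H nonneg 1 by (intro side[OF _ _ _ _ _ ends]) auto
    show "norm (\<Psi> (Complex x H)) \<le> J * B"
      using x H nonneg 1 by (intro side[OF _ _ _ _ _ ends]) auto
  qed
  moreover have "\<Psi> (Complex \<sigma> 0) = of_real I"
  proof -
    have c0: "Complex \<sigma> 0 = of_real \<sigma>" by (simp add: complex_eq_iff)
    have e: "of_real \<sigma> + \<i> * of_real t = Complex \<sigma> t" for t by (simp add: complex_eq_iff)
    have "\<Phi> (of_real \<sigma>) = integral {T1..T2} (\<lambda>t. of_real ((norm (F (Complex \<sigma> t)))\<^sup>2))"
      unfolding \<Phi>_def e h_def by (simp add: complex_norm_square del: of_real_power)
    also have "\<dots> = of_real I"
      unfolding I_def
      by (intro integral_unique has_integral_of_real integrable_integral integrable_continuous_interval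
          continuous_intros continuous_on_vertical[OF F T1])
    finally show ?thesis using Y by (simp add: \<Psi>_def c0)
  qed
  ultimately have "J * J \<le> J * B" using I0 by (simp add: J_def)
  moreover have "B \<ge> 0" using order_trans[OF _ B(1)] nonneg by simp
  moreover have "J \<ge> 0" using I0 by (simp add: J_def)
  ultimately have "J \<le> B" by (cases "J = 0") (auto simp del: real_sqrt_mult_self)
  then have "J\<^sup>2 \<le> B\<^sup>2" using I0 by (intro power_mono) (auto simp: J_def)
  then show ?thesis using I0 by (simp add: J_def I_def)
qed

section \<open>Almost periodic functions with nonnegative coefficients\<close>

text \<open>
  Bohr almost periodic functions whose frequencies carry nonnegative coefficients. Describing them by
  closure properties makes the passage from characters to products, series and exponentials an
  induction, and no Fourier coefficient has to be computed: positivity of the mean is all that is used.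
\<close>

inductive pos_ap :: "(real \<Rightarrow> complex) \<Rightarrow> bool" where
  pos_ap_cis: "pos_ap (\<lambda>t. cis (l * t))"
| pos_ap_scale: "pos_ap f \<Longrightarrow> c \<ge> 0 \<Longrightarrow> pos_ap (\<lambda>t. of_real c * f t)"
| pos_ap_add: "pos_ap f \<Longrightarrow> pos_ap g \<Longrightarrow> pos_ap (\<lambda>t. f t + g t)"
| pos_ap_uniform_limit: "(\<And>n. pos_ap (f n)) \<Longrightarrow> uniform_limit UNIV f g sequentially \<Longrightarrow> pos_ap g"

lemma pos_ap_imp_bounded: "pos_ap f \<Longrightarrow> \<exists>B. \<forall>t. norm (f t) \<le> B"
proof (induction rule: pos_ap.induct)
  case (pos_ap_cis l)
  show ?case by (intro exI[of _ 1]) simp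
next
  case (pos_ap_scale f c)
  then obtain B where "\<forall>t. norm (f t) \<le> B" by blast
  with pos_ap_scale show ?case
    by (intro exI[of _ "c * B"]) (auto simp: norm_mult mult_left_mono)
next
  case (pos_ap_add f g)
  then obtain A B where "\<forall>t. norm (f t) \<le> A" "\<forall>t. norm (g t) \<le> B" by blast
  then show ?case by (intro exI[of _ "A + B"]) (auto intro: norm_triangle_mono)
next
  case (pos_ap_uniform_limit f g)
  from uniform_limitD[OF pos_ap_uniform_limit.hyps(2), of 1]
  obtain n where n: "\<And>t. dist (f n t) (g t) < 1" by (auto simp: eventually_sequentially)
  obtain B where B: "\<forall>t. norm (f n t) \<le> B" using pos_ap_uniform_limit by blast
  have "norm (g t) \<le> B + 1" for t
    using n[of t] B[rule_format, of t] norm_triangle_ineq2[of "g t" "f n t"] by (simp add: dist_norm norm_minus_commute)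
  then show ?case by blast
qed

lemma pos_ap_imp_continuous: "pos_ap f \<Longrightarrow> continuous_on A f"
proof (induction rule: pos_ap.induct)
  case (pos_ap_uniform_limit f g)
  have "uniform_limit A f g sequentially"
    using pos_ap_uniform_limit.hyps(2) by (rule uniform_limit_on_subset) simp
  then show ?case
    using pos_ap_uniform_limit.IH by (intro uniform_limit_theorem[where F = sequentially and f = f]) auto
qed (auto intro!: continuous_intros)

lemma pos_ap_uniform_limit_mult:
  assumes "\<And>n. pos_ap (f n)" "uniform_limit UNIV f g sequentially" "\<And>t. norm (h t) \<le> B"
  shows "uniform_limit UNIV (\<lambda>n t. h t * f n t) (\<lambda>t. h t * g t) sequentially"
proof (rule uniform_lim_mult[OF uniform_limit_const assms(2)])
  show "bounded (range h)" using assms(3) by (auto simp: bounded_iff)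
  have "pos_ap g" using assms(1,2) by (rule pos_ap_uniform_limit)
  then show "bounded (range g)" using pos_ap_imp_bounded by (auto simp: bounded_iff)
qed

lemma pos_ap_cis_mult: "pos_ap f \<Longrightarrow> pos_ap (\<lambda>t. cis (l * t) * f t)"
proof (induction rule: pos_ap.induct)
  case (pos_ap_cis k)
  have "(\<lambda>t. cis (l * t) * cis (k * t)) = (\<lambda>t. cis ((l + k) * t))"
    by (simp add: cis_mult algebra_simps)
  then show ?case using pos_ap.pos_ap_cis by metis
next
  case (pos_ap_scale f c)
  then show ?case using pos_ap.pos_ap_scale[of "\<lambda>t. cis (l * t) * f t" c] by (simp add: mult_ac)
next
  case (pos_ap_add f g)
  then show ?case using pos_ap.pos_ap_add by (simp add: distrib_left)
next
  case (pos_ap_uniform_limit f g)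
  show ?case
    by (rule pos_ap.pos_ap_uniform_limit[OF pos_ap_uniform_limit.IH
          pos_ap_uniform_limit_mult[OF pos_ap_uniform_limit.hyps, of _ 1]]) simp
qed

text \<open>
  Products of characters are characters, and boundedness lets multiplication pass through uniform limits.
\<close>

lemma pos_ap_mult: "pos_ap f \<Longrightarrow> pos_ap g \<Longrightarrow> pos_ap (\<lambda>t. f t * g t)"
proof (induction rule: pos_ap.induct)
  case (pos_ap_cis l)
  then show ?case by (rule pos_ap_cis_mult)
next
  case (pos_ap_scale f c)
  then show ?case using pos_ap.pos_ap_scale[of "\<lambda>t. f t * g t" c] by (simp add: mult_ac)
next
  case (pos_ap_add f g)
  then show ?case using pos_ap.pos_ap_add by (simp add: distrib_right)
next
  case (pos_ap_uniform_limit f f')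
  obtain B where "\<forall>t. norm (g t) \<le> B" using pos_ap_imp_bounded[OF pos_ap_uniform_limit.prems] by blast
  then have "uniform_limit UNIV (\<lambda>n t. g t * f n t) (\<lambda>t. g t * f' t) sequentially"
    by (intro pos_ap_uniform_limit_mult[OF pos_ap_uniform_limit.hyps]) auto
  then have "uniform_limit UNIV (\<lambda>n t. f n t * g t) (\<lambda>t. f' t * g t) sequentially"
    by (simp add: mult.commute)
  with pos_ap_uniform_limit.IH[OF pos_ap_uniform_limit.prems] show ?case
    by (rule pos_ap.pos_ap_uniform_limit)
qed

lemma pos_ap_const: "c \<ge> 0 \<Longrightarrow> pos_ap (\<lambda>t. of_real c)"
  using pos_ap_scale[OF pos_ap_cis[of 0]] by simp

lemma pos_ap_power: "pos_ap f \<Longrightarrow> pos_ap (\<lambda>t. f t ^ n)"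
  by (induction n) (use pos_ap_const[of 1] in \<open>auto intro: pos_ap_mult\<close>)

lemma pos_ap_sum: "(\<And>i. i \<in> A \<Longrightarrow> pos_ap (f i)) \<Longrightarrow> pos_ap (\<lambda>t. \<Sum>i\<in>A. f i t)"
  by (induction A rule: infinite_finite_induct) (use pos_ap_const[of 0] in \<open>auto intro: pos_ap_add\<close>)

lemma pos_ap_suminf:
  assumes "\<And>n. pos_ap (f n)" "\<And>n t. norm (f n t) \<le> M n" "summable M"
  shows "pos_ap (\<lambda>t. \<Sum>n. f n t)"
  by (rule pos_ap_uniform_limit[OF _ Weierstrass_m_test[of UNIV f M]]) (use assms in \<open>auto intro: pos_ap_sum\<close>)

text \<open>
  The exponential series without its constant term still has nonnegative coefficients. This is what
  makes \<open>\<zeta>\<^sup>k - 1\<close> and \<open>\<zeta>\<^sup>k - P\<^sub>N\<^sup>k\<close> members of the class.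
\<close>

lemma pos_ap_exp_minus_1:
  assumes "pos_ap f"
  shows "pos_ap (\<lambda>t. exp (f t) - 1)"
proof -
  obtain B where B: "\<And>t. norm (f t) \<le> B" using pos_ap_imp_bounded[OF assms] by blast
  have "pos_ap (\<lambda>t. \<Sum>n. f t ^ Suc n /\<^sub>R fact (Suc n))"
  proof (rule pos_ap_suminf[where M = "\<lambda>n. B ^ Suc n /\<^sub>R fact (Suc n)"])
    show "pos_ap (\<lambda>t. f t ^ Suc n /\<^sub>R fact (Suc n))" for n
      using pos_ap_scale[OF pos_ap_power[OF assms, of "Suc n"], of "inverse (fact (Suc n))"]
      by (simp add: scaleR_conv_of_real)
    show "norm (f t ^ Suc n /\<^sub>R fact (Suc n)) \<le> B ^ Suc n /\<^sub>R fact (Suc n)" for n t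
      by (simp only: norm_scaleR norm_power real_scaleR_def abs_inverse abs_of_nonneg[OF fact_ge_zero])
         (intro mult_left_mono power_mono B; simp)
    show "summable (\<lambda>n. B ^ Suc n /\<^sub>R fact (Suc n))"
      using summable_exp_generic[of B] by (subst summable_Suc_iff[where f = "\<lambda>n. B ^ n /\<^sub>R fact n"])
  qed
  moreover have "(\<Sum>n. f t ^ Suc n /\<^sub>R fact (Suc n)) = exp (f t) - 1" for t
    using suminf_split_head[OF summable_exp_generic[of "f t"]] by (simp add: exp_def)
  ultimately show ?thesis by simp
qed

lemma pos_ap_exp: "pos_ap f \<Longrightarrow> pos_ap (\<lambda>t. exp (f t))"
  using pos_ap_add[OF pos_ap_exp_minus_1 pos_ap_const[of 1]] by simp

lemma integral_cis_bound:
  fixes l a b :: real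
  assumes "l \<noteq> 0" "a \<le> b"
  shows "norm (integral {a..b} (\<lambda>t. cis (l * t))) \<le> 2 / \<bar>l\<bar>"
proof -
  have "((\<lambda>t. cis (l * t) / (\<i> * of_real l)) has_vector_derivative cis (l * t)) (at t within {a..b})" for t
    unfolding cis_conv_exp using assms(1)
    by (auto intro!: derivative_eq_intros has_vector_derivative_real_field simp: field_simps)
  from fundamental_theorem_of_calculus[OF assms(2) this]
  have "integral {a..b} (\<lambda>t. cis (l * t)) = cis (l * b) / (\<i> * of_real l) - cis (l * a) / (\<i> * of_real l)"
    by (rule integral_unique)
  also have "norm \<dots> \<le> 1 / \<bar>l\<bar> + 1 / \<bar>l\<bar>"
    by (intro order_trans[OF norm_triangle_ineq4] add_mono) (auto simp: norm_divide norm_mult)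
  finally show ?thesis by simp
qed

lemma pos_ap_integrable: "pos_ap f \<Longrightarrow> f integrable_on {a..b}"
  by (intro integrable_continuous_interval pos_ap_imp_continuous)

text \<open>
  A character has mean \<open>0\<close> or \<open>1\<close>, and the inequality, having an \<open>\<epsilon>\<close> to spare, survives nonnegative
  combinations and uniform limits.
\<close>

lemma pos_ap_mean_nonneg:
  assumes "pos_ap f" "\<epsilon> > 0"
  shows "\<forall>\<^sub>F T in at_top. Re (integral {1..T} f) \<ge> - (\<epsilon> * T)"
  using assms
proof (induction arbitrary: \<epsilon> rule: pos_ap.induct)
  case (pos_ap_cis l)
  show ?case
  proof (cases "l = 0")
    case True
    show ?thesis
      using eventually_ge_at_top[of 1]
    proof eventually_elim
      case (elim T)
      then have "\<epsilon> * T \<ge> 0" using pos_ap_cis by simp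
      with elim True show ?case by simp
    qed
  next
    case False
    show ?thesis
      using eventually_ge_at_top[of 1] eventually_ge_at_top[of "2 / \<bar>l\<bar> / \<epsilon>"]
    proof eventually_elim
      case (elim T)
      have "2 / \<bar>l\<bar> \<le> \<epsilon> * T" using elim(2) pos_ap_cis unfolding pos_divide_le_eq[OF pos_ap_cis] by (simp add: mult.commute)
      then show ?case
        using integral_cis_bound[OF False elim(1)] abs_Re_le_cmod[of "integral {1..T} (\<lambda>t. cis (l * t))"] by linarith
    qed
  qed
next
  case (pos_ap_scale f c)
  have "\<forall>\<^sub>F T in at_top. Re (integral {1..T} f) \<ge> - (\<epsilon> / (c + 1) * T)"
    using pos_ap_scale by (intro pos_ap_scale.IH) auto
  then show ?case using eventually_ge_at_top[of 0]
  proof eventually_elim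
    case (elim T)
    have "c * (\<epsilon> / (c + 1) * T) \<le> \<epsilon> * T"
      using pos_ap_scale.hyps(2) pos_ap_scale.prems elim(2) by (simp add: field_simps)
    moreover have "c * Re (integral {1..T} f) \<ge> c * - (\<epsilon> / (c + 1) * T)"
      using elim pos_ap_scale by (intro mult_left_mono) auto
    ultimately show ?case by simp
  qed
next
  case (pos_ap_add f g)
  have "\<forall>\<^sub>F T in at_top. Re (integral {1..T} f) \<ge> - (\<epsilon> / 2 * T)"
    "\<forall>\<^sub>F T in at_top. Re (integral {1..T} g) \<ge> - (\<epsilon> / 2 * T)"
    using pos_ap_add.prems by (intro pos_ap_add.IH half_gt_zero; assumption)+
  then show ?case
  proof eventually_elim
    case (elim T)
    then show ?case by (simp add: integral_add pos_ap_integrable pos_ap_add)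
  qed
next
  case (pos_ap_uniform_limit f g)
  from uniform_limitD[OF pos_ap_uniform_limit.hyps(2), of "\<epsilon> / 2"] pos_ap_uniform_limit.prems
  obtain n where n: "\<And>t. dist (f n t) (g t) < \<epsilon> / 2" by (auto simp: eventually_sequentially)
  have g: "pos_ap g" using pos_ap_uniform_limit.hyps by (rule pos_ap.pos_ap_uniform_limit)
  have "\<forall>\<^sub>F T in at_top. Re (integral {1..T} (f n)) \<ge> - (\<epsilon> / 2 * T)"
    using pos_ap_uniform_limit.prems by (intro pos_ap_uniform_limit.IH) auto
  then show ?case using eventually_ge_at_top[of 1]
  proof eventually_elim
    case (elim T)
    have i: "f n integrable_on {1..T}" "g integrable_on {1..T}"
      using pos_ap_integrable pos_ap_uniform_limit(1) g by auto
    have "norm (integral {1..T} (\<lambda>t. f n t - g t)) \<le> integral {1..T} (\<lambda>t. \<epsilon> / 2)"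
      using n by (intro integral_norm_bound_integral integrable_diff i) (auto simp: dist_norm intro: less_imp_le)
    also have "\<dots> \<le> \<epsilon> / 2 * T" using elim pos_ap_uniform_limit.prems by (simp add: field_simps)
    finally have "Re (integral {1..T} (f n)) - Re (integral {1..T} g) \<le> \<epsilon> / 2 * T"
      using abs_Re_le_cmod[of "integral {1..T} (\<lambda>t. f n t - g t)"] by (simp add: integral_diff i)
    with elim show ?case by simp
  qed
qed

section \<open>Dirichlet series and the logarithm of zeta\<close>

text \<open>
  At \<open>n = 0\<close> the term vanishes because \<open>0 powr z = 0\<close>, so series may be indexed by all natural numbers.
\<close>

definition dterm :: "(nat \<Rightarrow> real) \<Rightarrow> complex \<Rightarrow> nat \<Rightarrow> complex" where
  "dterm a s n = of_real (a n) * of_nat n powr (- s)"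

definition dirichlet :: "(nat \<Rightarrow> real) \<Rightarrow> complex \<Rightarrow> complex" where
  "dirichlet a s = (\<Sum>n. dterm a s n)"

definition dirichlet_conv :: "(nat \<Rightarrow> real) \<Rightarrow> (nat \<Rightarrow> real) \<Rightarrow> nat \<Rightarrow> real" where
  "dirichlet_conv a b n = (\<Sum>d | d dvd n. a d * b (n div d))"

lemma dterm_0 [simp]: "dterm a s 0 = 0"
  by (simp add: dterm_def)

lemma norm_dterm: "norm (dterm a s n) = \<bar>a n\<bar> * real n powr (- Re s)"
proof (cases "n = 0")
  case False
  then have "norm ((of_nat n :: complex) powr (- s)) = real n powr (- Re s)"
    by (subst norm_powr_real_powr) auto
  then show ?thesis by (simp add: dterm_def norm_mult)
qed simp

lemma summable_dterm_bounded:
  assumes "\<And>n. \<bar>a n\<bar> \<le> 1" "Re s > 1"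
  shows "summable (\<lambda>n. norm (dterm a s n))"
proof (rule summable_comparison_test'[where N = 0])
  show "summable (\<lambda>n. real n powr (- Re s))"
    using assms(2) by (subst summable_real_powr_iff) auto
  show "norm (norm (dterm a s n)) \<le> real n powr (- Re s)" for n
    using assms(1)[of n] by (simp add: norm_dterm mult_left_le_one_le)
qed

lemma dirichlet_sums:
  "summable (\<lambda>n. norm (dterm a s n)) \<Longrightarrow> dterm a s sums dirichlet a s"
  unfolding dirichlet_def by (rule summable_sums[OF summable_norm_cancel])

lemma dirichlet_product_sums:
  assumes a: "summable (\<lambda>n. norm (dterm a s n))" and b: "summable (\<lambda>n. norm (dterm b s n))"
  shows "dterm (dirichlet_conv a b) s sums (dirichlet a s * dirichlet b s)"
proof -
  let ?x = "dterm a s" and ?y = "dterm b s"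
  let ?P = "{0<..} :: nat set"
  have hx: "(?x has_sum dirichlet a s) UNIV" and hy: "(?y has_sum dirichlet b s) UNIV"
    by (rule norm_summable_imp_has_sum[OF a dirichlet_sums[OF a]],
        rule norm_summable_imp_has_sum[OF b dirichlet_sums[OF b]])
  have nx: "(\<lambda>n. norm (?x n)) summable_on UNIV" and ny: "(\<lambda>n. norm (?y n)) summable_on UNIV"
    using a b by (subst summable_on_UNIV_nonneg_real_iff; simp)+
  have "(\<lambda>p. norm ((\<lambda>(m, n). ?x m * ?y n) p)) summable_on (UNIV \<times> UNIV)"
  proof (subst Infinite_Sum.abs_summable_on_Sigma_iff, intro conjI ballI)
    show "(\<lambda>n. norm (case (m, n) of (m, n) \<Rightarrow> ?x m * ?y n)) summable_on UNIV" for m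
      using summable_on_cmult_right[OF ny, of "norm (?x m)"] by (simp add: norm_mult)
    have "(\<lambda>m. norm (?x m) * infsum (\<lambda>n. norm (?y n)) UNIV) summable_on UNIV"
      by (rule summable_on_cmult_left[OF nx])
    moreover have "norm (infsum (\<lambda>n. norm (?x m * ?y n)) UNIV) =
        norm (?x m) * infsum (\<lambda>n. norm (?y n)) UNIV" for m
    proof -
      have "infsum (\<lambda>n. norm (?x m * ?y n)) UNIV = norm (?x m) * infsum (\<lambda>n. norm (?y n)) UNIV"
        unfolding norm_mult using ny by (intro infsum_cmult_right) auto
      moreover have "infsum (\<lambda>n. norm (?y n)) UNIV \<ge> 0" by (intro infsum_nonneg) simp
      ultimately show ?thesis by simp
    qed
    ultimately show "(\<lambda>m. norm (infsum (\<lambda>n. norm (case (m, n) of (m, n) \<Rightarrow> ?x m * ?y n)) UNIV)) summable_on UNIV"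
      by simp
  qed
  then have "(\<lambda>(m, n). ?x m * ?y n) summable_on (UNIV \<times> UNIV)"
    by (rule Infinite_Sum.abs_summable_summable)
  then obtain S where S: "((\<lambda>(m, n). ?x m * ?y n) has_sum S) (UNIV \<times> UNIV)"
    by (auto simp: summable_on_def)
  have "((\<lambda>m. ?x m * dirichlet b s) has_sum S) UNIV"
    using S by (rule has_sum_SigmaD) (use has_sum_cmult_right[OF hy] in auto)
  moreover have "((\<lambda>m. ?x m * dirichlet b s) has_sum (dirichlet a s * dirichlet b s)) UNIV"
    using hx by (rule has_sum_cmult_left)
  ultimately have S_eq: "S = dirichlet a s * dirichlet b s" by (rule has_sum_unique)
  \<comment> \<open>Every number divides \<open>0\<close>, so the index \<open>0\<close> is dropped before the pairs are grouped by their product.\<close>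
  have "((\<lambda>(m, n). ?x m * ?y n) has_sum S) (?P \<times> ?P)"
    using S by (subst has_sum_cong_neutral[where T = "UNIV \<times> UNIV" and g = "\<lambda>(m, n). ?x m * ?y n"]) (auto intro!: gr0I)
  moreover have "bij_betw (\<lambda>(n, d). (d, n div d)) (Sigma ?P (\<lambda>n. {d. d dvd n})) (?P \<times> ?P)"
    by (rule bij_betw_byWitness[where f' = "\<lambda>(d, e). (d * e, d)"]) (auto simp: dvd_pos_nat intro!: Nat.gr0I elim!: dvdE)
  ultimately have "((\<lambda>p. (\<lambda>(m, n). ?x m * ?y n) ((\<lambda>(n, d). (d, n div d)) p)) has_sum S) (Sigma ?P (\<lambda>n. {d. d dvd n}))"
    by (subst has_sum_reindex_bij_betw)
  then have "((\<lambda>(n, d). ?x d * ?y (n div d)) has_sum S) (Sigma ?P (\<lambda>n. {d. d dvd n}))"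
    by (simp add: case_prod_unfold)
  then have "((\<lambda>n. \<Sum>d | d dvd n. ?x d * ?y (n div d)) has_sum S) ?P"
    by (rule has_sum_SigmaD) (auto intro!: has_sum_finite)
  also have "?this \<longleftrightarrow> (dterm (dirichlet_conv a b) s has_sum S) UNIV"
  proof (rule has_sum_cong_neutral)
    fix n assume "n \<in> ?P \<inter> UNIV"
    then have n: "n > 0" by simp
    have "?x d * ?y (n div d) = of_real (a d * b (n div d)) * of_nat n powr (- s)" if dn: "d dvd n" for d
    proof -
      obtain e where e: "n = d * e" using dn by blast
      then have "d > 0" "e > 0" using n by auto
      then show ?thesis by (simp add: e dterm_def powr_times_real mult_ac)
    qed
    then have "(\<Sum>d | d dvd n. ?x d * ?y (n div d)) =
        (\<Sum>d | d dvd n. of_real (a d * b (n div d)) * of_nat n powr (- s))"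
      by (intro sum.cong) auto
    then show "(\<Sum>d | d dvd n. ?x d * ?y (n div d)) = dterm (dirichlet_conv a b) s n"
      by (simp add: dterm_def dirichlet_conv_def sum_distrib_right)
  qed auto
  finally have "dterm (dirichlet_conv a b) s sums S" by (rule has_sum_imp_sums)
  then show ?thesis by (simp only: S_eq)
qed

lemma zeta_eq_dirichlet: "Re s > 1 \<Longrightarrow> zeta s = dirichlet (\<lambda>_. 1) s"
proof -
  assume s: "Re s > 1"
  have "dterm (\<lambda>_. 1) s sums dirichlet (\<lambda>_. 1) s"
    using s by (intro dirichlet_sums summable_dterm_bounded) auto
  then have "(\<lambda>n. dterm (\<lambda>_. 1) s (Suc n)) sums dirichlet (\<lambda>_. 1) s"
    by (subst sums_Suc_iff) simp
  moreover have "(\<lambda>n. dterm (\<lambda>_. 1) s (Suc n)) sums zeta s"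
    using is_zeta_zeta s by (simp add: is_zeta_def dterm_def)
  ultimately show ?thesis by (rule sums_unique2[symmetric])
qed

lemma dirichlet_has_field_derivative:
  assumes a: "\<And>n. \<bar>a n\<bar> \<le> 1" and s: "Re s > 3/2"
  shows "(dirichlet a has_field_derivative - dirichlet (\<lambda>n. a n * ln (real n)) s) (at s)"
    and "summable (\<lambda>n. norm (dterm (\<lambda>n. a n * ln (real n)) s n))"
proof -
  let ?S = "{s. Re s > 3/2}"
  let ?b = "\<lambda>n. a n * ln (real n)"
  have M: "norm (dterm ?b s n) \<le> 4 * real n powr (- (5/4))" if "s \<in> ?S" for s n
  proof (cases "n = 0")
    case False
    have "\<bar>?b n\<bar> \<le> 1 * (real n powr (1/4) / (1/4))"
      unfolding abs_mult using False a ln_powr_bound[of "real n" "1/4"] by (intro mult_mono) auto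
    then have "norm (dterm ?b s n) \<le> (4 * real n powr (1/4)) * real n powr (- (3/2))"
      unfolding norm_dterm using that False by (intro mult_mono powr_mono) auto
    also have "\<dots> = 4 * real n powr (- (5/4))" by (simp flip: powr_add)
    finally show ?thesis .
  qed simp
  have sM: "summable (\<lambda>n. 4 * real n powr (- (5/4)))"
    by (intro summable_mult) (subst summable_real_powr_iff, simp)
  show "summable (\<lambda>n. norm (dterm ?b s n))"
    by (rule summable_comparison_test'[OF sM, of 0]) (use M s in auto)
  have ul: "uniform_limit ?S (\<lambda>n s. \<Sum>i<n. - dterm ?b s i) (\<lambda>s. \<Sum>i. - dterm ?b s i) sequentially"
    by (rule Weierstrass_m_test[OF _ sM]) (use M in auto)
  have der: "((\<lambda>s. dterm a s n) has_field_derivative - dterm ?b s n) (at s within ?S)" for n s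
  proof (cases "n = 0")
    case False
    have "((\<lambda>s. of_real (a n) * exp (- s * of_real (ln (real n)))) has_field_derivative
        of_real (a n) * (exp (- s * of_real (ln (real n))) * - of_real (ln (real n)))) (at s within ?S)"
      by (auto intro!: derivative_eq_intros)
    moreover have "of_nat n powr (- s) = exp (- s * of_real (ln (real n)))" for s :: complex
      using False Ln_of_real[of "real n"] by (simp add: powr_def)
    ultimately show ?thesis by (simp add: dterm_def mult_ac)
  qed simp
  have "summable (dterm a 2)"
    by (rule summable_norm_cancel[OF summable_dterm_bounded[OF a]]) simp
  from has_field_derivative_series[OF convex_halfspace_Re_gt der ul _ this]
  obtain g where g: "\<And>x. x \<in> ?S \<Longrightarrow> dterm a x sums g x"
    "\<And>x. x \<in> ?S \<Longrightarrow> (g has_field_derivative (\<Sum>i. - dterm ?b x i)) (at x within ?S)" by auto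
  have gd: "g x = dirichlet a x" if "x \<in> ?S" for x
    using g(1)[OF that] by (simp add: dirichlet_def sums_iff)
  have op: "open ?S" by (rule open_halfspace_Re_gt)
  have "(g has_field_derivative (\<Sum>i. - dterm ?b s i)) (at s)"
    using g(2)[of s] s at_within_open[OF _ op, of s] by auto
  then have "(dirichlet a has_field_derivative (\<Sum>i. - dterm ?b s i)) (at s)"
    by (rule has_field_derivative_transform_within_open[OF _ op]) (use gd s in auto)
  moreover have "(\<Sum>i. - dterm ?b s i) = - dirichlet ?b s"
    unfolding dirichlet_def using \<open>summable (\<lambda>n. norm (dterm ?b s n))\<close>
    by (rule suminf_minus[OF summable_norm_cancel])
  ultimately show "(dirichlet a has_field_derivative - dirichlet ?b s) (at s)" by simp
qed

text \<open>
  Without a constant term, every term carries a factor \<open>2 powr (- x)\<close>.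
\<close>

lemma dirichlet_tendsto_0:
  assumes a: "\<And>n. \<bar>a n\<bar> \<le> 1" "a 1 = 0"
  shows "((\<lambda>x. dirichlet a (of_real x)) \<longlongrightarrow> 0) at_top"
proof -
  have s2: "summable (\<lambda>n. real n powr (- 2))" by (subst summable_real_powr_iff) simp
  define Z where "Z = (\<Sum>n. real n powr (- 2))"
  have "norm (dirichlet a (of_real x)) \<le> 2 powr (2 - x) * Z" if x: "x \<ge> 2" for x
  proof -
    have "norm (dterm a (of_real x) n) \<le> 2 powr (2 - x) * real n powr (- 2)" for n
    proof (cases "n \<le> 1")
      case True
      then have "n = 0 \<or> n = 1" by auto
      then show ?thesis using a(2) by (auto simp: norm_dterm)
    next
      case False
      have "norm (dterm a (of_real x) n) \<le> 1 * real n powr (- x)"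
        unfolding norm_dterm using a(1) by (intro mult_mono) auto
      also have "\<dots> = real n powr (2 - x) * real n powr (- 2)" by (simp flip: powr_add)
      also have "\<dots> \<le> 2 powr (2 - x) * real n powr (- 2)"
        using False x by (intro mult_right_mono powr_mono2') auto
      finally show ?thesis .
    qed
    then have "norm (suminf (dterm a (of_real x))) \<le> (\<Sum>n. 2 powr (2 - x) * real n powr (- 2))"
      using s2 by (intro norm_suminf_le summable_mult)
    also have "\<dots> = 2 powr (2 - x) * Z" unfolding Z_def by (rule suminf_mult[OF s2])
    finally show ?thesis by (simp add: dirichlet_def)
  qed
  then have "\<forall>\<^sub>F x in at_top. norm (dirichlet a (of_real x)) \<le> 2 powr (2 - x) * Z"
    by (auto simp: eventually_at_top_linorder)
  moreover have "((\<lambda>x::real. 2 powr (2 - x) * Z) \<longlongrightarrow> 0) at_top"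
    by real_asymp
  ultimately show ?thesis by (rule Lim_null_comparison)
qed

text \<open>
  The coefficients of \<open>log \<zeta>\<close>: \<open>1 / j\<close> at the \<open>j\<close>-th power of a prime and \<open>0\<close> elsewhere; at \<open>n \<le> 1\<close> the numerator is \<open>0\<close>.
\<close>

definition log_zeta_coeff :: "nat \<Rightarrow> real" where
  "log_zeta_coeff n = mangoldt n / ln (real n)"

lemma log_zeta_coeff_nonneg: "log_zeta_coeff n \<ge> 0"
  unfolding log_zeta_coeff_def using mangoldt_nonneg[of n]
  by (cases "n = 0") (auto intro!: divide_nonneg_nonneg)

lemma log_zeta_coeff_le_1: "log_zeta_coeff n \<le> 1"
proof (cases "n \<le> 1")
  case False
  then show ?thesis using mangoldt_le[of n] by (simp add: log_zeta_coeff_def divide_le_eq)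
next
  case True
  then have "n = 0 \<or> n = 1" by auto
  then show ?thesis by (auto simp: log_zeta_coeff_def)
qed

lemma log_zeta_coeff_abs: "\<bar>log_zeta_coeff n\<bar> \<le> 1"
  using log_zeta_coeff_nonneg[of n] log_zeta_coeff_le_1[of n] by simp

lemma log_zeta_coeff_ln: "log_zeta_coeff n * ln (real n) = mangoldt n"
proof (cases "n \<le> 1")
  case True
  then have "n = 0 \<or> n = 1" by auto
  then show ?thesis by auto
qed (simp add: log_zeta_coeff_def)

text \<open>
  The identity \<open>\<Sum> d dvd n. \<Lambda> d = ln n\<close> says that \<open>- \<zeta>' / \<zeta>\<close> is the Dirichlet series of \<open>\<Lambda>\<close>, so the
  quotient of the two sides has derivative \<open>0\<close>.
\<close>

theorem zeta_eq_exp_dirichlet: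
  assumes s: "Re s > 3/2"
  shows "zeta s = exp (dirichlet log_zeta_coeff s)"
proof -
  let ?S = "{s. Re s > 3/2}"
  define W where "W s = dirichlet (\<lambda>_. 1) s * exp (- dirichlet log_zeta_coeff s)" for s
  have "(W has_field_derivative 0) (at s within ?S)" if s: "s \<in> ?S" for s
  proof -
    let ?l = "\<lambda>n. ln (real n)" and ?m = "\<lambda>n. mangoldt n :: real"
    have s': "Re s > 3/2" using s by simp
    have d1: "(dirichlet (\<lambda>_. 1) has_field_derivative - dirichlet ?l s) (at s)"
      using dirichlet_has_field_derivative(1)[of "\<lambda>_. 1", OF _ s'] by simp
    have d2: "(dirichlet log_zeta_coeff has_field_derivative - dirichlet ?m s) (at s)"
      "summable (\<lambda>n. norm (dterm ?m s n))"
      using dirichlet_has_field_derivative[of log_zeta_coeff, OF log_zeta_coeff_abs s']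
      by (simp_all add: log_zeta_coeff_ln)
    have "dterm (dirichlet_conv ?m (\<lambda>_. 1)) s sums (dirichlet ?m s * dirichlet (\<lambda>_. 1) s)"
      using s by (intro dirichlet_product_sums d2 summable_dterm_bounded) auto
    moreover have "dterm (dirichlet_conv ?m (\<lambda>_. 1)) s = dterm ?l s"
    proof
      fix n show "dterm (dirichlet_conv ?m (\<lambda>_. 1)) s n = dterm ?l s n"
        using mangoldt_sum[of n, where ?'a = real]
        by (cases "n = 0") (auto simp: dterm_def dirichlet_conv_def)
    qed
    ultimately have conv: "dirichlet ?l s = dirichlet ?m s * dirichlet (\<lambda>_. 1) s"
      by (simp add: dirichlet_def sums_iff)
    have "(W has_field_derivative
        (- dirichlet ?l s) * exp (- dirichlet log_zeta_coeff s) +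
        (exp (- dirichlet log_zeta_coeff s) * dirichlet ?m s) * dirichlet (\<lambda>_. 1) s) (at s)"
      unfolding W_def by (rule derivative_eq_intros d1 d2(1) refl | simp)+
    then have "(W has_field_derivative 0) (at s)" by (simp add: conv algebra_simps)
    then show ?thesis by (rule has_field_derivative_at_within)
  qed
  then obtain c where c: "\<And>s. s \<in> ?S \<Longrightarrow> W s = c"
    using has_field_derivative_zero_constant[OF convex_halfspace_Re_gt, of "3/2" W] by blast
  \<comment> \<open>The constant value of the quotient is its limit along the real axis.\<close>
  have "((\<lambda>x. dirichlet (\<lambda>n. if n = 1 then 0 else 1) (of_real x) + 1) \<longlongrightarrow> 0 + 1) at_top"
    by (intro tendsto_add dirichlet_tendsto_0 tendsto_const) auto
  moreover have "\<forall>\<^sub>F x in at_top. dirichlet (\<lambda>n. if n = 1 then 0 else 1) (of_real x) + 1 = dirichlet (\<lambda>_. 1) (of_real x)"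
    using eventually_gt_at_top[of 1]
  proof eventually_elim
    case (elim x)
    have "dterm (\<lambda>n. if n = 1 then 0 else 1) (of_real x) sums dirichlet (\<lambda>n. if n = 1 then 0 else 1) (of_real x)"
      using elim by (intro dirichlet_sums summable_dterm_bounded) auto
    moreover have "(\<lambda>n. if n = 1 then 1 else 0 :: complex) sums 1" by (rule sums_single)
    ultimately have "(\<lambda>n. dterm (\<lambda>n. if n = 1 then 0 else 1) (of_real x) n + (if n = 1 then 1 else 0)) sums
      (dirichlet (\<lambda>n. if n = 1 then 0 else 1) (of_real x) + 1)" by (rule sums_add)
    also have "(\<lambda>n. dterm (\<lambda>n. if n = 1 then 0 else 1) (of_real x) n + (if n = 1 then 1 else 0)) = dterm (\<lambda>_. 1) (of_real x)"
      by (auto simp: dterm_def)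
    finally show ?case by (simp add: dirichlet_def sums_iff)
  qed
  ultimately have "((\<lambda>x. dirichlet (\<lambda>_. 1) (of_real x)) \<longlongrightarrow> 0 + 1) at_top"
    by (rule Lim_transform_eventually)
  then have z: "((\<lambda>x. dirichlet (\<lambda>_. 1) (of_real x)) \<longlongrightarrow> 1) at_top" by simp
  have "((\<lambda>x. W (of_real x)) \<longlongrightarrow> 1 * exp (- 0)) at_top"
    unfolding W_def
    by (intro tendsto_intros z dirichlet_tendsto_0 log_zeta_coeff_abs) (simp add: log_zeta_coeff_def)
  moreover have "\<forall>\<^sub>F x in at_top. W (of_real x) = c"
    using eventually_gt_at_top[of "3/2"] by eventually_elim (use c in simp)
  ultimately have "((\<lambda>x. c) \<longlongrightarrow> 1 * exp (- 0)) (at_top :: real filter)"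
    by (rule Lim_transform_eventually)
  then have "c = 1" by (simp add: tendsto_const_iff)
  then have "W s = 1" using c s by simp
  then show ?thesis using zeta_eq_dirichlet[of s] s by (simp add: W_def exp_minus field_simps)
qed

section \<open>The coefficients of the powers of zeta\<close>

lemma card_divisors_mult_le:
  fixes p m a :: nat
  assumes p: "prime p" and m: "m > 0"
  shows "card {d. d dvd p ^ a * m} \<le> (a + 1) * card {d. d dvd m}"
proof -
  have "{d. d dvd p ^ a * m} \<subseteq> (\<lambda>(i, d). p ^ i * d) ` ({..a} \<times> {d. d dvd m})"
  proof
    fix d assume "d \<in> {d. d dvd p ^ a * m}"
    then obtain x y where xy: "d = x * y" "x dvd p ^ a" "y dvd m"
      using division_decomp[of d "p ^ a" m] by blast
    then obtain i where "i \<le> a" "x = p ^ i" using divides_primepow_nat[OF p, of x a] by blast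
    with xy show "d \<in> (\<lambda>(i, d). p ^ i * d) ` ({..a} \<times> {d. d dvd m})" by force
  qed
  then have "card {d. d dvd p ^ a * m} \<le> card ({..a} \<times> {d. d dvd m})"
    using m by (intro surj_card_le) auto
  then show ?thesis by (simp add: card_cartesian_product)
qed

text \<open>
  Removing the full power \<open>p ^ a\<close> of a prime from \<open>n\<close> divides the number of divisors by at most \<open>a + 1\<close>. This
  is absorbed by \<open>(p powr \<epsilon>) ^ a \<ge> 2 ^ a\<close> for large \<open>p\<close>, and costs one factor \<open>C\<close> for each of the finitely
  many small primes.
\<close>

lemma card_divisors_le_prime_count:
  fixes \<epsilon> :: real
  assumes e: "\<epsilon> > 0" and C: "C \<ge> 1" "\<And>a::nat. real (a + 1) \<le> C * 2 powr (\<epsilon> * real a)"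
    and M: "\<And>p::nat. p > M \<Longrightarrow> real p powr \<epsilon> \<ge> 2"
  shows "n > 0 \<Longrightarrow> real (card {d. d dvd n}) \<le> C ^ card {p. prime p \<and> p \<le> M \<and> p dvd n} * real n powr \<epsilon>"
proof (induction n rule: less_induct)
  case (less n)
  show ?case
  proof (cases "n = 1")
    case True
    then show ?thesis using C(1) by (simp add: one_le_power)
  next
    case False
    obtain p where p: "prime p" "p dvd n" using prime_factor_nat[OF False] by blast
    obtain a m where am: "n = p ^ a * m" "\<not> p dvd m"
      using multiplicity_decompose'[of n p] less.prems p prime_elem_not_unit
      by (metis multiplicity_decompose' not_prime_unit gr_implies_not0)
    have a: "a > 0" using am p by (cases a) auto
    have m: "m > 0" using am less.prems by (cases m) auto
    have p2: "p \<ge> 2" using p prime_ge_2_nat by blast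
    have "m * 1 < m * p ^ a" using m a p2 one_less_power[of p a] by (intro mult_strict_left_mono) auto
    then have mn: "m < n" by (simp add: am mult.commute)
    let ?Q = "\<lambda>n. {q. prime q \<and> q \<le> M \<and> q dvd n}"
    have fin: "finite (?Q m)" by (rule finite_subset[of _ "{..M}"]) auto
    have IH: "real (card {d. d dvd m}) \<le> C ^ card (?Q m) * real m powr \<epsilon>"
      using less.IH[OF mn] m by simp
    have "real (card {d. d dvd n}) \<le> real (a + 1) * real (card {d. d dvd m})"
      using card_divisors_mult_le[OF p(1) m, of a] unfolding am(1) of_nat_mult[symmetric] of_nat_le_iff .
    also have "\<dots> \<le> real (a + 1) * (C ^ card (?Q m) * real m powr \<epsilon>)"
      using IH by (intro mult_left_mono) auto
    also have "\<dots> \<le> (C ^ card (?Q n) * (real p powr \<epsilon>) ^ a) * real m powr \<epsilon>"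
    proof (cases "p \<le> M")
      case True
      have "q dvd n \<longleftrightarrow> q = p \<or> q dvd m" if "prime q" for q
        using that p a unfolding am(1)
        by (metis dvd_mult dvd_mult2 prime_dvd_mult_iff prime_dvd_power primes_dvd_imp_eq dvd_refl dvd_power)
      then have Q: "?Q n = insert p (?Q m)" using True p by auto
      have "card (?Q n) = Suc (card (?Q m))" unfolding Q using fin am(2) by (intro card_insert_disjoint) auto
      moreover have "real (a + 1) \<le> C * (real p powr \<epsilon>) ^ a"
      proof -
        have "2 powr (\<epsilon> * real a) = (2 powr \<epsilon>) ^ a" by (simp add: powr_powr flip: powr_realpow)
        also have "\<dots> \<le> (real p powr \<epsilon>) ^ a" using p2 e by (intro power_mono powr_mono2) auto
        finally show ?thesis using C(2)[of a] C(1) by (smt (verit) mult_left_mono)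
      qed
      then have "real (a + 1) * C ^ card (?Q m) \<le> (C * (real p powr \<epsilon>) ^ a) * C ^ card (?Q m)"
        using C(1) by (intro mult_right_mono) auto
      ultimately have "real (a + 1) * C ^ card (?Q m) \<le> C ^ card (?Q n) * (real p powr \<epsilon>) ^ a"
        by (simp add: mult_ac)
      then have "(real (a + 1) * C ^ card (?Q m)) * real m powr \<epsilon> \<le>
        (C ^ card (?Q n) * (real p powr \<epsilon>) ^ a) * real m powr \<epsilon>" by (intro mult_right_mono) auto
      then show ?thesis by (simp only: mult.assoc)
    next
      case False
      have "real (a + 1) \<le> 2 ^ a" by (induction a) auto
      also have "\<dots> \<le> (real p powr \<epsilon>) ^ a" using M[of p] False by (intro power_mono) auto
      finally have 1: "real (a + 1) \<le> (real p powr \<epsilon>) ^ a" .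
      have "card (?Q m) \<le> card (?Q n)"
        using less.prems by (intro card_mono) (auto simp: am(1))
      then have "C ^ card (?Q m) \<le> C ^ card (?Q n)" using C(1) by (intro power_increasing)
      then have "real (a + 1) * (C ^ card (?Q m) * real m powr \<epsilon>) \<le>
          (real p powr \<epsilon>) ^ a * (C ^ card (?Q n) * real m powr \<epsilon>)"
        using 1 C(1) by (intro mult_mono mult_right_mono mult_nonneg_nonneg) auto
      then show ?thesis by (simp only: mult_ac)
    qed
    also have "\<dots> = C ^ card (?Q n) * real n powr \<epsilon>"
      using p2 m by (simp add: am(1) powr_mult powr_powr mult_ac flip: powr_realpow)
    finally show ?thesis .
  qed
qed

lemma card_divisors_bound:
  fixes \<epsilon> :: real
  assumes e: "\<epsilon> > 0"
  shows "\<exists>C\<ge>1. \<forall>n>0. real (card {d. d dvd n}) \<le> C * real n powr \<epsilon>"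
proof -
  define \<delta> where "\<delta> = \<epsilon> * ln 2"
  \<comment> \<open>This \<open>C\<close> satisfies \<open>a + 1 \<le> C (1 + \<delta> a)\<close>.\<close>
  define C where "C = 1 + 1 / \<delta>"
  have d: "\<delta> > 0" using e by (simp add: \<delta>_def)
  have C1: "C \<ge> 1" using d by (simp add: C_def)
  have C2: "real (a + 1) \<le> C * 2 powr (\<epsilon> * real a)" for a :: nat
  proof -
    have "real (a + 1) \<le> C * (1 + \<delta> * real a)" using d by (simp add: C_def field_simps)
    also have "\<dots> \<le> C * exp (\<delta> * real a)" using C1 by (intro mult_left_mono exp_ge_add_one_self) auto
    also have "exp (\<delta> * real a) = 2 powr (\<epsilon> * real a)" by (simp add: powr_def \<delta>_def mult_ac)
    finally show ?thesis .
  qed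
  define M where "M = nat \<lceil>2 powr (1 / \<epsilon>)\<rceil>"
  have M: "real p powr \<epsilon> \<ge> 2" if "p > M" for p :: nat
  proof -
    have "real p \<ge> 2 powr (1 / \<epsilon>)" using that unfolding M_def by linarith
    then have "(2 powr (1 / \<epsilon>)) powr \<epsilon> \<le> real p powr \<epsilon>" using e by (intro powr_mono2) auto
    then show ?thesis using e by (simp add: powr_powr)
  qed
  define K where "K = C ^ card {..M}"
  have "real (card {d. d dvd n}) \<le> K * real n powr \<epsilon>" if "n > 0" for n
  proof -
    have "real (card {d. d dvd n}) \<le> C ^ card {p. prime p \<and> p \<le> M \<and> p dvd n} * real n powr \<epsilon>"
      by (rule card_divisors_le_prime_count[OF e C1 C2 M that])
    also have "\<dots> \<le> K * real n powr \<epsilon>"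
      unfolding K_def using C1 by (intro mult_right_mono power_increasing card_mono) auto
    finally show ?thesis .
  qed
  moreover have "K \<ge> 1" unfolding K_def using C1 by (rule one_le_power)
  ultimately show ?thesis by blast
qed

text \<open>
  The \<open>k\<close>-fold divisor function.
\<close>

primrec zeta_power_coeff :: "nat \<Rightarrow> nat \<Rightarrow> real" where
  "zeta_power_coeff 0 = (\<lambda>n. if n = 1 then 1 else 0)"
| "zeta_power_coeff (Suc k) = dirichlet_conv (zeta_power_coeff k) (\<lambda>_. 1)"

lemma zeta_power_coeff_nonneg: "zeta_power_coeff k n \<ge> 0"
  by (induction k arbitrary: n) (auto simp: dirichlet_conv_def intro: sum_nonneg)

lemma zeta_power_coeff_0 [simp]: "zeta_power_coeff k 0 = 0"
  by (cases k) (auto simp: dirichlet_conv_def)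

lemma zeta_power_coeff_bound:
  assumes "\<epsilon> > 0"
  shows "\<exists>C\<ge>1. \<forall>n. zeta_power_coeff k n \<le> C * real n powr \<epsilon>"
proof -
  have "\<exists>C\<ge>1. \<forall>n>0. zeta_power_coeff k n \<le> C * real n powr \<epsilon>"
    using assms
  proof (induction k arbitrary: \<epsilon>)
    case 0
    have "zeta_power_coeff 0 n \<le> 1 * real n powr \<epsilon>" if "n > 0" for n
      using that 0 by (auto simp: ge_one_powr_ge_zero)
    then show ?case by (intro exI[of _ 1]) auto
  next
    case (Suc k)
    have e: "\<epsilon> / 2 > 0" using Suc.prems by simp
    obtain C where C: "C \<ge> 1" "\<And>n. n > 0 \<Longrightarrow> zeta_power_coeff k n \<le> C * real n powr (\<epsilon> / 2)"
      using Suc.IH[OF e] by blast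
    obtain D where D: "D \<ge> 1" "\<And>n. n > 0 \<Longrightarrow> real (card {d. d dvd n}) \<le> D * real n powr (\<epsilon> / 2)"
      using card_divisors_bound[OF e] by blast
    have "zeta_power_coeff (Suc k) n \<le> (C * D) * real n powr \<epsilon>" if n: "n > 0" for n
    proof -
      have "zeta_power_coeff (Suc k) n \<le> (\<Sum>d | d dvd n. C * real n powr (\<epsilon> / 2))"
        unfolding zeta_power_coeff.simps dirichlet_conv_def
      proof (rule sum_mono)
        fix d assume "d \<in> {d. d dvd n}"
        then have d: "d > 0" "d \<le> n" using n by (auto intro: dvd_imp_le dvd_pos_nat)
        have "zeta_power_coeff k d \<le> C * real d powr (\<epsilon> / 2)" using C(2) d by auto
        also have "\<dots> \<le> C * real n powr (\<epsilon> / 2)" using d C(1) e by (intro mult_left_mono powr_mono2) auto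
        finally show "zeta_power_coeff k d * 1 \<le> C * real n powr (\<epsilon> / 2)" by simp
      qed
      also have "\<dots> = real (card {d. d dvd n}) * (C * real n powr (\<epsilon> / 2))" by simp
      also have "\<dots> \<le> (D * real n powr (\<epsilon> / 2)) * (C * real n powr (\<epsilon> / 2))"
        using D(2)[OF n] C(1) by (intro mult_right_mono) auto
      also have "\<dots> = (C * D) * (real n powr (\<epsilon> / 2) * real n powr (\<epsilon> / 2))" by simp
      also have "real n powr (\<epsilon> / 2) * real n powr (\<epsilon> / 2) = real n powr \<epsilon>" by (simp flip: powr_add)
      finally show ?thesis .
    qed
    moreover have "C * D \<ge> 1" using C D by (simp add: mult_ge1_I)
    ultimately show ?case by blast
  qed
  then obtain C where "C \<ge> 1" "\<And>n. n > 0 \<Longrightarrow> zeta_power_coeff k n \<le> C * real n powr \<epsilon>" by blast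
  moreover have "zeta_power_coeff k 0 \<le> C * real 0 powr \<epsilon>" by simp
  ultimately show ?thesis by (metis gr0I)
qed

lemma summable_zeta_power_coeff:
  assumes x: "x > 1"
  shows "summable (\<lambda>n. zeta_power_coeff k n * real n powr (- x))"
    and "summable (\<lambda>n. (zeta_power_coeff k n)\<^sup>2 * real n powr (- x))"
proof -
  define \<epsilon> where "\<epsilon> = (x - 1) / 4"
  have e: "\<epsilon> > 0" using x by (simp add: \<epsilon>_def)
  obtain C where C: "C \<ge> 1" "\<And>n. zeta_power_coeff k n \<le> C * real n powr \<epsilon>"
    using zeta_power_coeff_bound[OF e] by blast
  have s: "summable (\<lambda>n. C\<^sup>2 * real n powr (2 * \<epsilon> - x))"
    using x by (intro summable_mult) (subst summable_real_powr_iff, simp add: \<epsilon>_def field_simps)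
  have n: "\<bar>zeta_power_coeff k n\<bar> = zeta_power_coeff k n" for n using zeta_power_coeff_nonneg by simp
  have sq: "(zeta_power_coeff k n)\<^sup>2 * real n powr (- x) \<le> C\<^sup>2 * real n powr (2 * \<epsilon> - x)" for n
  proof -
    have "(zeta_power_coeff k n)\<^sup>2 * real n powr (- x) \<le> (C * real n powr \<epsilon>)\<^sup>2 * real n powr (- x)"
      using C by (intro mult_right_mono power_mono zeta_power_coeff_nonneg) auto
    also have "\<dots> = C\<^sup>2 * (real n powr \<epsilon> * real n powr \<epsilon> * real n powr (- x))"
      by (simp add: power2_eq_square)
    also have "real n powr \<epsilon> * real n powr \<epsilon> * real n powr (- x) = real n powr (2 * \<epsilon> - x)"
      by (simp flip: powr_add)
    finally show ?thesis .
  qed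
  then show "summable (\<lambda>n. (zeta_power_coeff k n)\<^sup>2 * real n powr (- x))"
    by (intro summable_comparison_test'[OF s, of 0]) simp
  show "summable (\<lambda>n. zeta_power_coeff k n * real n powr (- x))"
  proof (rule summable_comparison_test'[OF s, of 1])
    fix n :: nat assume "n \<ge> 1"
    have "zeta_power_coeff k n \<le> C * real n powr \<epsilon>" by (rule C)
    also have "\<dots> \<le> C\<^sup>2 * real n powr (2 * \<epsilon>)"
      using C(1) e \<open>n \<ge> 1\<close> by (intro mult_mono powr_mono) (auto simp: power2_eq_square)
    finally have "zeta_power_coeff k n * real n powr (- x) \<le> (C\<^sup>2 * real n powr (2 * \<epsilon>)) * real n powr (- x)"
      by (intro mult_right_mono) auto
    then show "norm (zeta_power_coeff k n * real n powr (- x)) \<le> C\<^sup>2 * real n powr (2 * \<epsilon> - x)"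
      by (simp add: n abs_mult mult.assoc flip: powr_add)
  qed
qed

lemma zeta_power_sums:
  assumes s: "Re s > 1"
  shows "dterm (zeta_power_coeff k) s sums (zeta s ^ k)"
proof (induction k)
  case 0
  have "dterm (zeta_power_coeff 0) s = (\<lambda>n. if n = 1 then 1 else 0)"
    by (auto simp: dterm_def)
  then show ?case using sums_single[of 1 "\<lambda>_. 1"] by simp
next
  case (Suc k)
  have "summable (\<lambda>n. norm (dterm (zeta_power_coeff k) s n))"
    using summable_zeta_power_coeff(1)[OF s, of k] zeta_power_coeff_nonneg[of k] by (simp add: norm_dterm)
  moreover have "summable (\<lambda>n. norm (dterm (\<lambda>_. 1) s n))"
    using s by (intro summable_dterm_bounded) auto
  ultimately have "dterm (dirichlet_conv (zeta_power_coeff k) (\<lambda>_. 1)) s sums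
      (dirichlet (zeta_power_coeff k) s * dirichlet (\<lambda>_. 1) s)"
    by (rule dirichlet_product_sums)
  moreover have "dirichlet (zeta_power_coeff k) s = zeta s ^ k"
    using Suc by (simp add: dirichlet_def sums_iff)
  ultimately show ?case using zeta_eq_dirichlet[OF s] by (simp add: mult.commute)
qed

text \<open>
  Rankin's trick: the factor \<open>n powr (- (1 - \<delta>))\<close> is at most \<open>X powr (- (1 - \<delta>))\<close> beyond the partial sum, and what is left
  of \<open>n powr (- 2)\<close> still gives a convergent series.
\<close>

lemma zeta_power_partial_sum_remainder:
  fixes X \<delta> t :: real
  assumes \<delta>: "\<delta> > 0" "\<delta> < 1" and X: "1 \<le> X" "X \<le> real N + 1"
  shows "norm (zeta (Complex 2 t) ^ k - (\<Sum>n=1..N. dterm (zeta_power_coeff k) (Complex 2 t) n)) \<le>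
    (\<Sum>n. zeta_power_coeff k n * real n powr (- (1 + \<delta>))) * X powr (- (1 - \<delta>))"
proof -
  define c where "c = zeta_power_coeff k"
  have c0: "c n \<ge> 0" for n by (simp add: c_def zeta_power_coeff_nonneg)
  have s1: "summable (\<lambda>n. c n * real n powr (- (1 + \<delta>)))"
    unfolding c_def using \<delta> by (intro summable_zeta_power_coeff) auto
  define Z1 where "Z1 = (\<Sum>n. c n * real n powr (- (1 + \<delta>)))"
  let ?s = "Complex 2 t"
  have zs: "dterm c ?s sums (zeta ?s ^ k)" unfolding c_def by (rule zeta_power_sums) simp
  have "zeta ?s ^ k - (\<Sum>n=1..N. dterm c ?s n) = (\<Sum>n. dterm c ?s (n + Suc N))"
  proof -
    have "(\<Sum>n<Suc N. dterm c ?s n) = (\<Sum>n=1..N. dterm c ?s n)"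
      by (rule sum.mono_neutral_right) (auto simp: not_less_eq_eq)
    then show ?thesis
      using suminf_minus_initial_segment[OF sums_summable[OF zs], of "Suc N"] sums_unique[OF zs] by simp
  qed
  also have "norm \<dots> \<le> (\<Sum>n. X powr (- (1 - \<delta>)) * (c (n + Suc N) * real (n + Suc N) powr (- (1 + \<delta>))))"
  proof (rule norm_suminf_le)
    fix n
    let ?n = "real (n + Suc N)"
    have nT: "?n \<ge> X" using X by simp
    have "?n powr (- 2) = ?n powr (- (1 - \<delta>)) * ?n powr (- (1 + \<delta>))"
      by (simp flip: powr_add)
    also have "?n powr (- (1 - \<delta>)) \<le> X powr (- (1 - \<delta>))"
      using nT X \<delta> by (intro powr_mono2') auto
    finally have "?n powr (- 2) \<le> X powr (- (1 - \<delta>)) * ?n powr (- (1 + \<delta>))" by (simp add: mult_right_mono)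
    then have "c (n + Suc N) * ?n powr (- 2) \<le> c (n + Suc N) * (X powr (- (1 - \<delta>)) * ?n powr (- (1 + \<delta>)))"
      using c0 by (intro mult_left_mono)
    then show "norm (dterm c ?s (n + Suc N)) \<le> X powr (- (1 - \<delta>)) * (c (n + Suc N) * ?n powr (- (1 + \<delta>)))"
      using c0[of "n + Suc N"] by (simp add: norm_dterm mult_ac)
  next
    show "summable (\<lambda>n. X powr (- (1 - \<delta>)) * (c (n + Suc N) * real (n + Suc N) powr (- (1 + \<delta>))))"
      using summable_ignore_initial_segment[OF s1, of "Suc N"] by (intro summable_mult)
  qed
  also have "\<dots> = X powr (- (1 - \<delta>)) * (\<Sum>n. c (n + Suc N) * real (n + Suc N) powr (- (1 + \<delta>)))"
    using summable_ignore_initial_segment[OF s1, of "Suc N"] by (intro suminf_mult)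
  also have "\<dots> \<le> X powr (- (1 - \<delta>)) * Z1"
  proof (rule mult_left_mono)
    have "0 \<le> (\<Sum>n<Suc N. c n * real n powr (- (1 + \<delta>)))"
      by (intro sum_nonneg mult_nonneg_nonneg c0) auto
    then show "(\<Sum>n. c (n + Suc N) * real (n + Suc N) powr (- (1 + \<delta>))) \<le> Z1"
      unfolding Z1_def suminf_minus_initial_segment[OF s1, of "Suc N"] by linarith
  qed simp
  finally show ?thesis by (simp add: mult.commute c_def Z1_def)
qed

section \<open>Dirichlet polynomials and the approximation to zeta\<close>

lemma integral_cos_bound:
  fixes w a b :: real
  assumes "w \<noteq> 0" "a \<le> b"
  shows "\<bar>integral {a..b} (\<lambda>t. cos (w * t))\<bar> \<le> 2 / \<bar>w\<bar>"
proof -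
  have "(\<lambda>t. cis (w * t)) integrable_on {a..b}"
    by (intro integrable_continuous_interval continuous_intros)
  from integral_linear[OF this bounded_linear_Re]
  have "integral {a..b} (\<lambda>t. cos (w * t)) = Re (integral {a..b} (\<lambda>t. cis (w * t)))" by (simp add: o_def)
  then show ?thesis using integral_cis_bound[OF assms] abs_Re_le_cmod order_trans by metis
qed

text \<open>
  The distances below \<open>m\<close> and those above \<open>m\<close> are each distinct integers between \<open>1\<close> and \<open>N\<close>.
\<close>

lemma sum_inverse_distance_le:
  assumes m: "m \<in> {1..N}"
  shows "(\<Sum>n\<in>{1..N} - {m}. 1 / \<bar>real n - real m\<bar>) \<le> 2 * harm N"
proof -
  have split: "{1..N} - {m} = {1..<m} \<union> {m<..N}" using m by auto
  have "(\<Sum>n\<in>{1..N} - {m}. 1 / \<bar>real n - real m\<bar>) =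
      (\<Sum>n\<in>{1..<m}. 1 / \<bar>real n - real m\<bar>) + (\<Sum>n\<in>{m<..N}. 1 / \<bar>real n - real m\<bar>)"
    unfolding split by (rule sum.union_disjoint) auto
  also have "(\<Sum>n\<in>{1..<m}. 1 / \<bar>real n - real m\<bar>) = (\<Sum>j\<in>{1..<m}. inverse (real j))"
    by (rule sum.reindex_bij_witness[of _ "\<lambda>j. m - j" "\<lambda>j. m - j"]) (auto simp: inverse_eq_divide)
  also have "\<dots> \<le> harm N"
    unfolding harm_def using m by (intro sum_mono2) auto
  also have "(\<Sum>n\<in>{m<..N}. 1 / \<bar>real n - real m\<bar>) = (\<Sum>j\<in>{1..N - m}. inverse (real j))"
    by (rule sum.reindex_bij_witness[of _ "\<lambda>j. m + j" "\<lambda>j. j - m"]) (auto simp: inverse_eq_divide)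
  also have "\<dots> \<le> harm N"
    unfolding harm_def by (intro sum_mono2) auto
  finally show ?thesis by simp
qed

lemma ln_distance_ge:
  assumes "m \<in> {1..N}" "n \<in> {1..N}"
  shows "\<bar>real n - real m\<bar> / real N \<le> \<bar>ln (real n) - ln (real m)\<bar>"
proof -
  have *: "(real n - real m) / real N \<le> ln (real n) - ln (real m)"
    if "m \<in> {1..N}" "n \<in> {1..N}" "m \<le> n" for m n
  proof -
    have "ln (real m / real n) \<le> real m / real n - 1" using that by (intro ln_le_minus_one) auto
    then have "1 - real m / real n \<le> ln (real n) - ln (real m)" using that by (simp add: ln_div)
    moreover have "(real n - real m) / real N \<le> (real n - real m) / real n"
      using that by (intro divide_left_mono) auto
    moreover have "(real n - real m) / real n = 1 - real m / real n" using that by (simp add: field_simps)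
    ultimately show ?thesis by linarith
  qed
  show ?thesis
    using *[of m n] *[of n m] assms by (cases "m \<le> n") auto
qed

lemma dterm_vertical:
  "dterm a (Complex x t) n = of_real (a n * real n powr (- x)) * cis (- ln (real n) * t)"
proof (cases "n = 0")
  case False
  then have "of_nat n powr (- Complex x t) = exp (of_real (- x * ln (real n)) + \<i> * of_real (- ln (real n) * t))"
    using Ln_of_real[of "real n"] by (simp add: powr_def Complex_eq algebra_simps)
  also have "\<dots> = of_real (real n powr (- x)) * cis (- ln (real n) * t)"
    unfolding exp_add exp_of_real cis_conv_exp using False by (simp add: powr_def)
  finally show ?thesis by (simp add: dterm_def)
qed simp

text \<open>
  The diagonal of the expanded square gives \<open>T2 - T1\<close>. Off the diagonal the oscillating integrals are at
  most \<open>2 / |ln n - ln m| \<le> 2 N / |n - m|\<close>, and replacing the product of two coefficients by half the sum of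
  their squares leaves sums of inverse distances.
\<close>

lemma dirichlet_polynomial_mean_square:
  assumes T: "T1 \<le> T2"
  shows "integral {T1..T2} (\<lambda>t. (norm (\<Sum>n=1..N. dterm a (Complex x t) n))\<^sup>2)
    \<le> (T2 - T1 + 4 * real N * harm N) * (\<Sum>n=1..N. (a n)\<^sup>2 * real n powr (- 2 * x))"
proof -
  define c where "c n = a n * real n powr (- x)" for n
  define w where "w m n = ln (real n) - ln (real m)" for m n :: nat
  have c2: "(c n)\<^sup>2 = (a n)\<^sup>2 * real n powr (- 2 * x)" for n
    by (simp add: c_def power_mult_distrib power2_eq_square flip: powr_add)
  have sq: "(norm (\<Sum>n=1..N. dterm a (Complex x t) n))\<^sup>2 = (\<Sum>m=1..N. \<Sum>n=1..N. c m * c n * cos (w m n * t))" for t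
  proof -
    let ?D = "\<Sum>n=1..N. of_real (c n) * cis (- ln (real n) * t)"
    have "(norm ?D)\<^sup>2 = Re (?D * cnj ?D)" by (simp only: complex_norm_square[symmetric] Re_complex_of_real)
    also have "?D * cnj ?D = (\<Sum>m=1..N. \<Sum>n=1..N. of_real (c m * c n) * cis (w m n * t))"
    proof -
      have "cis (- ln (real m) * t) * cnj (cis (- ln (real n) * t)) = cis (w m n * t)" for m n
        by (simp add: cis_cnj cis_mult w_def algebra_simps)
      then have "of_real (c m) * cis (- ln (real m) * t) * cnj (of_real (c n) * cis (- ln (real n) * t)) =
          of_real (c m * c n) * cis (w m n * t)" for m n
        by (simp add: mult_ac)
      then show ?thesis unfolding cnj_sum sum_product by (intro sum.cong refl)
    qed
    also have "Re \<dots> = (\<Sum>m=1..N. \<Sum>n=1..N. c m * c n * cos (w m n * t))"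
      by (simp del: of_real_mult)
    finally show ?thesis by (simp only: dterm_vertical c_def)
  qed
  have int: "(\<lambda>t. cos (w m n * t)) integrable_on {T1..T2}" for m n
    by (intro integrable_continuous_interval continuous_intros)
  define K where "K m n = integral {T1..T2} (\<lambda>t. cos (w m n * t))" for m n
  have "integral {T1..T2} (\<lambda>t. (norm (\<Sum>n=1..N. dterm a (Complex x t) n))\<^sup>2) =
      (\<Sum>m=1..N. \<Sum>n=1..N. c m * c n * K m n)"
  proof -
    have i1: "(\<lambda>t. c m * c n * cos (w m n * t)) integrable_on {T1..T2}" for m n
      by (intro integrable_on_mult_right int)
    have inner: "integral {T1..T2} (\<lambda>t. \<Sum>n=1..N. c m * c n * cos (w m n * t)) = (\<Sum>n=1..N. c m * c n * K m n)" for m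
      by (subst integral_sum[OF finite_atLeastAtMost i1]) (simp add: K_def)
    show ?thesis
      unfolding sq by (subst integral_sum[OF finite_atLeastAtMost integrable_sum[OF finite_atLeastAtMost i1]])
        (simp only: inner)
  qed
  also have "\<dots> = (\<Sum>m=1..N. (c m)\<^sup>2 * (T2 - T1) + (\<Sum>n\<in>{1..N} - {m}. c m * c n * K m n))"
  proof (intro sum.cong refl)
    fix m assume m: "m \<in> {1..N}"
    have "K m m = T2 - T1" using T by (simp add: K_def w_def)
    then show "(\<Sum>n=1..N. c m * c n * K m n) = (c m)\<^sup>2 * (T2 - T1) + (\<Sum>n\<in>{1..N} - {m}. c m * c n * K m n)"
      using m by (subst sum.remove[of _ m]) (auto simp: power2_eq_square)
  qed
  also have "\<dots> \<le> (\<Sum>m=1..N. (c m)\<^sup>2 * (T2 - T1) +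
      (\<Sum>n\<in>{1..N} - {m}. ((c m)\<^sup>2 + (c n)\<^sup>2) * (real N / \<bar>real n - real m\<bar>)))"
  proof (intro sum_mono add_left_mono)
    fix m n assume m: "m \<in> {1..N}" and n: "n \<in> {1..N} - {m}"
    have w: "w m n \<noteq> 0" using m n by (auto simp: w_def)
    have "0 < \<bar>real n - real m\<bar> / real N" using m n by auto
    then have "2 / \<bar>w m n\<bar> \<le> 2 / (\<bar>real n - real m\<bar> / real N)"
      using ln_distance_ge[of m N n] m n by (intro divide_left_mono) (auto simp: w_def)
    then have K: "\<bar>K m n\<bar> \<le> 2 * (real N / \<bar>real n - real m\<bar>)"
      using integral_cos_bound[OF w T] by (simp add: K_def)
    have "c m * c n * K m n \<le> (\<bar>c m\<bar> * \<bar>c n\<bar>) * \<bar>K m n\<bar>"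
      by (metis abs_ge_self abs_mult)
    also have "\<dots> \<le> (\<bar>c m\<bar> * \<bar>c n\<bar>) * (2 * (real N / \<bar>real n - real m\<bar>))"
      using K by (intro mult_left_mono) auto
    also have "\<dots> = (2 * \<bar>c m\<bar> * \<bar>c n\<bar>) * (real N / \<bar>real n - real m\<bar>)" by simp
    also have "\<dots> \<le> (\<bar>c m\<bar>\<^sup>2 + \<bar>c n\<bar>\<^sup>2) * (real N / \<bar>real n - real m\<bar>)"
      by (intro mult_right_mono sum_squares_bound) auto
    finally show "c m * c n * K m n \<le> ((c m)\<^sup>2 + (c n)\<^sup>2) * (real N / \<bar>real n - real m\<bar>)" by simp
  qed
  also have "\<dots> = (T2 - T1) * (\<Sum>m=1..N. (c m)\<^sup>2) +
      (\<Sum>m=1..N. \<Sum>n\<in>{1..N} - {m}. (c m)\<^sup>2 * (real N / \<bar>real n - real m\<bar>)) +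
      (\<Sum>m=1..N. \<Sum>n\<in>{1..N} - {m}. (c n)\<^sup>2 * (real N / \<bar>real n - real m\<bar>))"
    unfolding sum.distrib distrib_right sum_distrib_right[symmetric] by (simp only: add.assoc mult.commute[of "T2 - T1"])
  also have "(\<Sum>m=1..N. \<Sum>n\<in>{1..N} - {m}. (c n)\<^sup>2 * (real N / \<bar>real n - real m\<bar>)) =
      (\<Sum>n=1..N. \<Sum>m\<in>{1..N} - {n}. (c n)\<^sup>2 * (real N / \<bar>real n - real m\<bar>))"
    by (subst sum.Sigma, simp, simp, subst sum.Sigma, simp, simp)
       (rule sum.reindex_bij_witness[of _ prod.swap prod.swap]; auto)
  also have "\<dots> = (\<Sum>m=1..N. \<Sum>n\<in>{1..N} - {m}. (c m)\<^sup>2 * (real N / \<bar>real n - real m\<bar>))"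
    by (simp add: abs_minus_commute)
  also have "(\<Sum>m=1..N. \<Sum>n\<in>{1..N} - {m}. (c m)\<^sup>2 * (real N / \<bar>real n - real m\<bar>)) \<le>
      (\<Sum>m=1..N. (c m)\<^sup>2 * (real N * (2 * harm N)))"
  proof (rule sum_mono)
    fix m assume m: "m \<in> {1..N}"
    have "(\<Sum>n\<in>{1..N} - {m}. (c m)\<^sup>2 * (real N / \<bar>real n - real m\<bar>)) =
        (c m)\<^sup>2 * (real N * (\<Sum>n\<in>{1..N} - {m}. 1 / \<bar>real n - real m\<bar>))"
      by (simp add: sum_distrib_left)
    also have "\<dots> \<le> (c m)\<^sup>2 * (real N * (2 * harm N))"
      using sum_inverse_distance_le[OF m] by (intro mult_left_mono) auto
    finally show "(\<Sum>n\<in>{1..N} - {m}. (c m)\<^sup>2 * (real N / \<bar>real n - real m\<bar>)) \<le>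
      (c m)\<^sup>2 * (real N * (2 * harm N))" .
  qed
  also have "\<dots> = (2 * real N * harm N) * (\<Sum>m=1..N. (c m)\<^sup>2)"
    by (simp add: sum_distrib_left mult_ac)
  finally show ?thesis by (simp add: c2 algebra_simps)
qed

definition P_coeff :: "nat \<Rightarrow> nat \<Rightarrow> real" where
  "P_coeff N n = (if n \<in> {2..N\<^sup>2} then Lambda_N N n / ln (real n) else 0)"

text \<open>
  The weight \<open>2 - ln n / ln N\<close> lies between \<open>0\<close> and \<open>1\<close> for \<open>N < n \<le> N\<^sup>2\<close>. These inequalities are the only
  property of the smoothed von Mangoldt function that produces positivity.
\<close>

lemma P_coeff_bounds:
  assumes N: "N \<ge> 1"
  shows "0 \<le> P_coeff N n" "P_coeff N n \<le> log_zeta_coeff n"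
proof -
  have "0 \<le> Lambda_N N n \<and> Lambda_N N n \<le> mangoldt n" if n: "2 \<le> n" "n \<le> N\<^sup>2"
  proof (cases "n \<le> N")
    case False
    then have "N \<ge> 2" using N n by (cases "N = 1") auto
    then have lN: "ln (real N) > 0" by simp
    have "ln (real N) \<le> ln (real n)" using False N by simp
    then have 1: "1 \<le> ln (real n) / ln (real N)" using lN by simp
    have "real n \<le> real N ^ 2" using n by (metis of_nat_le_iff of_nat_power)
    then have "ln (real n) \<le> ln (real N ^ 2)" using n N by (subst ln_le_cancel_iff) auto
    also have "\<dots> = 2 * ln (real N)" using N by (simp add: ln_realpow)
    finally have 2: "ln (real n) / ln (real N) \<le> 2" using lN by (simp add: divide_le_eq)
    have m: "mangoldt n \<ge> (0 :: real)" by (rule mangoldt_nonneg)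
    have "0 \<le> mangoldt n * (2 - ln (real n) / ln (real N))" using m 2 by (intro mult_nonneg_nonneg) auto
    moreover have "mangoldt n * (2 - ln (real n) / ln (real N)) \<le> mangoldt n"
      using m 1 by (intro mult_left_le) auto
    ultimately show ?thesis using False by (simp add: Lambda_N_def)
  qed (simp add: Lambda_N_def mangoldt_nonneg)
  then show "0 \<le> P_coeff N n" "P_coeff N n \<le> log_zeta_coeff n"
    using log_zeta_coeff_nonneg[of n]
    by (auto simp: P_coeff_def log_zeta_coeff_def intro!: divide_nonneg_nonneg divide_right_mono)
qed

lemma P_coeff_eq: "n \<le> N \<Longrightarrow> P_coeff N n = log_zeta_coeff n"
proof -
  assume n: "n \<le> N"
  consider "n = 0" | "n = 1" | "n \<ge> 2" by linarith
  then show ?thesis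
  proof cases
    case 3
    then have "N * 1 \<le> N * N" using n by (intro mult_le_mono2) auto
    then have "n \<le> N\<^sup>2" using n unfolding power2_eq_square by linarith
    with 3 n show ?thesis by (simp add: P_coeff_def Lambda_N_def log_zeta_coeff_def)
  qed (auto simp: P_coeff_def log_zeta_coeff_def)
qed

lemma P_approx_eq: "P_approx N s = exp (\<Sum>n=2..N\<^sup>2. dterm (P_coeff N) s n)"
  unfolding P_approx_def
  by (rule arg_cong[where f = exp]) (auto intro!: sum.cong simp: P_coeff_def dterm_def powr_minus field_simps)

lemma P_approx_nonzero [simp]: "P_approx N s \<noteq> 0"
  by (simp add: P_approx_def)

lemma P_approx_cnj: "P_approx N (cnj s) = cnj (P_approx N s)"
proof -
  have c: "cnj s = Complex (Re s) (- Im s)" by (simp add: complex_eq_iff)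
  have "dterm a (cnj s) n = cnj (dterm a s n)" for a n
    using dterm_vertical[of a "Re s" "Im s" n] dterm_vertical[of a "Re s" "- Im s" n]
    unfolding c by (simp add: complex_eq_iff)
  then show ?thesis by (simp add: P_approx_eq exp_cnj)
qed

lemma P_approx_holomorphic: "P_approx N holomorphic_on A"
proof -
  have "(\<lambda>s. exp (\<Sum>n=2..N\<^sup>2. of_real (P_coeff N n) * of_nat n powr (- s))) holomorphic_on A"
    by (intro holomorphic_intros) auto
  then show ?thesis by (simp add: P_approx_eq[abs_def] dterm_def)
qed

lemma P_approx_reflected_holomorphic: "(\<lambda>s. P_approx N (w - s)) holomorphic_on A"
proof -
  have "(P_approx N \<circ> (\<lambda>s. w - s)) holomorphic_on A"
    by (intro holomorphic_on_compose holomorphic_intros P_approx_holomorphic)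
  then show ?thesis by (simp add: o_def)
qed

text \<open>
  The exponent is a finite sum. The range \<open>x \<ge> -2\<close> contains the reflected abscissas \<open>2 \<sigma> - x\<close> that occur below.
\<close>

lemma P_approx_bounded:
  assumes N: "N \<ge> 1"
  shows "\<exists>B\<ge>1. \<forall>x t. -2 \<le> x \<longrightarrow> norm (P_approx N (Complex x t)) \<le> B \<and> norm (1 / P_approx N (Complex x t)) \<le> B"
proof -
  define E where "E = (\<Sum>n=2..N\<^sup>2. real n powr 2)"
  have "norm (P_approx N (Complex x t)) \<le> exp E \<and> norm (1 / P_approx N (Complex x t)) \<le> exp E"
    if x: "-2 \<le> x" for x t
  proof -
    let ?S = "\<Sum>n=2..N\<^sup>2. dterm (P_coeff N) (Complex x t) n"
    have "norm ?S \<le> E"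
      unfolding E_def
    proof (rule sum_norm_le)
      fix n assume "n \<in> {2..N\<^sup>2}"
      then have "\<bar>P_coeff N n\<bar> * real n powr (- x) \<le> 1 * real n powr 2"
        using x P_coeff_bounds[OF N, of n] log_zeta_coeff_le_1[of n] by (intro mult_mono powr_mono) auto
      then show "norm (dterm (P_coeff N) (Complex x t) n) \<le> real n powr 2" by (simp add: norm_dterm)
    qed
    then have "Re ?S \<le> E" "- Re ?S \<le> E" using abs_Re_le_cmod[of ?S] by linarith+
    then show ?thesis unfolding P_approx_eq by (simp add: norm_divide norm_exp_eq_Re flip: exp_minus inverse_eq_divide)
  qed
  moreover have "exp E \<ge> 1" by (simp add: E_def sum_nonneg)
  ultimately show ?thesis by blast
qed

definition G_coeff :: "nat \<Rightarrow> nat \<Rightarrow> real" where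
  "G_coeff N n = log_zeta_coeff n - P_coeff N n"

lemma G_coeff_bounds:
  assumes "N \<ge> 1"
  shows "0 \<le> G_coeff N n" "G_coeff N n \<le> 1" "\<bar>G_coeff N n\<bar> \<le> 1"
  using P_coeff_bounds[OF assms, of n] log_zeta_coeff_le_1[of n] by (auto simp: G_coeff_def)

lemma zeta_eq_P_times_exp:
  assumes N: "N \<ge> 1" and s: "Re s > 3/2"
  shows "zeta s = P_approx N s * exp (dirichlet (G_coeff N) s)"
proof -
  have "(\<lambda>n. dterm (P_coeff N) s n) sums (\<Sum>n=2..N\<^sup>2. dterm (P_coeff N) s n)"
    by (rule sums_finite) (auto simp: dterm_def P_coeff_def)
  moreover have "dterm (G_coeff N) s sums dirichlet (G_coeff N) s"
    using s by (intro dirichlet_sums summable_dterm_bounded G_coeff_bounds N) auto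
  ultimately have "(\<lambda>n. dterm (P_coeff N) s n + dterm (G_coeff N) s n) sums
      ((\<Sum>n=2..N\<^sup>2. dterm (P_coeff N) s n) + dirichlet (G_coeff N) s)" by (rule sums_add)
  moreover have "(\<lambda>n. dterm (P_coeff N) s n + dterm (G_coeff N) s n) = dterm log_zeta_coeff s"
    by (auto simp: dterm_def G_coeff_def algebra_simps)
  ultimately have "dirichlet log_zeta_coeff s = (\<Sum>n=2..N\<^sup>2. dterm (P_coeff N) s n) + dirichlet (G_coeff N) s"
    by (simp add: dirichlet_def sums_iff)
  then show ?thesis using zeta_eq_exp_dirichlet[OF s] by (simp add: P_approx_eq exp_add)
qed

text \<open>
  The parameter \<open>e\<close> is \<open>1\<close> on a vertical line and \<open>-1\<close> on its reflection \<open>2 \<sigma> - s\<close>.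
\<close>

lemma pos_ap_dterm: "a n \<ge> 0 \<Longrightarrow> pos_ap (\<lambda>t. dterm a (Complex x (e * t)) n)"
  using pos_ap_scale[OF pos_ap_cis[of "- ln (real n) * e"], of "a n * real n powr (- x)"]
  by (simp add: dterm_vertical mult.assoc)

lemma pos_ap_P_approx: "N \<ge> 1 \<Longrightarrow> pos_ap (\<lambda>t. P_approx N (Complex x (e * t)))"
  unfolding P_approx_eq by (intro pos_ap_exp pos_ap_sum pos_ap_dterm P_coeff_bounds)

lemma pos_ap_dirichlet:
  assumes a: "\<And>n. a n \<ge> 0" "\<And>n. \<bar>a n\<bar> \<le> 1"
  shows "pos_ap (\<lambda>t. dirichlet a (Complex 2 t))"
  unfolding dirichlet_def
proof (rule pos_ap_suminf)
  show "pos_ap (\<lambda>t. dterm a (Complex 2 t) n)" for n using pos_ap_dterm[OF a(1), where x = 2 and e = 1] by simp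
  show "norm (dterm a (Complex 2 t) n) \<le> norm (dterm a 2 n)" for n t by (simp add: norm_dterm)
  show "summable (\<lambda>n. norm (dterm a 2 n))" by (rule summable_dterm_bounded) (use a in auto)
qed

lemma pos_ap_scale_nat: "pos_ap f \<Longrightarrow> pos_ap (\<lambda>t. of_nat k * f t)"
  using pos_ap_scale[of f "real k"] by simp

lemma pos_ap_zeta_power_minus_1: "pos_ap (\<lambda>t. zeta (Complex 2 t) ^ k - 1)"
proof -
  have "pos_ap (\<lambda>t. exp (of_nat k * dirichlet log_zeta_coeff (Complex 2 t)) - 1)"
    by (intro pos_ap_exp_minus_1 pos_ap_scale_nat pos_ap_dirichlet log_zeta_coeff_nonneg log_zeta_coeff_abs)
  then show ?thesis by (simp add: zeta_eq_exp_dirichlet exp_of_nat_mult)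
qed

text \<open>
  \<open>\<zeta>\<^sup>k - P\<^sub>N\<^sup>k = P\<^sub>N\<^sup>k (exp (k G) - 1)\<close>, where \<open>G\<close> is the series of nonnegative coefficients that \<open>log P\<^sub>N\<close> misses.
\<close>

lemma pos_ap_zeta_power_minus_P:
  assumes N: "N \<ge> 1"
  shows "pos_ap (\<lambda>t. zeta (Complex 2 t) ^ k - P_approx N (Complex 2 t) ^ k)"
proof -
  have "pos_ap (\<lambda>t. P_approx N (Complex 2 (1 * t)) ^ k * (exp (of_nat k * dirichlet (G_coeff N) (Complex 2 t)) - 1))"
    by (intro pos_ap_mult pos_ap_power pos_ap_exp_minus_1 pos_ap_scale_nat pos_ap_dirichlet pos_ap_P_approx G_coeff_bounds N)
  then show ?thesis
    by (simp add: zeta_eq_P_times_exp[OF N] exp_of_nat_mult power_mult_distrib right_diff_distrib)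
qed

text \<open>
  Here \<open>\<zeta>\<^sup>2\<^sup>k / P\<^sub>N\<^sup>k = P\<^sub>N\<^sup>k exp (2 k G)\<close>: the square of \<open>\<zeta>\<^sup>k\<close> leaves a positive power of \<open>P\<^sub>N\<close> after the division.
\<close>

lemma pos_ap_zeta_power_div_P:
  assumes N: "N \<ge> 1"
  shows "pos_ap (\<lambda>t. zeta (Complex 2 t) ^ (2 * k) / P_approx N (Complex 2 t) ^ k)"
proof -
  have "pos_ap (\<lambda>t. P_approx N (Complex 2 (1 * t)) ^ k * exp (of_nat (2 * k) * dirichlet (G_coeff N) (Complex 2 t)))"
    by (intro pos_ap_mult pos_ap_power pos_ap_exp pos_ap_scale_nat pos_ap_dirichlet pos_ap_P_approx G_coeff_bounds N)
  moreover have "zeta (Complex 2 t) ^ (2 * k) / P_approx N (Complex 2 t) ^ k =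
     P_approx N (Complex 2 (1 * t)) ^ k * exp (of_nat (2 * k) * dirichlet (G_coeff N) (Complex 2 t))" for t
    unfolding exp_of_nat_mult zeta_eq_P_times_exp[OF N, of "Complex 2 t", simplified] power_mult_distrib
    by (simp add: power_mult power2_eq_square mult_2 power_add)
  ultimately show ?thesis by simp
qed

text \<open>
  The missing series \<open>G\<close> starts at \<open>n > N\<close>, so it is dominated by a tail of \<open>\<Sum> n powr (- 2)\<close>.
\<close>

lemma zeta_power_minus_P_tendsto_0:
  assumes \<eta>: "\<eta> > 0"
  shows "\<exists>N\<^sub>0\<ge>1. \<forall>N\<ge>N\<^sub>0. \<forall>t. norm (zeta (Complex 2 t) ^ k - P_approx N (Complex 2 t) ^ k) \<le> \<eta>"
proof -
  have s2: "summable (\<lambda>n. real n powr (- 2))" by (subst summable_real_powr_iff) simp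
  define Z where "Z = (\<Sum>n. real n powr (- 2))"
  define \<tau> where "\<tau> N = (\<Sum>n. real (n + N) powr (- 2))" for N
  have \<tau>: "\<tau> \<longlonglongrightarrow> 0" using suminf_exist_split2[OF s2] by (simp add: \<tau>_def[abs_def])
  have "(\<lambda>N. exp Z ^ k * (exp (real k * \<tau> N) - 1)) \<longlonglongrightarrow> exp Z ^ k * (exp (real k * 0) - 1)"
    by (intro tendsto_intros \<tau>)
  then have "\<forall>\<^sub>F N in sequentially. exp Z ^ k * (exp (real k * \<tau> N) - 1) < \<eta>"
    using \<eta> by (intro order_tendstoD(2)) auto
  then obtain N1 where N1: "\<And>N. N \<ge> N1 \<Longrightarrow> exp Z ^ k * (exp (real k * \<tau> N) - 1) < \<eta>"
    by (auto simp: eventually_sequentially)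
  have "norm (zeta (Complex 2 t) ^ k - P_approx N (Complex 2 t) ^ k) \<le> \<eta>" if NN: "N \<ge> max 1 N1" for N t
  proof -
    let ?s = "Complex 2 t"
    have N: "N \<ge> 1" using NN by simp
    have nd: "norm (dterm a ?s n) \<le> real n powr (- 2)" if "\<bar>a n\<bar> \<le> 1" for a n
      using that by (simp add: norm_dterm mult_left_le_one_le)
    have "norm (\<Sum>n=2..N\<^sup>2. dterm (P_coeff N) ?s n) \<le> (\<Sum>n=2..N\<^sup>2. real n powr (- 2))"
      using P_coeff_bounds[OF N] log_zeta_coeff_le_1
      by (intro sum_norm_le nd) (metis abs_of_nonneg order_trans)
    also have "\<dots> \<le> Z" unfolding Z_def by (intro sum_le_suminf s2) auto
    finally have "norm (P_approx N ?s) \<le> exp Z"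
      unfolding P_approx_eq by (intro order_trans[OF norm_exp]) simp
    then have P: "norm (P_approx N ?s) ^ k \<le> exp Z ^ k" by (intro power_mono) auto
    have G0: "G_coeff N n = 0" if "n < N" for n using that by (simp add: G_coeff_def P_coeff_eq)
    have sG: "summable (dterm (G_coeff N) ?s)"
      by (rule summable_norm_cancel[OF summable_dterm_bounded]) (use G_coeff_bounds[OF N] in auto)
    have "dirichlet (G_coeff N) ?s = (\<Sum>n. dterm (G_coeff N) ?s (n + N))"
      unfolding dirichlet_def using suminf_split_initial_segment[OF sG, of N] by (simp add: G0 dterm_def)
    also have "norm \<dots> \<le> \<tau> N"
      unfolding \<tau>_def
    proof (intro norm_suminf_le nd)
      show "summable (\<lambda>n. real (n + N) powr (- 2))"
        using summable_ignore_initial_segment[OF s2, of N] by simp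
    qed (use G_coeff_bounds[OF N] in auto)
    finally have G: "norm (of_nat k * dirichlet (G_coeff N) ?s) \<le> real k * \<tau> N"
      by (simp add: norm_mult mult_left_mono)
    let ?z = "of_nat k * dirichlet (G_coeff N) ?s"
    have e1: "norm (exp ?z - 1) \<le> exp (norm ?z) - 1"
    proof -
      have "norm (\<Sum>n. ?z ^ Suc n /\<^sub>R fact (Suc n)) \<le> (\<Sum>n. norm ?z ^ Suc n /\<^sub>R fact (Suc n))"
        using summable_exp_generic[of "norm ?z"]
        by (intro norm_suminf_le, simp add: norm_power norm_mult)
           (subst summable_Suc_iff[where f = "\<lambda>n. norm ?z ^ n /\<^sub>R fact n"])
      then show ?thesis
        using suminf_split_head[OF summable_exp_generic[of ?z]] suminf_split_head[OF summable_exp_generic[of "norm ?z"]]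
        by (simp add: exp_def)
    qed
    also have "\<dots> \<le> exp (real k * \<tau> N) - 1" using G by simp
    finally have "norm (exp ?z - 1) \<le> exp (real k * \<tau> N) - 1" .
    then have "norm (P_approx N ?s) ^ k * norm (exp ?z - 1) \<le> exp Z ^ k * (exp (real k * \<tau> N) - 1)"
      using P by (intro mult_mono) auto
    moreover have "zeta ?s ^ k - P_approx N ?s ^ k = P_approx N ?s ^ k * (exp ?z - 1)"
      by (simp add: zeta_eq_P_times_exp[OF N] exp_of_nat_mult power_mult_distrib right_diff_distrib)
    ultimately show ?thesis using N1[of N] NN by (simp add: norm_mult norm_power)
  qed
  then show ?thesis by (intro exI[of _ "max 1 N1"]) auto
qed

section \<open>Mean values by moving the line of integration\<close>

text \<open>
  A growth exponent less than \<open>1\<close> makes the horizontal segments negligible against \<open>T\<close>.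
\<close>

lemma contour_shift_mean:
  assumes F: "F holomorphic_on {s. Im s > 0}" and \<sigma>: "\<sigma> \<le> 2" and \<nu>: "\<nu> < 1"
    and growth: "\<And>x t. \<sigma> \<le> x \<Longrightarrow> x \<le> 2 \<Longrightarrow> 1 \<le> t \<Longrightarrow> norm (F (Complex x t)) \<le> D * t powr \<nu>"
    and \<epsilon>: "\<epsilon> > 0"
  shows "\<forall>\<^sub>F T in at_top. norm (integral {1..T} (\<lambda>t. F (Complex \<sigma> t)) - integral {1..T} (\<lambda>t. F (Complex 2 t))) \<le> \<epsilon> * T"
proof -
  have "((\<lambda>T. (2 - \<sigma>) * (D + D * T powr \<nu>) / T) \<longlongrightarrow> 0) at_top"
  proof -
    have "((\<lambda>T. (2 - \<sigma>) * (D * (1 / T) + D * T powr (\<nu> - 1))) \<longlongrightarrow> (2 - \<sigma>) * (D * 0 + D * 0)) at_top"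
      using \<nu> by (intro tendsto_intros tendsto_neg_powr filterlim_ident tendsto_divide_0[OF tendsto_const] filterlim_at_top_imp_at_infinity) auto
    moreover have "\<forall>\<^sub>F T in at_top. (2 - \<sigma>) * (D * (1 / T) + D * T powr (\<nu> - 1)) = (2 - \<sigma>) * (D + D * T powr \<nu>) / T"
      using eventually_gt_at_top[of 0] by eventually_elim (simp add: powr_diff field_simps)
    ultimately show ?thesis by (auto intro: Lim_transform_eventually)
  qed
  then have "\<forall>\<^sub>F T in at_top. (2 - \<sigma>) * (D + D * T powr \<nu>) / T < \<epsilon>"
    using \<epsilon> by (rule order_tendstoD(2))
  then show ?thesis using eventually_ge_at_top[of 1]
  proof eventually_elim
    case (elim T)
    have "norm (integral {1..T} (\<lambda>t. F (Complex \<sigma> t)) - integral {1..T} (\<lambda>t. F (Complex 2 t)))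
        \<le> (2 - \<sigma>) * (D + D * T powr \<nu>)"
    proof (rule contour_shift_bound[OF F \<sigma>])
      fix x assume x: "\<sigma> \<le> x" "x \<le> 2"
      show "norm (F (Complex x 1)) \<le> D" using growth[OF x, of 1] by simp
      show "norm (F (Complex x T)) \<le> D * T powr \<nu>" using growth[OF x elim(2)] .
    qed (use elim in auto)
    also have "\<dots> \<le> \<epsilon> * T" using elim by (simp add: divide_less_eq)
    finally show ?case .
  qed
qed

lemma mean_lower_bound_pos_ap:
  assumes F: "F holomorphic_on {s. Im s > 0}" and \<sigma>: "\<sigma> \<le> 2" and \<nu>: "\<nu> < 1"
    and growth: "\<And>x t. \<sigma> \<le> x \<Longrightarrow> x \<le> 2 \<Longrightarrow> 1 \<le> t \<Longrightarrow> norm (F (Complex x t)) \<le> D * t powr \<nu>"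
    and pos: "pos_ap (\<lambda>t. F (Complex 2 t))" and \<epsilon>: "\<epsilon> > 0"
  shows "\<forall>\<^sub>F T in at_top. Re (integral {1..T} (\<lambda>t. F (Complex \<sigma> t))) \<ge> - (\<epsilon> * T)"
proof -
  have e2: "\<epsilon> / 2 > 0" using \<epsilon> by simp
  have "\<forall>\<^sub>F T in at_top. norm (integral {1..T} (\<lambda>t. F (Complex \<sigma> t)) - integral {1..T} (\<lambda>t. F (Complex 2 t))) \<le> \<epsilon> / 2 * T"
    by (rule contour_shift_mean[OF F \<sigma> \<nu> _ e2]) (rule growth)
  from this pos_ap_mean_nonneg[OF pos e2] show ?thesis
  proof eventually_elim
    case (elim T)
    have "Re (integral {1..T} (\<lambda>t. F (Complex 2 t))) - Re (integral {1..T} (\<lambda>t. F (Complex \<sigma> t))) \<le> \<epsilon> / 2 * T"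
      using elim(1) abs_Re_le_cmod[of "integral {1..T} (\<lambda>t. F (Complex \<sigma> t)) - integral {1..T} (\<lambda>t. F (Complex 2 t))"]
      by simp
    with elim(2) show ?case by (simp add: field_simps)
  qed
qed

lemma mean_bounded_by_right_edge:
  assumes F: "F holomorphic_on {s. Im s > 0}" and \<sigma>: "\<sigma> \<le> 2" and \<nu>: "\<nu> < 1"
    and growth: "\<And>x t. \<sigma> \<le> x \<Longrightarrow> x \<le> 2 \<Longrightarrow> 1 \<le> t \<Longrightarrow> norm (F (Complex x t)) \<le> D * t powr \<nu>"
    and bd: "\<And>t. norm (F (Complex 2 t)) \<le> B"
  shows "\<forall>\<^sub>F T in at_top. norm (integral {1..T} (\<lambda>t. F (Complex \<sigma> t))) \<le> (B + 1) * T"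
proof -
  have "\<forall>\<^sub>F T in at_top. norm (integral {1..T} (\<lambda>t. F (Complex \<sigma> t)) - integral {1..T} (\<lambda>t. F (Complex 2 t))) \<le> 1 * T"
    by (rule contour_shift_mean[OF F \<sigma> \<nu> _ zero_less_one]) (rule growth)
  then show ?thesis using eventually_ge_at_top[of 1]
proof eventually_elim
  case (elim T)
  have B: "B \<ge> 0" using bd[of 0] norm_ge_zero order_trans by blast
  have "norm (integral {1..T} (\<lambda>t. F (Complex 2 t))) \<le> integral {1..T} (\<lambda>t. B)"
    using bd by (intro integral_norm_bound_integral integrable_continuous_interval continuous_on_vertical[OF F]) auto
  also have "\<dots> \<le> B * T" using elim B by (simp add: algebra_simps)
  finally have "norm (integral {1..T} (\<lambda>t. F (Complex 2 t))) \<le> B * T" .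
  then show ?case
    using elim(1) norm_triangle_sub[of "integral {1..T} (\<lambda>t. F (Complex \<sigma> t))" "integral {1..T} (\<lambda>t. F (Complex 2 t))"]
    by (simp add: algebra_simps)
qed
qed

lemma square_integral_mono:
  assumes F: "F holomorphic_on {s. Im s > 0}" and "0 < c" "c \<le> a" "b \<le> d"
  shows "square_integral F x a b \<le> square_integral F x c d"
proof (rule integral_subset_le)
  show "{a..b} \<subseteq> {c..d}" using assms by auto
  show "(\<lambda>t. (norm (F (Complex x t)))\<^sup>2) integrable_on {a..b}" "(\<lambda>t. (norm (F (Complex x t)))\<^sup>2) integrable_on {c..d}"
    using assms by (auto intro!: integrable_continuous_interval continuous_intros continuous_on_vertical[OF F])
qed auto

lemma square_integral_le:
  assumes F: "F holomorphic_on {s. Im s > 0}" and "0 < a" "a \<le> b"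
    and M: "\<And>t. a \<le> t \<Longrightarrow> t \<le> b \<Longrightarrow> norm (F (Complex x t)) \<le> M"
  shows "square_integral F x a b \<le> (b - a) * M\<^sup>2"
proof -
  have "square_integral F x a b \<le> integral {a..b} (\<lambda>t. M\<^sup>2)"
    using assms by (intro integral_le power_mono M integrable_continuous_interval continuous_intros continuous_on_vertical[OF F]) auto
  then show ?thesis using assms(3) by simp
qed

lemma square_integral_combine:
  assumes F: "F holomorphic_on {s. Im s > 0}" and "0 < a" "a \<le> b" "b \<le> c"
  shows "square_integral F x a b + square_integral F x b c =
    square_integral F x a c"
  using assms
  by (intro Henstock_Kurzweil_Integration.integral_combine integrable_continuous_interval continuous_intros continuous_on_vertical[OF F]) auto

text \<open>
  A crude bound. It is applied with \<open>2 ln T\<close> in place of \<open>T\<close>, to discard the beginning of the line.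
\<close>

lemma square_integral_growth:
  assumes F: "F holomorphic_on {s. Im s > 0}" and \<nu>: "0 \<le> \<nu>" "\<nu> < 1/2"
    and growth: "\<And>t. 1 \<le> t \<Longrightarrow> norm (F (Complex x t)) \<le> D * t powr \<nu>" and T: "1 \<le> T"
  shows "square_integral F x 1 T \<le> D\<^sup>2 * T\<^sup>2"
proof -
  have D: "D \<ge> 0" using order_trans[OF norm_ge_zero growth[of 1]] by simp
  have "square_integral F x 1 T \<le> (T - 1) * (D * T powr \<nu>)\<^sup>2"
  proof (rule square_integral_le[OF F])
    fix t assume t: "1 \<le> t" "t \<le> T"
    have "norm (F (Complex x t)) \<le> D * t powr \<nu>" using t by (intro growth)
    also have "\<dots> \<le> D * T powr \<nu>" using t D \<nu> by (intro mult_left_mono powr_mono2) auto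
    finally show "norm (F (Complex x t)) \<le> D * T powr \<nu>" .
  qed (use T in auto)
  also have "(D * T powr \<nu>)\<^sup>2 = D\<^sup>2 * T powr (2 * \<nu>)"
    by (simp add: power_mult_distrib power2_eq_square flip: powr_add)
  also have "(T - 1) * (D\<^sup>2 * T powr (2 * \<nu>)) \<le> T * (D\<^sup>2 * T powr 1)"
    using T \<nu> by (intro mult_mono powr_mono) auto
  also have "\<dots> = D\<^sup>2 * T\<^sup>2" using T by (simp add: power2_eq_square)
  finally show ?thesis .
qed

text \<open>
  Asymptotic form of the three lines theorem. The height \<open>ln T\<close> of the rectangle is large enough for the
  Gaussian to beat every power of \<open>T\<close> on the horizontal edges, and small enough for the initial segment
  of length \<open>2 ln T\<close>, where there is no room for vertical shifts, to contribute \<open>o(T)\<close>.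
\<close>

lemma mean_square_interpolation:
  assumes F: "F holomorphic_on {s. Im s > 0}" and \<alpha>: "\<alpha> \<le> \<sigma>" "\<sigma> \<le> 2" "0 \<le> \<alpha>" and \<nu>: "0 \<le> \<nu>" "\<nu> < 1/2"
    and growth: "\<And>x t. \<alpha> \<le> x \<Longrightarrow> x \<le> 2 \<Longrightarrow> 1 \<le> t \<Longrightarrow> norm (F (Complex x t)) \<le> D * t powr \<nu>"
    and left: "\<forall>\<^sub>F T in at_top. square_integral F \<alpha> 1 T \<le> A * T"
    and right: "\<And>t. norm (F (Complex 2 t)) \<le> \<eta>"
    and A: "A \<ge> 0" and Y: "Y \<ge> 1" and \<delta>: "\<delta> > 0"
  shows "\<forall>\<^sub>F T in at_top. square_integral F \<sigma> 1 T \<le>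
     (exp 8 * (2 * A * (Y powr (\<alpha> - \<sigma>))\<^sup>2 + \<eta>\<^sup>2 * (Y powr (2 - \<sigma>))\<^sup>2) + \<delta>) * T"
proof -
  define K where "K = exp 8 * (2 * A * (Y powr (\<alpha> - \<sigma>))\<^sup>2 + \<eta>\<^sup>2 * (Y powr (2 - \<sigma>))\<^sup>2)"
  have \<eta>: "\<eta> \<ge> 0" using right[of 0] norm_ge_zero order_trans by blast
  have D: "D \<ge> 0" using order_trans[OF norm_ge_zero growth[of 2 1]] \<alpha> by simp
  have K: "K \<ge> 0" using A by (simp add: K_def)
  have e8: "exp 8 = (exp (4::real))\<^sup>2" by (simp add: power2_eq_square flip: exp_add)
  define y where "y = Y powr (2 - \<sigma>)"
  have y: "y > 0" using Y by (simp add: y_def)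
  have small: "\<forall>\<^sub>F T in at_top. exp 4 * y * (exp (- (ln T)\<^sup>2) * (D * (2 * T) powr \<nu>)) \<le> sqrt (\<delta> / 2)"
  proof -
    have "((\<lambda>T::real. exp (- (ln T)\<^sup>2) * (2 * T)) \<longlongrightarrow> 0) at_top" by real_asymp
    then have "((\<lambda>T::real. exp 4 * y * D * (exp (- (ln T)\<^sup>2) * (2 * T))) \<longlongrightarrow> exp 4 * y * D * 0) at_top"
      by (intro tendsto_intros)
    then have "\<forall>\<^sub>F T in at_top. exp 4 * y * D * (exp (- (ln T)\<^sup>2) * (2 * T)) < sqrt (\<delta> / 2)"
      using \<delta> by (intro order_tendstoD(2)) auto
    then show ?thesis using eventually_ge_at_top[of 1]
    proof eventually_elim
      case (elim T)
      have "(2 * T) powr \<nu> \<le> (2 * T) powr 1" using \<nu> elim by (intro powr_mono) auto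
      then have "exp 4 * y * D * exp (- (ln T)\<^sup>2) * (2 * T) powr \<nu> \<le> exp 4 * y * D * exp (- (ln T)\<^sup>2) * (2 * T)"
        using y D elim by (intro mult_left_mono) auto
      with elim show ?case by (simp add: mult_ac)
    qed
  qed
  have start: "\<forall>\<^sub>F T in at_top. D\<^sup>2 * (2 * ln T)\<^sup>2 \<le> \<delta> / 2 * T"
  proof -
    have "((\<lambda>T::real. (2 * ln T)\<^sup>2 / T) \<longlongrightarrow> 0) at_top" by real_asymp
    then have "((\<lambda>T::real. D\<^sup>2 * ((2 * ln T)\<^sup>2 / T)) \<longlongrightarrow> D\<^sup>2 * 0) at_top" by (intro tendsto_intros)
    then have "\<forall>\<^sub>F T in at_top. D\<^sup>2 * ((2 * ln T)\<^sup>2 / T) < \<delta> / 2"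
      using \<delta> by (intro order_tendstoD(2)) auto
    then show ?thesis using eventually_gt_at_top[of 0]
      by eventually_elim (simp add: field_simps)
  qed
  obtain T0 where T0: "\<And>T. T \<ge> T0 \<Longrightarrow> square_integral F \<alpha> 1 T \<le> A * T"
    using left by (auto simp: eventually_at_top_linorder)
  have "\<forall>\<^sub>F T in at_top. ln T \<ge> (1::real)" "\<forall>\<^sub>F T in at_top. 3 * ln T \<le> (T::real)" by real_asymp+
  then show ?thesis
    using small start eventually_ge_at_top[of "max 1 T0"]
  proof eventually_elim
    case (elim T)
    define H where "H = ln T"
    have H: "H \<ge> 1" "3 * H \<le> T" using elim by (auto simp: H_def)
    have T: "T \<ge> 1" "T \<ge> T0" using elim by auto
    define B where "B = sqrt ((K + \<delta> / 2) * T)"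
    have BT: "sqrt X * sqrt T \<le> B" if "X \<le> K + \<delta> / 2" for X
      using that T by (simp add: B_def real_sqrt_mult mult_right_mono)
    have "square_integral F \<sigma> (2*H) T \<le> B\<^sup>2"
    proof (rule mean_square_three_lines[OF F \<alpha>(1,2), where H = H and Y = Y and A = "sqrt (2 * A * T)" and E = "\<eta> * sqrt T"
          and G = "D * (2 * T) powr \<nu> * sqrt T"])
      fix y assume y: "- H \<le> y" "y \<le> H"
      have "square_integral F \<alpha> (2*H+y) (T+y) \<le> square_integral F \<alpha> 1 (2*T)"
        using y H by (intro square_integral_mono[OF F]) auto
      also have "\<dots> \<le> A * (2 * T)" using T by (intro T0) auto
      finally show "square_integral F \<alpha> (2*H+y) (T+y) \<le> (sqrt (2 * A * T))\<^sup>2"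
        using A T by simp
      have "square_integral F 2 (2*H+y) (T+y) \<le> (T + y - (2*H+y)) * \<eta>\<^sup>2"
        using y H right by (intro square_integral_le[OF F]) auto
      also have "\<dots> \<le> T * \<eta>\<^sup>2" using H by (intro mult_right_mono) auto
      finally show "square_integral F 2 (2*H+y) (T+y) \<le> (\<eta> * sqrt T)\<^sup>2"
        using T by (simp add: power_mult_distrib mult.commute)
    next
      fix x y assume x: "\<alpha> \<le> x" "x \<le> 2" and y: "\<bar>y\<bar> = H"
      have "square_integral F x (2*H+y) (T+y) \<le> (T + y - (2*H+y)) * (D * (2 * T) powr \<nu>)\<^sup>2"
      proof (rule square_integral_le[OF F])
        fix t assume t: "2*H+y \<le> t" "t \<le> T+y"
        have "norm (F (Complex x t)) \<le> D * t powr \<nu>" using t y H by (intro growth x) auto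
        also have "\<dots> \<le> D * (2 * T) powr \<nu>" using t y H D \<nu> by (intro mult_left_mono powr_mono2) auto
        finally show "norm (F (Complex x t)) \<le> D * (2 * T) powr \<nu>" .
      qed (use y H in auto)
      also have "\<dots> \<le> T * (D * (2 * T) powr \<nu>)\<^sup>2" using H by (intro mult_right_mono) auto
      finally show "square_integral F x (2*H+y) (T+y) \<le> (D * (2 * T) powr \<nu> * sqrt T)\<^sup>2"
        using T by (simp add: power_mult_distrib mult_ac)
    next
      have "exp 4 * Y powr (\<alpha> - \<sigma>) * sqrt (2 * A * T) = sqrt (exp 8 * (2 * A * (Y powr (\<alpha> - \<sigma>))\<^sup>2)) * sqrt T"
        unfolding e8 using A by (simp add: real_sqrt_mult)
      also have "\<dots> \<le> B" using \<delta> by (intro BT) (simp add: K_def algebra_simps)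
      finally show "exp 4 * Y powr (\<alpha> - \<sigma>) * sqrt (2 * A * T) \<le> B" .
      have "exp 4 * Y powr (2 - \<sigma>) * (\<eta> * sqrt T) = sqrt (exp 8 * (\<eta>\<^sup>2 * (Y powr (2 - \<sigma>))\<^sup>2)) * sqrt T"
        unfolding e8 using \<eta> by (simp add: real_sqrt_mult)
      also have "\<dots> \<le> B" using \<delta> A by (intro BT) (simp add: K_def algebra_simps)
      finally show "exp 4 * Y powr (2 - \<sigma>) * (\<eta> * sqrt T) \<le> B" .
      have "exp 4 * Y powr (2 - \<sigma>) * (exp (- H\<^sup>2) * (D * (2 * T) powr \<nu> * sqrt T)) =
         (exp 4 * y * (exp (- (ln T)\<^sup>2) * (D * (2 * T) powr \<nu>))) * sqrt T"
        by (simp add: H_def y_def)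
      also have "\<dots> \<le> sqrt (\<delta> / 2) * sqrt T" using elim T by (intro mult_right_mono) auto
      also have "\<dots> \<le> B" using K by (intro BT) auto
      finally show "exp 4 * Y powr (2 - \<sigma>) * (exp (- H\<^sup>2) * (D * (2 * T) powr \<nu> * sqrt T)) \<le> B" .
    qed (use H Y A \<eta> D T \<alpha> in auto)
    also have "B\<^sup>2 = (K + \<delta> / 2) * T" using K \<delta> T by (simp add: B_def)
    finally have 1: "square_integral F \<sigma> (2*H) T \<le> (K + \<delta> / 2) * T" .
    have "square_integral F \<sigma> 1 (2*H) \<le> D\<^sup>2 * (2 * H)\<^sup>2"
      using \<alpha> H by (intro square_integral_growth[OF F \<nu>] growth) auto
    also have "\<dots> \<le> \<delta> / 2 * T" using elim by (simp add: H_def)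
    finally have 2: "square_integral F \<sigma> 1 (2*H) \<le> \<delta> / 2 * T" .
    note square_integral_combine[OF F, of 1 "2 * H" T \<sigma>]
    with 1 2 H show "square_integral F \<sigma> 1 T \<le>
     (exp 8 * (2 * A * (Y powr (\<alpha> - \<sigma>))\<^sup>2 + \<eta>\<^sup>2 * (Y powr (2 - \<sigma>))\<^sup>2) + \<delta>) * T"
      unfolding K_def by (simp add: algebra_simps)
  qed
qed

text \<open>
  What the hypothesis on \<open>\<mu> (1/2)\<close> provides. The bound \<open>1/2\<close> on the exponent is what makes both \<open>\<zeta>\<^sup>k\<close> and its
  square \<open>o(t)\<close>.
\<close>

locale zeta_power_growth =
  fixes k :: nat and \<nu> C :: real
  assumes \<nu>: "0 < \<nu>" "\<nu> < 1/2" and C: "C > 0"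
    and growth: "\<And>x t. 1/2 \<le> x \<Longrightarrow> x \<le> 2 \<Longrightarrow> 1 \<le> t \<Longrightarrow> norm (zeta (Complex x t) ^ k) \<le> C * t powr \<nu>"

text \<open>
  The exponent is raised to at least \<open>1 / (4 k)\<close>: the maximum modulus argument needs a nonnegative exponent,
  and a positive one is convenient later.
\<close>

lemma zeta_power_growth_from_mu:
  assumes k: "k \<ge> 1" and mu: "zeta_mu (1/2) < ereal (1 / (2 * real k))"
  shows "\<exists>\<nu> C. zeta_power_growth k \<nu> C"
proof -
  obtain m where m: "m < 1 / (2 * real k)" and O: "(\<lambda>t. norm (zeta (Complex (1/2) t))) \<in> O[at_top](\<lambda>t. t powr m)"
    using mu unfolding zeta_mu_def Inf_less_iff by auto
  define m' where "m' = max m (1 / (4 * real k))"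
  have m': "m' > 0" "m' < 1 / (2 * real k)" "m \<le> m'" using k m by (auto simp: m'_def less_max_iff_disj field_simps)
  obtain C0 where "C0 > 0" "\<forall>\<^sub>F t in at_top. norm (norm (zeta (Complex (1/2) t))) \<le> C0 * norm (t powr m)"
    using O by (auto elim!: landau_o.bigE)
  then obtain t0 where C0: "C0 > 0" "\<And>t. t \<ge> t0 \<Longrightarrow> norm (zeta (Complex (1/2) t)) \<le> C0 * t powr m"
    by (auto simp: eventually_at_top_linorder)
  have "norm (zeta (Complex (1/2) t)) \<le> C0 * t powr m'" if "t \<ge> max 1 t0" for t
  proof -
    have "norm (zeta (Complex (1/2) t)) \<le> C0 * t powr m" using that by (intro C0) auto
    also have "\<dots> \<le> C0 * t powr m'" using that m' C0(1) by (intro mult_left_mono powr_mono) auto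
    finally show ?thesis .
  qed
  then obtain C where C: "C > 0" "\<And>x t. 1/2 \<le> x \<Longrightarrow> x \<le> 2 \<Longrightarrow> 1 \<le> t \<Longrightarrow> norm (zeta (Complex x t)) \<le> C * t powr m'"
    using zeta_growth_strip[of m' "max 1 t0" C0] m' by force
  have "zeta_power_growth k (m' * real k) (C ^ k)"
  proof
    show "0 < m' * real k" using m' k by simp
    show "m' * real k < 1 / 2" using m' k by (simp add: field_simps)
    show "C ^ k > 0" using C by simp
    fix x t :: real assume xt: "1/2 \<le> x" "x \<le> 2" "1 \<le> t"
    have "norm (zeta (Complex x t) ^ k) \<le> (C * t powr m') ^ k"
      unfolding norm_power using C xt by (intro power_mono) auto
    also have "\<dots> = C ^ k * t powr (m' * real k)"
      using xt by (simp add: power_mult_distrib powr_powr flip: powr_realpow)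
    finally show "norm (zeta (Complex x t) ^ k) \<le> C ^ k * t powr (m' * real k)" .
  qed
  then show ?thesis by blast
qed

section \<open>The weighted sine moment\<close>

text \<open>
  With \<open>z / p = r cis \<theta>\<close> the twisted power \<open>z\<^sup>2\<^sup>k cnj (p\<^sup>k) / p\<^sup>k\<close> is \<open>|z|\<^sup>2\<^sup>k cis (2 k \<theta>)\<close>, which gives the equation.
  For the inequality, \<open>|z|\<^sup>k |sin (k \<theta>)|\<close> is the distance of \<open>z\<^sup>k\<close> from the real line through \<open>p\<^sup>k\<close>.
\<close>

lemma sin_square_weight:
  fixes z p :: complex
  assumes p: "p \<noteq> 0"
  shows "norm z ^ (2 * k) * (sin (real k * Arg (z / p)))\<^sup>2 =
      (norm z ^ (2 * k) - Re (z ^ (2 * k) / p ^ k * cnj (p ^ k))) / 2"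
    and "norm z ^ (2 * k) * (sin (real k * Arg (z / p)))\<^sup>2 \<le> (norm (z ^ k - p ^ k))\<^sup>2"
proof -
  define r \<theta> where "r = norm (z / p)" and "\<theta> = Arg (z / p)"
  have w: "z / p = of_real r * cis \<theta>"
    using rcis_cmod_Arg[of "z / p"] by (simp add: r_def \<theta>_def rcis_def)
  have z: "z = p * (of_real r * cis \<theta>)" using w p by (simp add: field_simps)
  have nz: "norm z = norm p * r" using p by (simp add: r_def norm_divide)
  have "z ^ (2 * k) / p ^ k * cnj (p ^ k) = (p ^ k * cnj (p ^ k)) * (of_real r * cis \<theta>) ^ (2 * k)"
    unfolding z power_mult_distrib using p by (simp add: mult_2 power_add)
  also have "p ^ k * cnj (p ^ k) = of_real (norm p ^ (2 * k))"
    unfolding complex_norm_square[symmetric] by (simp add: norm_power mult.commute[of 2] power_mult)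
  also have "(of_real r * cis \<theta>) ^ (2 * k) = of_real (r ^ (2 * k)) * cis (2 * (real k * \<theta>))"
    by (simp add: power_mult_distrib Complex.DeMoivre mult_ac)
  also have "of_real (norm p ^ (2 * k)) * (of_real (r ^ (2 * k)) * cis (2 * (real k * \<theta>))) =
      of_real ((norm p * r) ^ (2 * k)) * cis (2 * (real k * \<theta>))"
    by (simp add: power_mult_distrib)
  finally have "Re (z ^ (2 * k) / p ^ k * cnj (p ^ k)) = norm z ^ (2 * k) * cos (2 * (real k * \<theta>))"
    by (simp add: nz del: of_real_power of_real_mult)
  then have R: "Re (z ^ (2 * k) / p ^ k * cnj (p ^ k)) = norm z ^ (2 * k) * (1 - 2 * (sin (real k * \<theta>))\<^sup>2)"
    by (simp only: cos_double_sin)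
  show "norm z ^ (2 * k) * (sin (real k * Arg (z / p)))\<^sup>2 =
      (norm z ^ (2 * k) - Re (z ^ (2 * k) / p ^ k * cnj (p ^ k))) / 2"
    unfolding \<theta>_def[symmetric] R by (simp add: algebra_simps)
  have "Im ((z / p) ^ k - 1) = r ^ k * sin (real k * \<theta>)"
    unfolding w by (simp add: power_mult_distrib Complex.DeMoivre flip: of_real_power)
  then have "\<bar>r ^ k * sin (real k * \<theta>)\<bar> \<le> norm ((z / p) ^ k - 1)" using abs_Im_le_cmod by metis
  then have "norm p ^ k * \<bar>r ^ k * sin (real k * \<theta>)\<bar> \<le> norm p ^ k * norm ((z / p) ^ k - 1)"
    by (intro mult_left_mono) auto
  also have "\<dots> = norm (p ^ k * ((z / p) ^ k - 1))" by (simp add: norm_mult norm_power)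
  also have "p ^ k * ((z / p) ^ k - 1) = z ^ k - p ^ k" using p by (simp add: power_divide right_diff_distrib)
  finally have "(norm p ^ k * \<bar>r ^ k * sin (real k * \<theta>)\<bar>)\<^sup>2 \<le> (norm (z ^ k - p ^ k))\<^sup>2"
    by (intro power_mono) auto
  also have "(norm p ^ k * \<bar>r ^ k * sin (real k * \<theta>)\<bar>)\<^sup>2 = norm z ^ (2 * k) * (sin (real k * \<theta>))\<^sup>2"
    by (simp add: nz power_mult_distrib mult_ac flip: power_mult)
  finally show "norm z ^ (2 * k) * (sin (real k * Arg (z / p)))\<^sup>2 \<le> (norm (z ^ k - p ^ k))\<^sup>2"
    by (simp add: \<theta>_def)
qed

lemma continuous_on_zeta_vertical: "\<sigma> \<noteq> 1 \<Longrightarrow> continuous_on A (\<lambda>t. zeta (Complex \<sigma> t))"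
proof -
  assume \<sigma>: "\<sigma> \<noteq> 1"
  have "zeta holomorphic_on - {1}" using is_zeta_zeta by (simp add: is_zeta_def)
  then have "continuous_on A (zeta \<circ> (\<lambda>t. Complex \<sigma> t))"
    using \<sigma> by (intro continuous_on_compose continuous_intros
        continuous_on_subset[OF holomorphic_on_imp_continuous_on]) (auto simp: complex_eq_iff)
  then show ?thesis by (simp add: o_def)
qed

lemma continuous_on_P_vertical: "continuous_on A (\<lambda>t. P_approx N (Complex \<sigma> t))"
proof -
  have "continuous_on A (P_approx N \<circ> (\<lambda>t. Complex \<sigma> t))"
    by (intro continuous_on_compose continuous_intros holomorphic_on_imp_continuous_on P_approx_holomorphic)
  then show ?thesis by (simp add: o_def)
qed

lemma zeta_moment_split:
  assumes "\<sigma> \<noteq> 1" "T \<ge> 1"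
  shows "zeta_moment k \<sigma> T = zeta_moment k \<sigma> 1 + square_integral (\<lambda>s. zeta s ^ k) \<sigma> 1 T"
proof -
  have "integral {0..1} (\<lambda>t. norm (zeta (Complex \<sigma> t)) ^ (2 * k)) + integral {1..T} (\<lambda>t. norm (zeta (Complex \<sigma> t)) ^ (2 * k)) =
      integral {0..T} (\<lambda>t. norm (zeta (Complex \<sigma> t)) ^ (2 * k))"
    using assms
    by (intro Henstock_Kurzweil_Integration.integral_combine integrable_continuous_interval continuous_intros continuous_on_zeta_vertical) auto
  moreover have "norm z ^ (2 * k) = (norm (z ^ k))\<^sup>2" for z :: complex
    by (simp add: norm_power mult.commute flip: power_mult)
  ultimately show ?thesis by (simp add: zeta_moment_def)
qed

lemma zeta_moment_nonneg: "zeta_moment k \<sigma> T \<ge> 0"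
  unfolding zeta_moment_def
  by (cases "(\<lambda>t. norm (zeta (Complex \<sigma> t)) ^ (2 * k)) integrable_on {0..T}")
     (auto intro: integral_nonneg simp: not_integrable_integral)

definition twisted_power :: "nat \<Rightarrow> nat \<Rightarrow> real \<Rightarrow> real \<Rightarrow> complex" where
  "twisted_power k N \<sigma> t = zeta (Complex \<sigma> t) ^ (2 * k) / P_approx N (Complex \<sigma> t) ^ k * cnj (P_approx N (Complex \<sigma> t) ^ k)"

lemma continuous_on_twisted_power: "\<sigma> \<noteq> 1 \<Longrightarrow> continuous_on A (twisted_power k N \<sigma>)"
  unfolding twisted_power_def[abs_def]
  by (intro continuous_intros continuous_on_zeta_vertical continuous_on_P_vertical) auto

lemma zeta_sin_moment_eq:
  assumes \<sigma>: "\<sigma> \<noteq> 1" and T: "T \<ge> 0"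
  shows "zeta_sin_moment k N \<sigma> T = (zeta_moment k \<sigma> T - Re (integral {0..T} (twisted_power k N \<sigma>))) / 2"
proof -
  have i: "twisted_power k N \<sigma> integrable_on {0..T}"
    by (intro integrable_continuous_interval continuous_on_twisted_power \<sigma>)
  have ii: "(\<lambda>t. norm (zeta (Complex \<sigma> t)) ^ (2 * k)) integrable_on {0..T}"
    by (intro integrable_continuous_interval continuous_intros continuous_on_zeta_vertical \<sigma>)
  have iii: "(\<lambda>t. Re (twisted_power k N \<sigma> t)) integrable_on {0..T}"
    by (intro integrable_continuous_interval continuous_intros continuous_on_twisted_power \<sigma>)
  have "zeta_sin_moment k N \<sigma> T = integral {0..T} (\<lambda>t. (norm (zeta (Complex \<sigma> t)) ^ (2 * k) - Re (twisted_power k N \<sigma> t)) / 2)"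
    unfolding zeta_sin_moment_def theta_Z_def Z_quot_def twisted_power_def
    by (subst sin_square_weight(1)) auto
  also have "\<dots> = (integral {0..T} (\<lambda>t. norm (zeta (Complex \<sigma> t)) ^ (2 * k)) - integral {0..T} (\<lambda>t. Re (twisted_power k N \<sigma> t))) / 2"
    using integral_diff[OF ii iii] by simp
  also have "integral {0..T} (\<lambda>t. Re (twisted_power k N \<sigma> t)) = Re (integral {0..T} (twisted_power k N \<sigma>))"
    using integral_linear[OF i bounded_linear_Re] by (simp add: o_def)
  finally show ?thesis by (simp add: zeta_moment_def)
qed

lemma zeta_sin_moment_le:
  assumes \<sigma>: "\<sigma> \<noteq> 1" and T: "T \<ge> 0"
  shows "zeta_sin_moment k N \<sigma> T \<le> square_integral (\<lambda>s. zeta s ^ k - P_approx N s ^ k) \<sigma> 0 T"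
  unfolding zeta_sin_moment_def theta_Z_def Z_quot_def
proof (rule integral_le)
  have "continuous_on {0..T} (\<lambda>t. (norm (zeta (Complex \<sigma> t)) ^ (2 * k) - Re (twisted_power k N \<sigma> t)) / 2)"
    by (intro continuous_intros continuous_on_twisted_power continuous_on_zeta_vertical \<sigma>) auto
  then have "(\<lambda>t. (norm (zeta (Complex \<sigma> t)) ^ (2 * k) - Re (twisted_power k N \<sigma> t)) / 2) integrable_on {0..T}"
    by (rule integrable_continuous_interval)
  then show "(\<lambda>t. norm (zeta (Complex \<sigma> t)) ^ (2 * k) * (sin (real k * Arg (zeta (Complex \<sigma> t) / P_approx N (Complex \<sigma> t))))\<^sup>2) integrable_on {0..T}"
    unfolding twisted_power_def by (subst sin_square_weight(1)) auto
  show "(\<lambda>t. (norm (zeta (Complex \<sigma> t) ^ k - P_approx N (Complex \<sigma> t) ^ k))\<^sup>2) integrable_on {0..T}"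
    by (intro integrable_continuous_interval continuous_intros continuous_on_P_vertical continuous_on_zeta_vertical \<sigma>)
qed (use sin_square_weight(2) in auto)

context zeta_power_growth
begin

lemma zeta_power_holomorphic: "(\<lambda>s. zeta s ^ k) holomorphic_on {s. Im s > 0}"
  by (intro holomorphic_intros zeta_holomorphic)

lemma const_le_growth: "B \<ge> 0 \<Longrightarrow> 1 \<le> t \<Longrightarrow> B \<le> B * t powr \<nu>"
  using \<nu> ge_one_powr_ge_zero[of t \<nu>] mult_left_mono[of 1 "t powr \<nu>" B] by simp

text \<open>
  The mean of \<open>\<zeta>\<^sup>k\<close> itself has real part asymptotically at least \<open>1\<close>, because its Dirichlet series starts
  with \<open>1\<close>; Cauchy-Schwarz transfers this to the mean square.
\<close>

lemma moment_lower_bound: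
  assumes \<sigma>: "1/2 \<le> \<sigma>" "\<sigma> \<le> 2"
  shows "\<forall>\<^sub>F T in at_top. T / 4 \<le> square_integral (\<lambda>s. zeta s ^ k) \<sigma> 1 T"
proof -
  let ?F = "\<lambda>s. zeta s ^ k - 1"
  have hol: "?F holomorphic_on {s. Im s > 0}" by (intro holomorphic_intros zeta_power_holomorphic)
  have "\<forall>\<^sub>F T in at_top. Re (integral {1..T} (\<lambda>t. ?F (Complex \<sigma> t))) \<ge> - (1/4 * T)"
  proof (rule mean_lower_bound_pos_ap[OF hol \<sigma>(2), of \<nu> "C + 1"])
    fix x t assume x: "\<sigma> \<le> x" "x \<le> 2" and t: "1 \<le> (t::real)"
    have "norm (?F (Complex x t)) \<le> norm (zeta (Complex x t) ^ k) + norm (1::complex)" by (rule norm_triangle_ineq4)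
    also have "\<dots> \<le> C * t powr \<nu> + 1 * t powr \<nu>"
      using growth[of x t] x \<sigma> t const_le_growth[of 1 t] by (intro add_mono) auto
    finally show "norm (?F (Complex x t)) \<le> (C + 1) * t powr \<nu>" by (simp add: algebra_simps)
  qed (use \<nu> pos_ap_zeta_power_minus_1 in auto)
  then show ?thesis using eventually_ge_at_top[of 4]
  proof eventually_elim
    case (elim T)
    let ?M = "square_integral (\<lambda>s. zeta s ^ k) \<sigma> 1 T"
    have c: "continuous_on {1..T} (\<lambda>t. zeta (Complex \<sigma> t) ^ k)"
      using continuous_on_vertical[OF zeta_power_holomorphic] by simp
    have M0: "?M \<ge> 0" by (intro integral_nonneg integrable_continuous_interval continuous_intros c) auto
    have "integral {1..T} (\<lambda>t. ?F (Complex \<sigma> t)) = integral {1..T} (\<lambda>t. zeta (Complex \<sigma> t) ^ k) - of_real (T - 1)"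
      using elim by (subst integral_diff) (auto intro!: integrable_continuous_interval c simp: scaleR_conv_of_real)
    then have "Re (integral {1..T} (\<lambda>t. zeta (Complex \<sigma> t) ^ k)) \<ge> T / 2" using elim by simp
    then have "T / 2 \<le> norm (integral {1..T} (\<lambda>t. zeta (Complex \<sigma> t) ^ k))"
      using complex_Re_le_cmod order_trans by blast
    also have "\<dots> \<le> sqrt ?M * sqrt (integral {1..T} (\<lambda>t. (norm (1::complex))\<^sup>2))"
      using integral_Cauchy_Schwarz[OF c, of "\<lambda>_. 1"] by simp
    also have "\<dots> \<le> sqrt ?M * sqrt T"
      using elim M0 by (intro mult_left_mono) auto
    finally have "(T / 2)\<^sup>2 \<le> (sqrt ?M * sqrt T)\<^sup>2" using elim by (intro power_mono) auto
    also have "\<dots> = ?M * T" using M0 elim by (simp add: power_mult_distrib)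
    finally have "T * (T / 4) \<le> T * ?M" by (simp add: power2_eq_square mult.commute)
    then show ?case using elim by (simp only: mult_le_cancel_left_pos)
  qed
qed

text \<open>
  Positivity of the mean of \<open>(\<zeta>\<^sup>k - P\<^sub>N\<^sup>k) cnj (P\<^sub>N\<^sup>k)\<close> says that the mean square of \<open>P\<^sub>N\<^sup>k\<close> is at most the
  correlation of \<open>\<zeta>\<^sup>k\<close> with \<open>P\<^sub>N\<^sup>k\<close>; then \<open>2 |z p| \<le> |z|\<^sup>2 + |p|\<^sup>2\<close>. This plays the role of Bessel's
  inequality and is uniform in \<open>N\<close>.
\<close>

lemma P_moment_le_zeta_moment:
  assumes \<sigma>: "1/2 \<le> \<sigma>" "\<sigma> \<le> 2" and N: "N \<ge> 1" and \<epsilon>: "\<epsilon> > 0"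
  shows "\<forall>\<^sub>F T in at_top. square_integral (\<lambda>s. P_approx N s ^ k) \<sigma> 1 T \<le>
     square_integral (\<lambda>s. zeta s ^ k) \<sigma> 1 T + \<epsilon> * T"
proof -
  obtain B where B: "B \<ge> 1" "\<And>x t. -2 \<le> x \<Longrightarrow> norm (P_approx N (Complex x t)) \<le> B"
    using P_approx_bounded[OF N] by blast
  let ?F = "\<lambda>s. (zeta s ^ k - P_approx N s ^ k) * P_approx N (of_real (2 * \<sigma>) - s) ^ k"
  have hol: "?F holomorphic_on {s. Im s > 0}"
    by (intro holomorphic_intros zeta_holomorphic P_approx_holomorphic P_approx_reflected_holomorphic)
  have refl: "of_real (2 * \<sigma>) - Complex x t = Complex (2 * \<sigma> - x) (-1 * t)" for x t
    by (simp add: complex_eq_iff)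
  have Bk: "norm (P_approx N (Complex x t) ^ k) \<le> B ^ k" if "-2 \<le> x" for x t
    unfolding norm_power using B(2)[OF that] by (intro power_mono) auto
  have Bk0: "B ^ k \<ge> 0" using B by simp
  have "\<forall>\<^sub>F T in at_top. Re (integral {1..T} (\<lambda>t. ?F (Complex \<sigma> t))) \<ge> - (\<epsilon> / 2 * T)"
  proof (rule mean_lower_bound_pos_ap[OF hol \<sigma>(2), of \<nu> "(C + B ^ k) * B ^ k"])
    fix x t assume x: "\<sigma> \<le> x" "x \<le> 2" and t: "1 \<le> (t::real)"
    have "norm (zeta (Complex x t) ^ k - P_approx N (Complex x t) ^ k) \<le>
        norm (zeta (Complex x t) ^ k) + norm (P_approx N (Complex x t) ^ k)" by (rule norm_triangle_ineq4)
    also have "\<dots> \<le> C * t powr \<nu> + B ^ k * t powr \<nu>"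
      using x \<sigma> t const_le_growth[OF Bk0 t] by (intro add_mono growth order_trans[OF Bk]) auto
    finally have "norm (?F (Complex x t)) \<le> (C * t powr \<nu> + B ^ k * t powr \<nu>) * B ^ k"
      unfolding norm_mult refl using x \<sigma> C Bk0 by (intro mult_mono Bk add_nonneg_nonneg) auto
    then show "norm (?F (Complex x t)) \<le> (C + B ^ k) * B ^ k * t powr \<nu>" by (simp add: algebra_simps)
  next
    show "pos_ap (\<lambda>t. ?F (Complex 2 t))"
      unfolding refl by (intro pos_ap_mult pos_ap_zeta_power_minus_P pos_ap_power pos_ap_P_approx N)
  qed (use \<nu> \<epsilon> in auto)
  then show ?thesis
  proof eventually_elim
    case (elim T)
    have i: "(\<lambda>t. ?F (Complex \<sigma> t)) integrable_on {1..T}"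
      by (rule integrable_continuous_interval) (rule continuous_on_vertical[OF hol], simp)
    have iz: "(\<lambda>t. (norm (zeta (Complex \<sigma> t) ^ k))\<^sup>2) integrable_on {1..T}"
      by (intro integrable_continuous_interval continuous_intros continuous_on_vertical[OF zeta_holomorphic]) auto
    have iP: "(\<lambda>t. (norm (P_approx N (Complex \<sigma> t) ^ k))\<^sup>2) integrable_on {1..T}"
      by (intro integrable_continuous_interval continuous_intros continuous_on_P_vertical)
    have iR: "(\<lambda>t. Re (?F (Complex \<sigma> t))) integrable_on {1..T}"
      using integrable_linear[OF i bounded_linear_Re] by (simp add: o_def)
    have pt: "2 * Re (?F (Complex \<sigma> t)) + (norm (P_approx N (Complex \<sigma> t) ^ k))\<^sup>2 \<le> (norm (zeta (Complex \<sigma> t) ^ k))\<^sup>2" for t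
    proof -
      let ?z = "zeta (Complex \<sigma> t) ^ k" and ?p = "P_approx N (Complex \<sigma> t) ^ k"
      have "of_real (2 * \<sigma>) - Complex \<sigma> t = cnj (Complex \<sigma> t)" by (simp add: complex_eq_iff)
      then have "?F (Complex \<sigma> t) = (?z - ?p) * cnj ?p" by (simp add: P_approx_cnj)
      then have "Re (?F (Complex \<sigma> t)) = Re (?z * cnj ?p) - Re (?p * cnj ?p)" by (simp add: left_diff_distrib)
      also have "Re (?p * cnj ?p) = (norm ?p)\<^sup>2" by (simp only: complex_norm_square[symmetric] Re_complex_of_real)
      finally have "Re (?F (Complex \<sigma> t)) = Re (?z * cnj ?p) - (norm ?p)\<^sup>2" .
      moreover have "Re (?z * cnj ?p) \<le> norm ?z * norm ?p"
        using complex_Re_le_cmod[of "?z * cnj ?p"] by (simp only: norm_mult complex_mod_cnj)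
      moreover have "2 * norm ?z * norm ?p \<le> (norm ?z)\<^sup>2 + (norm ?p)\<^sup>2" by (rule sum_squares_bound)
      ultimately show ?thesis by linarith
    qed
    have "2 * integral {1..T} (\<lambda>t. Re (?F (Complex \<sigma> t))) + square_integral (\<lambda>s. P_approx N s ^ k) \<sigma> 1 T =
      integral {1..T} (\<lambda>t. 2 * Re (?F (Complex \<sigma> t)) + (norm (P_approx N (Complex \<sigma> t) ^ k))\<^sup>2)"
      by (subst integral_add[OF integrable_on_mult_right[OF iR, of 2] iP]) (simp only: integral_mult_right)
    also have "\<dots> \<le> square_integral (\<lambda>s. zeta s ^ k) \<sigma> 1 T"
      using pt by (intro integral_le integrable_add integrable_on_mult_right iR iP iz) auto
    also have "integral {1..T} (\<lambda>t. Re (?F (Complex \<sigma> t))) = Re (integral {1..T} (\<lambda>t. ?F (Complex \<sigma> t)))"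
      using integral_linear[OF i bounded_linear_Re] by (simp add: o_def)
    finally show ?case using elim by linarith
  qed
qed

text \<open>
  Both bounds are read off on \<open>Re s = 2\<close>, where the continued twisted power is bounded and of
  nonnegative mean. The line of integration is moved from \<open>t = 1\<close> on, away from the pole; the initial
  segment contributes a constant.
\<close>

lemma twisted_power_bounds:
  assumes \<sigma>: "1/2 \<le> \<sigma>" "\<sigma> < 1" and N: "N \<ge> 1"
  shows "\<epsilon> > 0 \<Longrightarrow> \<forall>\<^sub>F T in at_top. Re (integral {0..T} (twisted_power k N \<sigma>)) \<ge> - (\<epsilon> * T)"
    and "\<exists>K>0. \<forall>\<^sub>F T in at_top. Re (integral {0..T} (twisted_power k N \<sigma>)) \<le> K * T"
proof -
  obtain B where B: "B \<ge> 1" "\<And>x t. -2 \<le> x \<Longrightarrow> norm (P_approx N (Complex x t)) \<le> B"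
    "\<And>x t. -2 \<le> x \<Longrightarrow> norm (1 / P_approx N (Complex x t)) \<le> B"
    using P_approx_bounded[OF N] by blast
  let ?F = "\<lambda>s. zeta s ^ (2 * k) / P_approx N s ^ k * P_approx N (of_real (2 * \<sigma>) - s) ^ k"
  have hol: "?F holomorphic_on {s. Im s > 0}"
    by (intro holomorphic_intros zeta_holomorphic P_approx_holomorphic P_approx_reflected_holomorphic) auto
  have refl: "of_real (2 * \<sigma>) - Complex x t = Complex (2 * \<sigma> - x) (-1 * t)" for x t
    by (simp add: complex_eq_iff)
  have Bk: "norm (P_approx N (Complex x t) ^ k) \<le> B ^ k" if "-2 \<le> x" for x t
    unfolding norm_power using B(2)[OF that] by (intro power_mono) auto
  have Bk': "norm (1 / P_approx N (Complex x t) ^ k) \<le> B ^ k" if "-2 \<le> x" for x t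
    using power_mono[OF B(3)[OF that] norm_ge_zero, of t k] by (simp add: norm_power norm_divide power_divide)
  have Bk0: "B ^ k \<ge> 0" using B by simp
  have gr: "norm (?F (Complex x t)) \<le> (norm (zeta (Complex x t) ^ k))\<^sup>2 * B ^ k * B ^ k" if "1/2 \<le> x" "x \<le> 2" for x t
  proof -
    have "?F (Complex x t) = (zeta (Complex x t) ^ k)\<^sup>2 * (1 / P_approx N (Complex x t) ^ k) * P_approx N (Complex (2 * \<sigma> - x) (-1 * t)) ^ k"
      unfolding refl by (simp add: mult.commute[of 2] power_mult)
    also have "norm \<dots> \<le> (norm (zeta (Complex x t) ^ k))\<^sup>2 * B ^ k * B ^ k"
      unfolding norm_mult norm_power[of _ 2] using that \<sigma> Bk0 by (intro mult_mono Bk Bk' mult_nonneg_nonneg) auto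
    finally show ?thesis .
  qed
  have growth2: "norm (?F (Complex x t)) \<le> (C\<^sup>2 * B ^ k * B ^ k) * t powr (2 * \<nu>)"
    if x: "\<sigma> \<le> x" "x \<le> 2" and t: "1 \<le> t" for x t
  proof -
    have "(norm (zeta (Complex x t) ^ k))\<^sup>2 \<le> (C * t powr \<nu>)\<^sup>2" using x t \<sigma> by (intro power_mono growth) auto
    also have "\<dots> = C\<^sup>2 * t powr (2 * \<nu>)" by (simp add: power_mult_distrib power2_eq_square flip: powr_add)
    finally have "(norm (zeta (Complex x t) ^ k))\<^sup>2 * B ^ k * B ^ k \<le> C\<^sup>2 * t powr (2 * \<nu>) * B ^ k * B ^ k"
      using Bk0 by (intro mult_right_mono)
    then show ?thesis using gr[of x t] x \<sigma> by (simp add: mult_ac)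
  qed
  have Q: "(\<lambda>t. ?F (Complex \<sigma> t)) = twisted_power k N \<sigma>"
  proof
    fix t
    have "of_real (2 * \<sigma>) - Complex \<sigma> t = cnj (Complex \<sigma> t)" by (simp add: complex_eq_iff)
    then show "?F (Complex \<sigma> t) = twisted_power k N \<sigma> t" by (simp add: P_approx_cnj twisted_power_def)
  qed
  have split: "integral {0..T} (twisted_power k N \<sigma>) = integral {0..1} (twisted_power k N \<sigma>) + integral {1..T} (twisted_power k N \<sigma>)"
    if "T \<ge> 1" for T
    using that \<sigma>
    by (intro Henstock_Kurzweil_Integration.integral_combine[symmetric] integrable_continuous_interval continuous_on_twisted_power) auto
  define c where "c = Re (integral {0..1} (twisted_power k N \<sigma>))"
  have pos: "pos_ap (\<lambda>t. ?F (Complex 2 t))"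
    unfolding refl by (intro pos_ap_mult pos_ap_zeta_power_div_P pos_ap_power pos_ap_P_approx N)
  have s2: "\<sigma> \<le> 2" and nu1: "2 * \<nu> < 1" using \<sigma> \<nu> by auto
  {
    assume \<epsilon>: "\<epsilon> > 0"
    then have e2: "\<epsilon> / 2 > 0" by simp
    have "\<forall>\<^sub>F T in at_top. Re (integral {1..T} (\<lambda>t. ?F (Complex \<sigma> t))) \<ge> - (\<epsilon> / 2 * T)"
      by (rule mean_lower_bound_pos_ap[OF hol s2 nu1 growth2 pos e2])
    then show "\<forall>\<^sub>F T in at_top. Re (integral {0..T} (twisted_power k N \<sigma>)) \<ge> - (\<epsilon> * T)"
      unfolding Q using eventually_ge_at_top[of 1] eventually_ge_at_top[of "2 * \<bar>c\<bar> / \<epsilon>"]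
    proof eventually_elim
      case (elim T)
      have "2 * \<bar>c\<bar> \<le> \<epsilon> * T" using elim(3) \<epsilon> by (simp add: pos_divide_le_eq mult.commute)
      then show ?case using elim split[of T] by (simp add: c_def[symmetric] abs_le_iff)
    qed
  }
  obtain B2 where "\<forall>t. norm (?F (Complex 2 t)) \<le> B2" using pos_ap_imp_bounded[OF pos] by blast
  then have B2: "\<And>t. norm (?F (Complex 2 t)) \<le> B2" by blast
  then have B20: "B2 \<ge> 0" using norm_ge_zero order_trans by blast
  have "\<forall>\<^sub>F T in at_top. norm (integral {1..T} (\<lambda>t. ?F (Complex \<sigma> t))) \<le> (B2 + 1) * T"
    by (rule mean_bounded_by_right_edge[OF hol s2 nu1 growth2 B2])
  then have "\<forall>\<^sub>F T in at_top. Re (integral {0..T} (twisted_power k N \<sigma>)) \<le> (B2 + 2) * T"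
    unfolding Q using eventually_ge_at_top[of 1] eventually_ge_at_top[of "\<bar>c\<bar>"]
  proof eventually_elim
    case (elim T)
    then show ?case
      using split[of T] complex_Re_le_cmod[of "integral {1..T} (twisted_power k N \<sigma>)"]
      by (simp add: c_def[symmetric] algebra_simps abs_le_iff)
  qed
  then show "\<exists>K>0. \<forall>\<^sub>F T in at_top. Re (integral {0..T} (twisted_power k N \<sigma>)) \<le> K * T"
    using B20 by (intro exI[of _ "B2 + 2"]) auto
qed

lemma zeta_moment_lower_bound:
  assumes "1/2 \<le> \<sigma>" "\<sigma> < 1"
  shows "\<forall>\<^sub>F T in at_top. T / 4 \<le> zeta_moment k \<sigma> T"
proof -
  have "\<forall>\<^sub>F T in at_top. T / 4 \<le> square_integral (\<lambda>s. zeta s ^ k) \<sigma> 1 T"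
    using assms by (intro moment_lower_bound) auto
  then show ?thesis using eventually_ge_at_top[of 1]
  proof eventually_elim
    case (elim T)
    then show ?case using zeta_moment_split[of \<sigma> T k] zeta_moment_nonneg[of k \<sigma> 1] assms by simp
  qed
qed

end

section \<open>Bounded moments near the line of abscissa 1\<close>

lemma square_integral_add_le:
  assumes F: "F holomorphic_on {s. Im s > 0}" and G: "G holomorphic_on {s. Im s > 0}" and a: "0 < a"
    and H: "\<And>t. norm (H (Complex x t)) \<le> norm (F (Complex x t)) + norm (G (Complex x t))"
    and Hh: "H holomorphic_on {s. Im s > 0}"
  shows "square_integral H x a b \<le>
     2 * square_integral F x a b + 2 * square_integral G x a b"
proof -
  have i: "(\<lambda>t. (norm (E (Complex x t)))\<^sup>2) integrable_on {a..b}" if "E holomorphic_on {s. Im s > 0}" for E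
    by (intro integrable_continuous_interval continuous_intros continuous_on_vertical[OF that a])
  have "(norm (H (Complex x t)))\<^sup>2 \<le> 2 * (norm (F (Complex x t)))\<^sup>2 + 2 * (norm (G (Complex x t)))\<^sup>2" for t
  proof -
    have "(norm (H (Complex x t)))\<^sup>2 \<le> (norm (F (Complex x t)) + norm (G (Complex x t)))\<^sup>2"
      using H by (intro power_mono) auto
    also have "\<dots> \<le> 2 * (norm (F (Complex x t)))\<^sup>2 + 2 * (norm (G (Complex x t)))\<^sup>2"
      using sum_squares_bound[of "norm (F (Complex x t))" "norm (G (Complex x t))"] by (simp add: power2_sum)
    finally show ?thesis .
  qed
  then have "square_integral H x a b \<le>
      integral {a..b} (\<lambda>t. 2 * (norm (F (Complex x t)))\<^sup>2 + 2 * (norm (G (Complex x t)))\<^sup>2)"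
    by (intro integral_le integrable_add integrable_on_mult_right i F G Hh)
  also have "\<dots> = 2 * square_integral F x a b + 2 * square_integral G x a b"
    by (subst integral_add) (auto intro!: integrable_on_mult_right i F G)
  finally show ?thesis .
qed

lemma harm_le_1_plus_ln:
  assumes "n \<ge> 1"
  shows "harm n \<le> 1 + ln (real n)"
proof -
  have "harm (Suc (n - 1)) - ln (Suc (n - 1)) \<le> harm (Suc 0) - ln (Suc 0)"
    using decseq_harm_diff_ln by (rule decseqD) simp
  then show ?thesis using assms by (simp add: harm_def)
qed

abbreviation moment_bounded :: "nat \<Rightarrow> real \<Rightarrow> bool" where
  "moment_bounded k \<sigma> \<equiv> (\<lambda>T. zeta_moment k \<sigma> T) \<in> O[at_top](\<lambda>T. T)"

lemma moment_bounded_iff: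
  "moment_bounded k \<sigma> \<longleftrightarrow> (\<exists>K>0. \<forall>\<^sub>F T in at_top. zeta_moment k \<sigma> T \<le> K * T)"
proof
  assume "moment_bounded k \<sigma>"
  then obtain K where K: "K > 0" "\<forall>\<^sub>F T in at_top. norm (zeta_moment k \<sigma> T) \<le> K * norm T"
    by (rule landau_o.bigE)
  have "\<forall>\<^sub>F T in at_top. zeta_moment k \<sigma> T \<le> K * T"
    using K(2) eventually_ge_at_top[of 0] by eventually_elim auto
  with K(1) show "\<exists>K>0. \<forall>\<^sub>F T in at_top. zeta_moment k \<sigma> T \<le> K * T" by blast
next
  assume "\<exists>K>0. \<forall>\<^sub>F T in at_top. zeta_moment k \<sigma> T \<le> K * T"
  then obtain K where K: "K > 0" "\<forall>\<^sub>F T in at_top. zeta_moment k \<sigma> T \<le> K * T" by blast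
  have "\<forall>\<^sub>F T in at_top. norm (zeta_moment k \<sigma> T) \<le> K * norm T"
    using K(2) eventually_ge_at_top[of 0] by eventually_elim (auto simp: zeta_moment_nonneg)
  then show "moment_bounded k \<sigma>" by (rule bigoI)
qed

lemma dirichlet_polynomial_holomorphic: "(\<lambda>s. \<Sum>n=1..N. dterm a s n) holomorphic_on A"
  unfolding dterm_def by (intro holomorphic_intros) auto

context zeta_power_growth
begin

text \<open>
  Carlson's method. Let \<open>D\<close> be the partial sum of length \<open>T powr \<kappa>\<close> of the series of \<open>\<zeta>\<^sup>k\<close>. Since
  \<open>\<kappa> < 1\<close>, the mean square of \<open>D\<close> over an interval of length \<open>T\<close> is controlled by its diagonal, hence bounded
  on \<open>Re s = \<sigma>\<close> and of order \<open>T powr (2 \<nu>)\<close> on \<open>Re s = 1/2\<close>, like that of \<open>\<zeta>\<^sup>k\<close>. On \<open>Re s = 2\<close>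
  the remainder \<open>\<zeta>\<^sup>k - D\<close> is \<open>O (T powr (- l))\<close> with \<open>l > 2 \<nu>\<close>. Interpolating the remainder between these
  two lines gives a bounded mean square when \<open>\<sigma>\<close> is close to \<open>1\<close>.
\<close>

lemma moment_bounded_near_1:
  "\<exists>\<sigma>\<^sub>0\<in>{1/2..<1}. \<forall>\<sigma>\<in>{\<sigma>\<^sub>0<..<1}. moment_bounded k \<sigma>"
proof -
  \<comment> \<open>Any exponents with \<open>2 \<nu> < l < \<kappa> < 1\<close> would do. The abscissa \<open>\<sigma>\<^sub>0\<close> is where the interpolated exponent of \<open>T\<close> vanishes.\<close>
  define \<kappa> where "\<kappa> = (1 + 2 * \<nu>) / 2"
  define l where "l = (\<kappa> + 2 * \<nu>) / 2"
  have \<kappa>: "2 * \<nu> < \<kappa>" "\<kappa> < 1" "0 < \<kappa>" using \<nu> by (auto simp: \<kappa>_def)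
  have l: "2 * \<nu> < l" "l < \<kappa>" "0 < l" using \<kappa> \<nu> by (auto simp: l_def)
  define \<delta> where "\<delta> = 1 - l / \<kappa>"
  have \<delta>: "\<delta> > 0" "\<kappa> * (1 - \<delta>) = l" "\<delta> < 1" using l \<kappa> by (auto simp: \<delta>_def)
  define \<sigma>\<^sub>0 where "\<sigma>\<^sub>0 = (2 * \<nu> + l / 2) / (\<nu> + l)"
  have \<sigma>\<^sub>0: "1/2 \<le> \<sigma>\<^sub>0" "\<sigma>\<^sub>0 < 1" using l \<nu> by (auto simp: \<sigma>\<^sub>0_def field_simps)
  define c where "c = zeta_power_coeff k"
  have c0: "c n \<ge> 0" for n by (simp add: c_def zeta_power_coeff_nonneg)
  define D where "D N s = (\<Sum>n=1..N. dterm c s n)" for N s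
  have Dh: "D N holomorphic_on {s. Im s > 0}" for N
    unfolding D_def[abs_def] by (rule dirichlet_polynomial_holomorphic)
  have zh: "(\<lambda>s. zeta s ^ k) holomorphic_on {s. Im s > 0}" by (rule zeta_power_holomorphic)
  define g where "g N s = zeta s ^ k - D N s" for N s
  have gh: "g N holomorphic_on {s. Im s > 0}" for N
    unfolding g_def[abs_def] by (intro holomorphic_on_diff zh Dh)
  have "moment_bounded k \<sigma>" if \<sigma>: "\<sigma>\<^sub>0 < \<sigma>" "\<sigma> < 1" for \<sigma>
  proof -
    have \<sigma>12: "1/2 < \<sigma>" using \<sigma> \<sigma>\<^sub>0 by simp
    \<comment> \<open>The interpolation parameter will be \<open>Y = T powr \<beta>\<close>, for which \<open>Y powr (1/2 - \<sigma>)\<close> cancels the growth \<open>T powr \<nu>\<close> on the left edge.\<close>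
    define \<beta> where "\<beta> = \<nu> / (\<sigma> - 1/2)"
    have \<beta>: "\<beta> > 0" "\<beta> * (1/2 - \<sigma>) = - \<nu>" using \<nu> \<sigma>12 by (auto simp: \<beta>_def field_simps)
    have "2 * \<nu> + l / 2 < \<sigma> * (\<nu> + l)"
      using \<sigma>(1) l \<nu> by (simp add: \<sigma>\<^sub>0_def pos_divide_less_eq)
    then have "\<nu> * (2 - \<sigma>) \<le> l * (\<sigma> - 1/2)" by (simp add: algebra_simps)
    then have \<beta>2: "\<beta> * (2 - \<sigma>) \<le> l" using \<sigma>12 by (simp add: \<beta>_def pos_divide_le_eq)
    define Z1 where "Z1 = (\<Sum>n. c n * real n powr (- (1 + \<delta>)))"
    define Z2 where "Z2 = (\<Sum>n. (c n)\<^sup>2 * real n powr (- (1 + 2 * \<nu>)))"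
    define Z3 where "Z3 = (\<Sum>n. (c n)\<^sup>2 * real n powr (- (2 * \<sigma>)))"
    have s1: "summable (\<lambda>n. c n * real n powr (- (1 + \<delta>)))"
      unfolding c_def using \<delta> by (intro summable_zeta_power_coeff) auto
    have s2: "summable (\<lambda>n. (c n)\<^sup>2 * real n powr (- (1 + 2 * \<nu>)))"
      unfolding c_def using \<nu> by (intro summable_zeta_power_coeff) auto
    have s3: "summable (\<lambda>n. (c n)\<^sup>2 * real n powr (- (2 * \<sigma>)))"
      unfolding c_def using \<sigma>12 by (intro summable_zeta_power_coeff) auto
    have Z1: "Z1 \<ge> 0" unfolding Z1_def by (intro suminf_nonneg s1 mult_nonneg_nonneg c0) auto
    have Z2: "Z2 \<ge> 0" unfolding Z2_def by (intro suminf_nonneg s2) auto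
    have Z3: "Z3 \<ge> 0" unfolding Z3_def by (intro suminf_nonneg s3) auto
    obtain Cc where Cc: "Cc \<ge> 1" "\<And>n. c n \<le> Cc * real n powr 1"
      using zeta_power_coeff_bound[of 1 k] unfolding c_def by auto
    define C1 where "C1 = 2 * C\<^sup>2 * 4 + 10 * Z2"
    define C2 where "C2 = 2 * C + Cc"
    define C3 where "C3 = exp 4 * (sqrt C1 + Z1 + C2)"
    have C1: "C1 \<ge> 0" using Z2 by (simp add: C1_def)
    have C2: "C2 \<ge> 0" using C Cc by (simp add: C2_def)
    have ev: "\<forall>\<^sub>F T in at_top. (1::real) \<le> ln T" "\<forall>\<^sub>F T in at_top. 3 * ln T \<le> (T::real)"
      "\<forall>\<^sub>F T in at_top. (2 * ln T)\<^sup>2 \<le> (T::real)" "\<forall>\<^sub>F T in at_top. exp (- (ln T)\<^sup>2) * T ^ 3 \<le> (1::real)"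
      by real_asymp+
    have ev2: "\<forall>\<^sub>F T in at_top. T powr \<kappa> * (1 + ln T) \<le> T" using \<kappa> by real_asymp
    have "\<forall>\<^sub>F T in at_top. square_integral (\<lambda>s. zeta s ^ k) \<sigma> 1 T \<le> (C\<^sup>2 + 2 * C3\<^sup>2 + 10 * Z3) * T"
      using ev ev2
    proof eventually_elim
      case (elim T)
      define H where "H = ln T"
      have H: "H \<ge> 1" "3 * H \<le> T" using elim by (auto simp: H_def)
      have T: "T \<ge> 1" using H by simp
      define N where "N = nat \<lfloor>T powr \<kappa>\<rfloor>"
      have Tk: "T powr \<kappa> \<ge> 1" using T \<kappa> by (simp add: ge_one_powr_ge_zero)
      have N1: "real N \<le> T powr \<kappa>" "T powr \<kappa> < real N + 1" using Tk by (auto simp: N_def)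
      have N: "N \<ge> 1" using N1 Tk by simp
      have "T powr \<kappa> \<le> T powr 1" using T \<kappa> by (intro powr_mono) auto
      then have NT: "real N \<le> T" using N1 T by simp
      have "harm N \<le> 1 + ln (real N)" using harm_le_1_plus_ln[OF N] by simp
      also have "\<dots> \<le> 1 + ln T" using NT N T by simp
      finally have hN: "real N * harm N \<le> T powr \<kappa> * (1 + ln T)"
        using N1 T by (intro mult_mono) (auto intro: harm_nonneg)
      then have hN: "real N * harm N \<le> T" using elim by linarith
      have poly: "square_integral (D N) x (2*H+y) (T+y) \<le> (5 * T) * (\<Sum>n=1..N. (c n)\<^sup>2 * real n powr (- 2 * x))" for x y
      proof -
        have "square_integral (D N) x (2*H+y) (T+y) \<le>
            (T + y - (2*H+y) + 4 * real N * harm N) * (\<Sum>n=1..N. (c n)\<^sup>2 * real n powr (- 2 * x))"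
          unfolding D_def using H by (intro dirichlet_polynomial_mean_square) auto
        also have "\<dots> \<le> (5 * T) * (\<Sum>n=1..N. (c n)\<^sup>2 * real n powr (- 2 * x))"
          using hN H by (intro mult_right_mono sum_nonneg) auto
        finally show ?thesis .
      qed
      have zg: "norm (zeta (Complex x t) ^ k) \<le> C * (2 * T) powr \<nu>" if "1/2 \<le> x" "x \<le> 2" "1 \<le> t" "t \<le> 2 * T" for x t
      proof -
        have "norm (zeta (Complex x t) ^ k) \<le> C * t powr \<nu>" using that by (intro growth) auto
        also have "\<dots> \<le> C * (2 * T) powr \<nu>" using that C \<nu> by (intro mult_left_mono powr_mono2) auto
        finally show ?thesis .
      qed
      have "(T powr \<kappa>) powr (- (1 - \<delta>)) = T powr (- l)" by (simp only: powr_powr mult_minus_right \<delta>(2))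
      then have tail: "norm (g N (Complex 2 t)) \<le> Z1 * T powr (- l)" for t
        using zeta_power_partial_sum_remainder[OF \<delta>(1,3) Tk less_imp_le[OF N1(2)], of t k]
        by (simp only: g_def D_def c_def Z1_def)
      define A where "A = sqrt C1 * T powr \<nu> * sqrt T"
      define E where "E = Z1 * T powr (- l) * sqrt T"
      define G where "G = C2 * T\<^sup>2 * sqrt T"
      have gint: "square_integral (g N) \<sigma> (2*H) T \<le> (C3 * sqrt T)\<^sup>2"
      proof (rule mean_square_three_lines[OF gh, where H = H and Y = "T powr \<beta>" and A = A and E = E and G = G])
        show "1/2 \<le> \<sigma>" "\<sigma> \<le> 2" "2 - 1/2 \<le> (2::real)" using \<sigma> \<sigma>12 by auto
      next
        fix y assume y: "- H \<le> y" "y \<le> H"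
        have "square_integral (g N) (1/2) (2*H+y) (T+y) \<le>
           2 * square_integral (\<lambda>s. zeta s ^ k) (1/2) (2*H+y) (T+y) + 2 * square_integral (D N) (1/2) (2*H+y) (T+y)"
          using y H unfolding g_def
          by (intro square_integral_add_le[OF zh Dh] norm_triangle_ineq4 holomorphic_on_diff zh Dh) auto
        also have "square_integral (\<lambda>s. zeta s ^ k) (1/2) (2*H+y) (T+y) \<le> (T + y - (2*H+y)) * (C * (2 * T) powr \<nu>)\<^sup>2"
          using y H by (intro square_integral_le[OF zh] zg) auto
        also have "\<dots> \<le> T * (C * (2 * T) powr \<nu>)\<^sup>2" using H by (intro mult_right_mono) auto
        also have "(2 * T) powr \<nu> \<le> 2 * T powr \<nu>"
        proof -
          have "2 powr \<nu> \<le> 2 powr (1::real)" using \<nu> by (intro powr_mono) auto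
          then show ?thesis using T by (simp add: powr_mult mult_right_mono)
        qed
        then have "T * (C * (2 * T) powr \<nu>)\<^sup>2 \<le> T * (C * (2 * T powr \<nu>))\<^sup>2"
          using T C by (intro mult_left_mono power_mono) auto
        also have "square_integral (D N) (1/2) (2*H+y) (T+y) \<le> (5 * T) * (Z2 * (T powr \<nu>)\<^sup>2)"
        proof -
          have "(\<Sum>n=1..N. (c n)\<^sup>2 * real n powr (- 2 * (1/2))) \<le> (\<Sum>n=1..N. T powr (2 * \<nu>) * ((c n)\<^sup>2 * real n powr (- (1 + 2 * \<nu>))))"
          proof (rule sum_mono)
            fix n assume n: "n \<in> {1..N}"
            have "real n powr (- 2 * (1/2)) = real n powr (2 * \<nu>) * real n powr (- (1 + 2 * \<nu>))"
              by (simp flip: powr_add)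
            also have "\<dots> \<le> T powr (2 * \<nu>) * real n powr (- (1 + 2 * \<nu>))"
              using n NT \<nu> by (intro mult_right_mono powr_mono2) auto
            finally have "(c n)\<^sup>2 * real n powr (- 2 * (1/2)) \<le> (c n)\<^sup>2 * (T powr (2 * \<nu>) * real n powr (- (1 + 2 * \<nu>)))"
              by (intro mult_left_mono) auto
            then show "(c n)\<^sup>2 * real n powr (- 2 * (1/2)) \<le> T powr (2 * \<nu>) * ((c n)\<^sup>2 * real n powr (- (1 + 2 * \<nu>)))"
              by (simp only: mult.left_commute)
          qed
          also have "\<dots> = T powr (2 * \<nu>) * (\<Sum>n=1..N. (c n)\<^sup>2 * real n powr (- (1 + 2 * \<nu>)))"
            by (rule sum_distrib_left[symmetric])
          also have "\<dots> \<le> T powr (2 * \<nu>) * Z2"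
            unfolding Z2_def by (intro mult_left_mono sum_le_suminf s2) auto
          also have "\<dots> = Z2 * (T powr \<nu>)\<^sup>2" by (simp add: power2_eq_square flip: powr_add)
          finally show ?thesis using T by (intro order_trans[OF poly] mult_left_mono) auto
        qed
        finally have "square_integral (g N) (1/2) (2*H+y) (T+y) \<le>
            2 * (T * (C * (2 * T powr \<nu>))\<^sup>2) + 2 * (5 * T * (Z2 * (T powr \<nu>)\<^sup>2))" by simp
        also have "\<dots> = A\<^sup>2"
          using C1 T by (simp add: A_def C1_def power_mult_distrib algebra_simps)
        finally show "square_integral (g N) (1/2) (2*H+y) (T+y) \<le> A\<^sup>2" .
        have "square_integral (g N) 2 (2*H+y) (T+y) \<le> (T + y - (2*H+y)) * (Z1 * T powr (- l))\<^sup>2"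
          using y H by (intro square_integral_le[OF gh] tail) auto
        also have "\<dots> \<le> T * (Z1 * T powr (- l))\<^sup>2" using H by (intro mult_right_mono) auto
        also have "\<dots> = E\<^sup>2" using T by (simp add: E_def power_mult_distrib)
        finally show "square_integral (g N) 2 (2*H+y) (T+y) \<le> E\<^sup>2" .
      next
        fix x y :: real assume x: "1/2 \<le> x" "x \<le> 2" and y: "\<bar>y\<bar> = H"
        have "square_integral (g N) x (2*H+y) (T+y) \<le> (T + y - (2*H+y)) * (C2 * T\<^sup>2)\<^sup>2"
        proof (rule square_integral_le[OF gh])
          fix t assume t: "2*H+y \<le> t" "t \<le> T+y"
          have "norm (zeta (Complex x t) ^ k) \<le> C * (2 * T) powr \<nu>" using t y H x by (intro zg) auto
          also have "\<dots> \<le> C * (2 * T) powr 1" using C T \<nu> by (intro mult_left_mono powr_mono) auto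
          also have "\<dots> \<le> C * (2 * T\<^sup>2)" using C T by (intro mult_left_mono) (auto simp: power2_eq_square)
          finally have 1: "norm (zeta (Complex x t) ^ k) \<le> 2 * C * T\<^sup>2" by simp
          have "norm (D N (Complex x t)) \<le> (\<Sum>n=1..N. Cc * T)"
            unfolding D_def
          proof (rule sum_norm_le)
            fix n assume n: "n \<in> {1..N}"
            have "c n * real n powr (- x) \<le> (Cc * real n powr 1) * real n powr 0"
              using Cc c0 x n by (intro mult_mono powr_mono) auto
            also have "\<dots> \<le> Cc * T" using n NT Cc by (auto intro!: mult_left_mono)
            finally show "norm (dterm c (Complex x t) n) \<le> Cc * T" using c0[of n] by (simp add: norm_dterm)
          qed
          also have "\<dots> = real N * (Cc * T)" by simp
          also have "\<dots> \<le> T * (Cc * T)" using NT Cc T by (intro mult_right_mono) auto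
          finally have "norm (D N (Complex x t)) \<le> Cc * T\<^sup>2" by (simp add: power2_eq_square mult_ac)
          then show "norm (g N (Complex x t)) \<le> C2 * T\<^sup>2"
            unfolding g_def using 1 by (intro order_trans[OF norm_triangle_ineq4]) (simp add: C2_def algebra_simps)
        qed (use y H in auto)
        also have "\<dots> \<le> T * (C2 * T\<^sup>2)\<^sup>2" using H by (intro mult_right_mono) auto
        also have "\<dots> = G\<^sup>2" using T by (simp add: G_def power_mult_distrib)
        finally show "square_integral (g N) x (2*H+y) (T+y) \<le> G\<^sup>2" .
      next
        have C3': "exp 4 * X * sqrt T \<le> C3 * sqrt T" if "X \<le> sqrt C1 + Z1 + C2" for X
          using that T by (simp add: C3_def mult_right_mono)
        have "exp 4 * (T powr \<beta>) powr (1/2 - \<sigma>) * A = exp 4 * (sqrt C1 * (T powr (- \<nu>) * T powr \<nu>)) * sqrt T"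
          unfolding powr_powr \<beta>(2) A_def by simp
        also have "T powr (- \<nu>) * T powr \<nu> = 1" using T by (simp flip: powr_add)
        also have "exp 4 * (sqrt C1 * 1) * sqrt T \<le> C3 * sqrt T" using Z1 C2 by (intro C3') auto
        finally show "exp 4 * (T powr \<beta>) powr (1/2 - \<sigma>) * A \<le> C3 * sqrt T" .
        have Yl: "(T powr \<beta>) powr (2 - \<sigma>) \<le> T powr l"
          unfolding powr_powr using T \<beta>2 by (intro powr_mono) auto
        have "exp 4 * (T powr \<beta>) powr (2 - \<sigma>) * E \<le> exp 4 * T powr l * E"
          using Yl Z1 T by (intro mult_right_mono mult_left_mono) (auto simp: E_def)
        also have "\<dots> = exp 4 * (Z1 * (T powr l * T powr (- l))) * sqrt T" by (simp add: E_def)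
        also have "T powr l * T powr (- l) = 1" using T by (simp flip: powr_add)
        also have "exp 4 * (Z1 * 1) * sqrt T \<le> C3 * sqrt T" using C1 C2 by (intro C3') auto
        finally show "exp 4 * (T powr \<beta>) powr (2 - \<sigma>) * E \<le> C3 * sqrt T" .
        have "exp 4 * (T powr \<beta>) powr (2 - \<sigma>) * (exp (- H\<^sup>2) * G) \<le> exp 4 * T powr 1 * (exp (- H\<^sup>2) * G)"
          using Yl C2 T l \<kappa> powr_mono[of l 1 T] by (intro mult_right_mono mult_left_mono) (auto simp: G_def)
        also have "\<dots> = exp 4 * (C2 * (exp (- (ln T)\<^sup>2) * T ^ 3)) * sqrt T"
          using T by (simp add: G_def H_def power2_eq_square power3_eq_cube)
        also have "\<dots> \<le> exp 4 * (C2 * 1) * sqrt T"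
          using elim C2 T by (intro mult_right_mono mult_left_mono) auto
        also have "\<dots> \<le> C3 * sqrt T" using C1 Z1 by (intro C3') auto
        finally show "exp 4 * (T powr \<beta>) powr (2 - \<sigma>) * (exp (- H\<^sup>2) * G) \<le> C3 * sqrt T" .
      qed (use H T C1 C2 Z1 \<beta> in \<open>auto simp: A_def E_def G_def ge_one_powr_ge_zero\<close>)
      have "square_integral (\<lambda>s. zeta s ^ k) \<sigma> (2*H) T \<le>
         2 * square_integral (g N) \<sigma> (2*H) T + 2 * square_integral (D N) \<sigma> (2*H) T"
      proof (rule square_integral_add_le[OF gh Dh _ _ zh])
        show "norm (zeta (Complex \<sigma> t) ^ k) \<le> norm (g N (Complex \<sigma> t)) + norm (D N (Complex \<sigma> t))" for t
          using norm_triangle_ineq[of "g N (Complex \<sigma> t)" "D N (Complex \<sigma> t)"] by (simp add: g_def)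
      qed (use H in auto)
      also have "square_integral (D N) \<sigma> (2*H) T \<le> 5 * T * Z3"
      proof -
        have "(\<Sum>n=1..N. (c n)\<^sup>2 * real n powr (- 2 * \<sigma>)) \<le> Z3"
          unfolding Z3_def using sum_le_suminf[OF s3, of "{1..N}"] by simp
        then have "(5 * T) * (\<Sum>n=1..N. (c n)\<^sup>2 * real n powr (- 2 * \<sigma>)) \<le> (5 * T) * Z3"
          using T by (intro mult_left_mono) auto
        then show ?thesis using poly[of 0 \<sigma>] by simp
      qed
      also note gint
      also have "(C3 * sqrt T)\<^sup>2 = C3\<^sup>2 * T" using T by (simp add: power_mult_distrib)
      finally have 1: "square_integral (\<lambda>s. zeta s ^ k) \<sigma> (2*H) T \<le> (2 * C3\<^sup>2 + 10 * Z3) * T"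
        by (simp add: algebra_simps)
      have "square_integral (\<lambda>s. zeta s ^ k) \<sigma> 1 (2*H) \<le> C\<^sup>2 * (2 * H)\<^sup>2"
        using growth[of \<sigma>] \<sigma>12 \<sigma> H \<nu> by (intro square_integral_growth[OF zh]) auto
      also have "\<dots> \<le> C\<^sup>2 * T" using elim by (intro mult_left_mono) (auto simp: H_def)
      finally have 2: "square_integral (\<lambda>s. zeta s ^ k) \<sigma> 1 (2*H) \<le> C\<^sup>2 * T" .
      note square_integral_combine[OF zh, of 1 "2 * H" T \<sigma>]
      with 1 2 H show ?case by (simp add: algebra_simps)
    qed
    then have "\<forall>\<^sub>F T in at_top. zeta_moment k \<sigma> T \<le> (C\<^sup>2 + 2 * C3\<^sup>2 + 10 * Z3 + 1) * T"
      using eventually_ge_at_top[of 1] eventually_ge_at_top[of "zeta_moment k \<sigma> 1"]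
    proof eventually_elim
      case (elim T)
      then show ?case using zeta_moment_split[of \<sigma> T k] \<sigma> by (simp add: algebra_simps)
    qed
    then show ?thesis
      unfolding moment_bounded_iff using C Z3 by (intro exI[of _ "C\<^sup>2 + 2 * C3\<^sup>2 + 10 * Z3 + 1"]) (auto simp: add_pos_nonneg add_nonneg_pos)
  qed
  then show ?thesis using \<sigma>\<^sub>0 by (intro bexI[of _ \<sigma>\<^sub>0]) auto
qed

end

section \<open>The two sides of the critical abscissa\<close>

context zeta_power_growth
begin

lemma square_integral_le_moment_bound:
  assumes "\<alpha> \<noteq> 1" and "\<forall>\<^sub>F T in at_top. zeta_moment k \<alpha> T \<le> A * T"
  shows "\<forall>\<^sub>F T in at_top. square_integral (\<lambda>s. zeta s ^ k) \<alpha> 1 T \<le> A * T"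
  using assms(2) eventually_ge_at_top[of 1]
proof eventually_elim
  case (elim T)
  then show ?case using zeta_moment_split[OF assms(1), of T k] zeta_moment_nonneg[of k \<alpha> 1] by simp
qed

lemma moment_bounded_mono:
  assumes \<alpha>: "1/2 \<le> \<alpha>" "\<alpha> < \<sigma>" "\<sigma> < 1"
    and bd: "moment_bounded k \<alpha>"
  shows "moment_bounded k \<sigma>"
proof -
  obtain A where A: "A > 0" "\<forall>\<^sub>F T in at_top. zeta_moment k \<alpha> T \<le> A * T"
    using bd unfolding moment_bounded_iff by blast
  obtain B where B: "B > 0" "\<And>t. norm (zeta (Complex 2 t)) \<le> B" using zeta_bounded_Re_2 by blast
  have left: "\<forall>\<^sub>F T in at_top. square_integral (\<lambda>s. zeta s ^ k) \<alpha> 1 T \<le> A * T"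
    by (rule square_integral_le_moment_bound[OF _ A(2)]) (use \<alpha> in simp)
  define K where "K = exp 8 * (2 * A * (1 powr (\<alpha> - \<sigma>))\<^sup>2 + (B ^ k)\<^sup>2 * (1 powr (2 - \<sigma>))\<^sup>2) + 1"
  have "\<forall>\<^sub>F T in at_top. square_integral (\<lambda>s. zeta s ^ k) \<sigma> 1 T \<le> K * T"
    unfolding K_def
  proof (rule mean_square_interpolation[OF zeta_power_holomorphic _ _ _ _ _ _ left])
    show "norm (zeta (Complex x t) ^ k) \<le> C * t powr \<nu>" if "\<alpha> \<le> x" "x \<le> 2" "1 \<le> t" for x t
      using that \<alpha> by (intro growth) auto
    show "norm (zeta (Complex 2 t) ^ k) \<le> B ^ k" for t
      unfolding norm_power using B(2) by (intro power_mono) auto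
  qed (use \<alpha> \<nu> A in auto)
  then have "\<forall>\<^sub>F T in at_top. zeta_moment k \<sigma> T \<le> (K + 1) * T"
    using eventually_ge_at_top[of 1] eventually_ge_at_top[of "zeta_moment k \<sigma> 1"]
  proof eventually_elim
    case (elim T)
    then show ?case using zeta_moment_split[of \<sigma> T k] \<alpha> by (simp add: algebra_simps)
  qed
  moreover have "K + 1 > 0" unfolding K_def using A(1) by (intro add_nonneg_pos) auto
  ultimately show ?thesis unfolding moment_bounded_iff by blast
qed

text \<open>
  The ratio is \<open>1/2 - R / (2 M)\<close>, where \<open>R\<close> is the twisted integral and \<open>M\<close> the moment. From \<open>R \<ge> - o(T)\<close> and
  \<open>M \<ge> T / 4\<close> the limes superior is at most \<open>1/2\<close>. If it were smaller, then \<open>M\<close> would eventually be at most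
  a constant multiple of \<open>R\<close>, hence \<open>O(T)\<close>.
\<close>

lemma sin_moment_ratio_half:
  assumes \<sigma>: "1/2 \<le> \<sigma>" "\<sigma> < 1" and N: "N \<ge> 1"
    and unbounded: "\<not> moment_bounded k \<sigma>"
  shows "Limsup at_top (\<lambda>T. ereal (zeta_sin_moment k N \<sigma> T / zeta_moment k \<sigma> T)) = ereal (1/2)"
proof (rule antisym)
  define R where "R T = Re (integral {0..T} (twisted_power k N \<sigma>))" for T
  define M where "M = zeta_moment k \<sigma>"
  have ratio: "zeta_sin_moment k N \<sigma> T / M T = 1/2 - R T / (2 * M T)" if "M T > 0" "T \<ge> 0" for T
    using that zeta_sin_moment_eq[of \<sigma> T k N] \<sigma> by (simp add: R_def M_def field_simps)
  have M: "\<forall>\<^sub>F T in at_top. T / 4 \<le> M T" unfolding M_def using \<sigma> by (rule zeta_moment_lower_bound)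
  show "Limsup at_top (\<lambda>T. ereal (zeta_sin_moment k N \<sigma> T / zeta_moment k \<sigma> T)) \<le> ereal (1/2)"
    unfolding M_def[symmetric]
  proof (rule ereal_le_epsilon2)
    fix \<epsilon> :: real assume \<epsilon>: "\<epsilon> > 0"
    then have "\<epsilon> / 2 > 0" by simp
    from twisted_power_bounds(1)[OF \<sigma> N this] M
    have "\<forall>\<^sub>F T in at_top. ereal (zeta_sin_moment k N \<sigma> T / M T) \<le> ereal (1/2) + ereal \<epsilon>"
      using eventually_gt_at_top[of 0]
    proof eventually_elim
      case (elim T)
      have MT: "M T > 0" using elim by linarith
      have "\<epsilon> * (T / 4) \<le> \<epsilon> * M T" using elim \<epsilon> by (intro mult_left_mono) auto
      then have "- R T \<le> \<epsilon> * (2 * M T)" using elim(1) by (simp add: R_def)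
      then have "- R T / (2 * M T) \<le> \<epsilon>" using MT by (subst pos_divide_le_eq) auto
      then show ?case using ratio[OF MT] elim by simp
    qed
    then show "Limsup at_top (\<lambda>T. ereal (zeta_sin_moment k N \<sigma> T / M T)) \<le> ereal (1/2) + ereal \<epsilon>"
      by (rule Limsup_bounded)
  qed
  show "ereal (1/2) \<le> Limsup at_top (\<lambda>T. ereal (zeta_sin_moment k N \<sigma> T / zeta_moment k \<sigma> T))"
  proof (rule ccontr)
    assume "\<not> ?thesis"
    then have "Limsup at_top (\<lambda>T. ereal (zeta_sin_moment k N \<sigma> T / M T)) < ereal (1/2)" by (simp add: M_def)
    from ereal_dense2[OF this]
    obtain c where c: "Limsup at_top (\<lambda>T. ereal (zeta_sin_moment k N \<sigma> T / M T)) < ereal c" "c < 1/2"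
      by auto
    obtain K where K: "K > 0" "\<forall>\<^sub>F T in at_top. R T \<le> K * T"
      using twisted_power_bounds(2)[OF \<sigma> N] unfolding R_def by blast
    define d where "d = 1 - 2 * c"
    have d: "d > 0" using c by (simp add: d_def)
    from Limsup_lessD[OF c(1)] K(2) M
    have "\<forall>\<^sub>F T in at_top. M T \<le> K / d * T"
      using eventually_gt_at_top[of 0]
    proof eventually_elim
      case (elim T)
      have MT: "M T > 0" using elim by linarith
      have "1/2 - R T / (2 * M T) < c" using elim(1) ratio[OF MT] elim(4) by simp
      then have "d * M T < R T" using MT by (simp add: d_def field_simps)
      then have "d * M T \<le> K * T" using elim by linarith
      then show ?case using d by (simp add: field_simps)
    qed
    moreover have "K / d > 0" using K d by simp
    ultimately show False using unbounded unfolding moment_bounded_iff M_def by blast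
  qed
qed

lemma mean_square_distance_small:
  assumes \<alpha>: "1/2 \<le> \<alpha>" "\<alpha> < \<sigma>" "\<sigma> < 1"
    and bd: "moment_bounded k \<alpha>" and \<epsilon>: "\<epsilon> > 0"
  shows "\<exists>N\<^sub>0\<ge>1. \<forall>N\<ge>N\<^sub>0. \<forall>\<^sub>F T in at_top.
    square_integral (\<lambda>s. zeta s ^ k - P_approx N s ^ k) \<sigma> 1 T \<le> \<epsilon> * T"
proof -
  define e where "e = \<epsilon> / 3"
  have e: "e > 0" using \<epsilon> by (simp add: e_def)
  obtain A0 where A0: "A0 > 0" "\<forall>\<^sub>F T in at_top. zeta_moment k \<alpha> T \<le> A0 * T"
    using bd unfolding moment_bounded_iff by blast
  have left0: "\<forall>\<^sub>F T in at_top. square_integral (\<lambda>s. zeta s ^ k) \<alpha> 1 T \<le> A0 * T"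
    by (rule square_integral_le_moment_bound[OF _ A0(2)]) (use \<alpha> in simp)
  \<comment> \<open>This eventually bounds the mean square of the difference on \<open>Re s = \<alpha>\<close> for every \<open>N\<close>, so that \<open>Y\<close>, then \<open>\<eta>\<close>, and only then \<open>N\<close> can be chosen.\<close>
  define A where "A = 4 * A0 + 2"
  have A: "A \<ge> 0" using A0 by (simp add: A_def)
  have "((\<lambda>Y. exp 8 * (2 * A * (Y powr (\<alpha> - \<sigma>))\<^sup>2)) \<longlongrightarrow> exp 8 * (2 * A * 0\<^sup>2)) at_top"
    using \<alpha> by (intro tendsto_intros tendsto_neg_powr filterlim_ident) auto
  then have "\<forall>\<^sub>F Y in at_top. exp 8 * (2 * A * (Y powr (\<alpha> - \<sigma>))\<^sup>2) < e"
    using e by (intro order_tendstoD(2)) auto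
  then have "\<forall>\<^sub>F Y in at_top. exp 8 * (2 * A * (Y powr (\<alpha> - \<sigma>))\<^sup>2) < e \<and> 1 \<le> Y"
    using eventually_ge_at_top by (rule eventually_conj)
  then obtain Y where Y: "exp 8 * (2 * A * (Y powr (\<alpha> - \<sigma>))\<^sup>2) < e" "Y \<ge> 1"
    by (auto simp: eventually_at_top_linorder)
  define y where "y = exp 8 * (Y powr (2 - \<sigma>))\<^sup>2"
  have y: "y > 0" using Y(2) by (simp add: y_def)
  define \<eta> where "\<eta> = sqrt (e / y)"
  have \<eta>: "\<eta> > 0" "\<eta>\<^sup>2 * y = e" using e y by (auto simp: \<eta>_def)
  obtain N\<^sub>0 where N\<^sub>0: "N\<^sub>0 \<ge> 1" "\<And>N t. N \<ge> N\<^sub>0 \<Longrightarrow> norm (zeta (Complex 2 t) ^ k - P_approx N (Complex 2 t) ^ k) \<le> \<eta>"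
    using zeta_power_minus_P_tendsto_0[OF \<eta>(1), of k] by blast
  have "\<forall>\<^sub>F T in at_top. square_integral (\<lambda>s. zeta s ^ k - P_approx N s ^ k) \<sigma> 1 T \<le> \<epsilon> * T"
    if NN: "N \<ge> N\<^sub>0" for N
  proof -
    have N: "N \<ge> 1" using N\<^sub>0(1) NN by simp
    obtain B where B: "B \<ge> 1" "\<And>x t. -2 \<le> x \<Longrightarrow> norm (P_approx N (Complex x t)) \<le> B"
      using P_approx_bounded[OF N] by blast
    have Ph: "(\<lambda>s. P_approx N s ^ k) holomorphic_on {s. Im s > 0}"
      by (intro holomorphic_intros P_approx_holomorphic)
    let ?g = "\<lambda>s. zeta s ^ k - P_approx N s ^ k"
    have gh: "?g holomorphic_on {s. Im s > 0}"
      by (intro holomorphic_on_diff zeta_power_holomorphic Ph)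
    have \<alpha>2: "\<alpha> \<le> 2" using \<alpha> by simp
    have left: "\<forall>\<^sub>F T in at_top. square_integral (?g) \<alpha> 1 T \<le> A * T"
      using left0 P_moment_le_zeta_moment[OF \<alpha>(1) \<alpha>2 N zero_less_one]
    proof eventually_elim
      case (elim T)
      have "square_integral (?g) \<alpha> 1 T \<le>
         2 * square_integral (\<lambda>s. zeta s ^ k) \<alpha> 1 T + 2 * square_integral (\<lambda>s. P_approx N s ^ k) \<alpha> 1 T"
        by (rule square_integral_add_le[OF zeta_power_holomorphic Ph _ norm_triangle_ineq4 gh]) simp
      with elim show ?case by (simp add: A_def algebra_simps)
    qed
    have "\<forall>\<^sub>F T in at_top. square_integral (?g) \<sigma> 1 T \<le>
       (exp 8 * (2 * A * (Y powr (\<alpha> - \<sigma>))\<^sup>2 + \<eta>\<^sup>2 * (Y powr (2 - \<sigma>))\<^sup>2) + e) * T"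
    proof (rule mean_square_interpolation[OF gh _ _ _ _ _ _ left])
      show "norm (?g (Complex x t)) \<le> (C + B ^ k) * t powr \<nu>" if x: "\<alpha> \<le> x" "x \<le> 2" and t: "1 \<le> t" for x t
      proof -
        have "norm (P_approx N (Complex x t) ^ k) \<le> B ^ k"
          unfolding norm_power using x \<alpha> B(2) by (intro power_mono) auto
        also have "\<dots> \<le> B ^ k * t powr \<nu>" using B(1) t by (intro const_le_growth) auto
        finally have "norm (P_approx N (Complex x t) ^ k) \<le> B ^ k * t powr \<nu>" .
        moreover have "norm (zeta (Complex x t) ^ k) \<le> C * t powr \<nu>" using x t \<alpha> by (intro growth) auto
        ultimately show ?thesis by (intro order_trans[OF norm_triangle_ineq4]) (simp add: algebra_simps)
      qed
      show "norm (?g (Complex 2 t)) \<le> \<eta>" for t by (rule N\<^sub>0(2)[OF NN])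
    qed (use \<alpha> \<nu> A Y e in auto)
    then show ?thesis using eventually_ge_at_top[of 0]
    proof eventually_elim
      case (elim T)
      have "exp 8 * (2 * A * (Y powr (\<alpha> - \<sigma>))\<^sup>2 + \<eta>\<^sup>2 * (Y powr (2 - \<sigma>))\<^sup>2) + e \<le> \<epsilon>"
        using Y(1) \<eta>(2) by (simp add: y_def e_def algebra_simps)
      then have "(exp 8 * (2 * A * (Y powr (\<alpha> - \<sigma>))\<^sup>2 + \<eta>\<^sup>2 * (Y powr (2 - \<sigma>))\<^sup>2) + e) * T \<le> \<epsilon> * T"
        using elim(2) by (rule mult_right_mono)
      with elim(1) show ?case by linarith
    qed
  qed
  then show ?thesis using N\<^sub>0(1) by blast
qed

lemma sin_moment_ratio_small:
  assumes \<alpha>: "1/2 \<le> \<alpha>" "\<alpha> < \<sigma>" "\<sigma> < 1"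
    and bd: "moment_bounded k \<alpha>" and \<epsilon>: "\<epsilon> > 0"
  shows "\<exists>N\<^sub>0. \<forall>N>N\<^sub>0. Limsup at_top (\<lambda>T. ereal (zeta_sin_moment k N \<sigma> T / zeta_moment k \<sigma> T)) < ereal \<epsilon>"
proof -
  \<comment> \<open>The integral up to \<open>1\<close> is eventually at most \<open>e T\<close> as well, and \<open>2 e T = (\<epsilon> / 2) (T / 4)\<close>.\<close>
  define e where "e = \<epsilon> / 16"
  have e: "e > 0" using \<epsilon> by (simp add: e_def)
  obtain N\<^sub>0 where N\<^sub>0: "\<And>N. N \<ge> N\<^sub>0 \<Longrightarrow> \<forall>\<^sub>F T in at_top.
      square_integral (\<lambda>s. zeta s ^ k - P_approx N s ^ k) \<sigma> 1 T \<le> e * T"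
    using mean_square_distance_small[OF \<alpha> bd e] by blast
  have \<sigma>1: "\<sigma> \<noteq> 1" "1/2 \<le> \<sigma>" using \<alpha> by auto
  have "Limsup at_top (\<lambda>T. ereal (zeta_sin_moment k N \<sigma> T / zeta_moment k \<sigma> T)) < ereal \<epsilon>" if NN: "N > N\<^sub>0" for N
  proof -
    let ?d = "\<lambda>t. (norm (zeta (Complex \<sigma> t) ^ k - P_approx N (Complex \<sigma> t) ^ k))\<^sup>2"
    have "\<forall>\<^sub>F T in at_top. integral {1..T} ?d \<le> e * T" using NN by (intro N\<^sub>0) simp
    then have "\<forall>\<^sub>F T in at_top. ereal (zeta_sin_moment k N \<sigma> T / zeta_moment k \<sigma> T) \<le> ereal (\<epsilon> / 2)"
      using zeta_moment_lower_bound[OF \<sigma>1(2) \<alpha>(3)] eventually_ge_at_top[of 1] eventually_ge_at_top[of "integral {0..1} ?d / e"]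
    proof eventually_elim
      case (elim T)
      have i: "?d integrable_on {0..T}"
        by (intro integrable_continuous_interval continuous_intros continuous_on_P_vertical continuous_on_zeta_vertical \<sigma>1)
      have MT: "zeta_moment k \<sigma> T > 0" using elim by linarith
      have "zeta_sin_moment k N \<sigma> T \<le> integral {0..T} ?d"
        using elim by (intro zeta_sin_moment_le \<sigma>1) auto
      also have "\<dots> = integral {0..1} ?d + integral {1..T} ?d"
        using elim i by (intro Henstock_Kurzweil_Integration.integral_combine[symmetric]) auto
      also have "\<dots> \<le> 2 * e * T" using elim e by (simp add: field_simps)
      also have "\<dots> = \<epsilon> / 2 * (T / 4)" by (simp add: e_def)
      also have "\<dots> \<le> \<epsilon> / 2 * zeta_moment k \<sigma> T" using elim \<epsilon> by (intro mult_left_mono) auto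
      finally show ?case using MT by (simp add: pos_divide_le_eq)
    qed
    then have "Limsup at_top (\<lambda>T. ereal (zeta_sin_moment k N \<sigma> T / zeta_moment k \<sigma> T)) \<le> ereal (\<epsilon> / 2)"
      by (rule Limsup_bounded)
    also have "\<dots> < ereal \<epsilon>" using \<epsilon> by simp
    finally show ?thesis .
  qed
  then show ?thesis by blast
qed

end

theorem theorem2:
  fixes k :: nat
  assumes "k \<ge> 1" and "zeta_mu (1/2) < ereal (1 / (2 * real k))"
  shows "(\<forall>\<sigma> N. 1/2 < \<sigma> \<and> \<sigma> < sigma_crit k \<and> N \<ge> 1 \<longrightarrow>
            Limsup at_top (\<lambda>T. ereal (zeta_sin_moment k N \<sigma> T / zeta_moment k \<sigma> T)) = ereal (1/2))
       \<and> (\<forall>\<sigma> \<epsilon>. sigma_crit k < \<sigma> \<and> \<sigma> < 1 \<and> \<epsilon> > 0 \<longrightarrow>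
            (\<exists>N\<^sub>0. \<forall>N>N\<^sub>0. Limsup at_top (\<lambda>T. ereal (zeta_sin_moment k N \<sigma> T / zeta_moment k \<sigma> T)) < ereal \<epsilon>))"
proof -
  obtain \<nu> C where "zeta_power_growth k \<nu> C" using zeta_power_growth_from_mu[OF assms] by blast
  then interpret zeta_power_growth k \<nu> C .
  define S where "S = {\<sigma>0 \<in> {1/2..<1}. \<forall>\<sigma>\<in>{\<sigma>0<..<1}. moment_bounded k \<sigma>}"
  have crit: "sigma_crit k = Inf S" by (simp add: sigma_crit_def S_def)
  \<comment> \<open>The infimum of the empty set of reals is an unspecified number, so \<open>S\<close> has to be inhabited.\<close>
  obtain \<sigma>1 where \<sigma>1: "\<sigma>1 \<in> S" using moment_bounded_near_1 by (auto simp: S_def)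
  have bdd: "bdd_below S" by (rule bdd_belowI[of _ "1/2"]) (simp add: S_def)
  show ?thesis
  proof (intro conjI allI impI)
    fix \<sigma> :: real and N :: nat
    assume *: "1/2 < \<sigma> \<and> \<sigma> < sigma_crit k \<and> N \<ge> 1"
    have "\<sigma> < \<sigma>1" using * cInf_lower[OF \<sigma>1 bdd] by (simp add: crit)
    then have \<sigma>: "1/2 \<le> \<sigma>" "\<sigma> < 1" using * \<sigma>1 by (auto simp: S_def)
    have "\<sigma> \<notin> S" using * cInf_lower[OF _ bdd, of \<sigma>] by (auto simp: crit)
    then obtain \<sigma>' where "\<sigma> < \<sigma>'" "\<sigma>' < 1" "\<not> moment_bounded k \<sigma>'"
      using \<sigma> by (auto simp: S_def)
    then have "\<not> moment_bounded k \<sigma>"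
      using moment_bounded_mono[OF \<sigma>(1)] by blast
    then show "Limsup at_top (\<lambda>T. ereal (zeta_sin_moment k N \<sigma> T / zeta_moment k \<sigma> T)) = ereal (1/2)"
      using * by (intro sin_moment_ratio_half \<sigma>) auto
  next
    fix \<sigma> \<epsilon> :: real
    assume *: "sigma_crit k < \<sigma> \<and> \<sigma> < 1 \<and> \<epsilon> > 0"
    then obtain \<sigma>0 where \<sigma>0: "\<sigma>0 \<in> S" "\<sigma>0 < \<sigma>"
      using cInf_lessD[of S \<sigma>] \<sigma>1 by (auto simp: crit)
    define \<alpha> where "\<alpha> = (\<sigma>0 + \<sigma>) / 2"
    have \<alpha>: "\<sigma>0 < \<alpha>" "\<alpha> < \<sigma>" "1/2 \<le> \<alpha>" using \<sigma>0 by (auto simp: \<alpha>_def S_def)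
    have "moment_bounded k \<alpha>" using \<sigma>0(1) \<alpha> * by (auto simp: S_def)
    then show "\<exists>N\<^sub>0. \<forall>N>N\<^sub>0. Limsup at_top (\<lambda>T. ereal (zeta_sin_moment k N \<sigma> T / zeta_moment k \<sigma> T)) < ereal \<epsilon>"
      using * by (intro sin_moment_ratio_small[OF \<alpha>(3,2)]) auto
  qed
qed

end
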